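(* Let $G$ be a Lie group with Lie algebra $\mathfrak g$, and let $E=E(g,\mu,\xi,\nu)$ be a smooth function on Tulczyjew's symplectic space ${}^{1}TT^*G=(G\circledS\mathfrak g_1^* )\circledS(\mathfrak g_2\circledS\mathfrak g_3^* )$. Hamilton's equation $i_{X_E}\Omega_{{}^{1}TT^*G}=-dE$ defines a Hamiltonian vector field $X_E$ whose value at each point $(g,\mu,\xi,\nu)$ is that of the right invariant vector field generated by the element $$\Big(\frac{\delta E}{\delta\nu},\ -\Big(\frac{\delta E}{\delta\xi}+ad^*_{\frac{\delta E}{\delta\nu}}\mu\Big),\ \frac{\delta E}{\delta\mu}-ad_\xi\frac{\delta E}{\delta\nu},\ -\Big(T_e^*R_g\frac{\delta E}{\delta g}+ad^*_\xi\frac{\delta E}{\delta\xi}+ad^*_\xi ad^*_{\frac{\delta E}{\delta\nu}}\mu\Big)\Big)$$ of the Lie algebra $(\mathfrak g\circledS\mathfrak g^* )\circledS(\mathfrak g\circledS\mathfrak g^* )$ (evaluated at that point). The components of $X_E$ give Hamilton's equations $$\dot g=T_eR_g\frac{\delta E}{\delta\nu},\qquad \dot\mu=-\frac{\delta E}{\delta\xi},\qquad \dot\xi=\frac{\delta E}{\delta\mu},\qquad \dot\nu=ad^*_{\frac{\delta E}{\delta\nu}}\nu-T_e^*R_g\frac{\delta E}{\delta g}.$$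
   Context: Conventions. $G$ is a (finite-dimensional) Lie group with identity $e$, $\mathfrak g=T_eG$, $\mathfrak g^*$ its dual, $\mathfrak g^{**}=\mathfrak g$. $R_g$ is right translation and $T_e^*R_g:T_g^*G\to\mathfrak g^*$ is the dual of $T_eR_g$. $Ad_g$ is the tangent map at $e$ of $h\mapsto g^{-1}hg$; the Lie bracket is $[\xi,\eta]=ad_\xi\eta=\frac{d}{dt}|_{t=0}Ad_{\exp(t\xi)}\eta$ (the bracket of right invariant vector fields). $\langle ad^*_\xi\mu,\eta\rangle=\langle\mu,[\xi,\eta]\rangle$. Partial derivatives: $\delta E/\delta g\in T_g^*G$, $\delta E/\delta\mu,\delta E/\delta\nu\in\mathfrak g$, $\delta E/\delta\xi\in\mathfrak g^*$. As a manifold ${}^{1}TT^*G=G\times\mathfrak g^*\times\mathfrak g\times\mathfrak g^*\ni(g,\mu,\xi,\nu)$ (subscripts on copies are only labels); it is the right trivialization of $T(G\circledS\mathfrak g^* )$. The right invariant vector field generated by $(\xi_2,\nu_2,\xi_3,\nu_3)\in\mathfrak g\times\mathfrak g^*\times\mathfrak g\times\mathfrak g^*$ is $$X_{(\xi_2,\nu_2,\xi_3,\nu_3)}(g,\mu,\xi,\nu)=(T_eR_g\xi_2,\ \nu_2+ad^*_{\xi_2}\mu,\ \xi_3+[\xi,\xi_2],\ \nu_3+ad^*_{\xi_2}\nu-ad^*_\xi\nu_2),$$ and the symplectic form is determined by $$\Omega_{{}^{1}TT^*G}(X_{(\xi_2,\nu_2,\xi_3,\nu_3)},X_{(\bar\xi_2,\bar\nu_2,\bar\xi_3,\bar\nu_3)})=\langle\nu_3,\bar\xi_2\rangle+\langle\nu_2,\bar\xi_3\rangle-\langle\bar\nu_2,\xi_3\rangle-\langle\bar\nu_3,\xi_2\rangle+\langle\nu,[\xi_2,\bar\xi_2]\rangle+\langle\mu,[\xi_3,\bar\xi_2]+[\xi_2,\bar\xi_3]+[\xi,[\xi_2,\bar\xi_2]]\rangle.$$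 *)

theory Defs
  imports "HOL-Analysis.Analysis"
begin

section \<open>Smooth maps on open subsets of normed spaces\<close>

text \<open>
  Meant for open \<open>S\<close> in a finite-dimensional space, where a function all of whose directional
  derivatives are \<open>C\<^sup>k\<close> is \<open>C\<^sup>k\<^sup>+\<^sup>1\<close>.
\<close>

primrec Ck_on :: "nat \<Rightarrow> 'v::real_normed_vector set \<Rightarrow> ('v \<Rightarrow> 'w::real_normed_vector) \<Rightarrow> bool" where
  "Ck_on 0 S f \<longleftrightarrow> continuous_on S f"
| "Ck_on (Suc k) S f \<longleftrightarrow>
     (\<forall>x\<in>S. f differentiable (at x)) \<and> (\<forall>v. Ck_on k S (\<lambda>x. frechet_derivative f (at x) v))"

definition smooth_on :: "'v::real_normed_vector set \<Rightarrow> ('v \<Rightarrow> 'w::real_normed_vector) \<Rightarrow> bool" where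
  "smooth_on S f \<longleftrightarrow> (\<forall>k. Ck_on k S f)"


section \<open>Smooth manifolds\<close>

text \<open>
  A smooth structure is presented by an atlas together with a preferred chart at each point (as
  with \<open>chartAt\<close> in Lean's mathlib); since every atlas can be thinned to the preferred charts,
  this is just a family \<open>C\<close>, where \<open>C x = (U, \<phi>)\<close> is a chart \<open>\<phi> : U \<rightarrow> 'e\<close> with \<open>x \<in> U\<close>.
  The values of \<open>\<phi>\<close> outside \<open>U\<close> are irrelevant.

  The tangent space at \<open>x\<close> is the model space \<open>'e\<close>: a tangent vector at \<open>x\<close> is given by its
  coordinates in the preferred chart at \<open>x\<close>. The cotangent space at \<open>x\<close> is the space
  \<open>'e \<Rightarrow>\<^sub>L real\<close> of (automatically bounded) linear functionals.

  The model space is a finite-dimensional inner product space instead of a type of class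
  \<open>euclidean_space\<close>, because the latter excludes dimension 0. The sort \<open>banach\<close> is no
  restriction in finite dimension.
\<close>

type_synonym ('a, 'e) charts = "'a \<Rightarrow> 'a set \<times> ('a \<Rightarrow> 'e)"

abbreviation chart_dom :: "('a, 'e) charts \<Rightarrow> 'a \<Rightarrow> 'a set" where
  "chart_dom C x \<equiv> fst (C x)"

abbreviation chart :: "('a, 'e) charts \<Rightarrow> 'a \<Rightarrow> 'a \<Rightarrow> 'e" where
  "chart C x \<equiv> snd (C x)"

abbreviation chart_inv :: "('a, 'e) charts \<Rightarrow> 'a \<Rightarrow> 'e \<Rightarrow> 'a" where
  "chart_inv C x \<equiv> inv_into (chart_dom C x) (chart C x)"

definition smooth_manifold ::
    "('a::{t2_space, second_countable_topology}, 'e::{real_inner, banach}) charts \<Rightarrow> bool" where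
  "smooth_manifold C \<longleftrightarrow>
     (\<exists>B::'e set. finite B \<and> span B = UNIV) \<and>
     (\<forall>x. x \<in> chart_dom C x \<and> open (chart_dom C x) \<and> open (chart C x ` chart_dom C x) \<and>
          homeomorphism (chart_dom C x) (chart C x ` chart_dom C x) (chart C x) (chart_inv C x)) \<and>
     (\<forall>x y. smooth_on (chart C x ` (chart_dom C x \<inter> chart_dom C y)) (chart C y \<circ> chart_inv C x))"

definition vec_charts :: "('v, 'v) charts" where
  "vec_charts = (\<lambda>_. (UNIV, id))"

definition prod_charts :: "('a, 'v) charts \<Rightarrow> ('b, 'w) charts \<Rightarrow> ('a \<times> 'b, 'v \<times> 'w) charts" where
  "prod_charts C D =
     (\<lambda>(x, y). (chart_dom C x \<times> chart_dom D y, map_prod (chart C x) (chart D y)))"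

definition smooth_map ::
    "('a::topological_space, 'v::real_normed_vector) charts \<Rightarrow>
     ('b::topological_space, 'w::real_normed_vector) charts \<Rightarrow> ('a \<Rightarrow> 'b) \<Rightarrow> bool" where
  "smooth_map C D f \<longleftrightarrow>
     continuous_on UNIV f \<and>
     (\<forall>x y. smooth_on (chart C x ` (chart_dom C x \<inter> f -` chart_dom D y))
               (chart D y \<circ> f \<circ> chart_inv C x))"

text \<open>The tangent map \<open>T\<^sub>x f : T\<^sub>x M \<rightarrow> T\<^sub>f\<^sub>(\<^sub>x\<^sub>) N\<close>.\<close>

definition tangent_map ::
    "('a, 'v::real_normed_vector) charts \<Rightarrow> ('b, 'w::real_normed_vector) charts \<Rightarrow>
     ('a \<Rightarrow> 'b) \<Rightarrow> 'a \<Rightarrow> 'v \<Rightarrow> 'w" where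
  "tangent_map C D f x =
     frechet_derivative (chart D (f x) \<circ> f \<circ> chart_inv C x) (at (chart C x x))"

text \<open>The curve \<open>\<gamma>\<close> is differentiable at time \<open>t\<close> with velocity \<open>v \<in> T\<^sub>\<gamma>\<^sub>(\<^sub>t\<^sub>) M\<close>.\<close>

definition has_velocity ::
    "('a::topological_space, 'v::real_normed_vector) charts \<Rightarrow> (real \<Rightarrow> 'a) \<Rightarrow> 'v \<Rightarrow> real \<Rightarrow> bool" where
  "has_velocity C \<gamma> v t \<longleftrightarrow>
     isCont \<gamma> t \<and> ((chart C (\<gamma> t) \<circ> \<gamma>) has_vector_derivative v) (at t)"

text \<open>
  A vector field assigns to \<open>x\<close> a vector in \<open>T\<^sub>x M\<close>, given in the preferred chart at \<open>x\<close>. To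
  express smoothness it is first transformed to one fixed chart, namely the one at \<open>y\<close>.
\<close>

definition smooth_vector_field ::
    "('a, 'v::real_normed_vector) charts \<Rightarrow> ('a \<Rightarrow> 'v) \<Rightarrow> bool" where
  "smooth_vector_field C X \<longleftrightarrow>
     (\<forall>y. smooth_on (chart C y ` chart_dom C y)
        (\<lambda>z. let x = chart_inv C y z
             in frechet_derivative (chart C y \<circ> chart_inv C x) (at (chart C x x)) (X x)))"

definition integral_curve_on ::
    "('a::topological_space, 'v::real_normed_vector) charts \<Rightarrow> ('a \<Rightarrow> 'v) \<Rightarrow> real set \<Rightarrow>
     (real \<Rightarrow> 'a) \<Rightarrow> bool" where
  "integral_curve_on C X J \<gamma> \<longleftrightarrow> (\<forall>t\<in>J. has_velocity C \<gamma> (X (\<gamma> t)) t)"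


section \<open>Lie groups\<close>

record ('a, 'e) lie_group_data =
  charts :: "('a, 'e) charts"
  gmult :: "'a \<Rightarrow> 'a \<Rightarrow> 'a"
  gone :: "'a"
  ginv :: "'a \<Rightarrow> 'a"

definition lie_group ::
    "('a::{t2_space, second_countable_topology}, 'e::{real_inner, banach}) lie_group_data \<Rightarrow> bool"
where
  "lie_group G \<longleftrightarrow>
     smooth_manifold (charts G) \<and>
     group (gmult G) (gone G) (ginv G) \<and>
     smooth_map (prod_charts (charts G) (charts G)) (charts G) (\<lambda>(g, h). gmult G g h) \<and>
     smooth_map (charts G) (charts G) (ginv G)"

text \<open>
  The Lie algebra \<open>\<gg> = T\<^sub>e G\<close> is the type \<open>'e\<close> (coordinates in the preferred chart at \<open>e\<close>), and
  \<open>\<gg>\<^sup>*\<close> is the type \<open>'e \<Rightarrow>\<^sub>L real\<close>, with \<open>blinfun_apply \<mu> \<xi>\<close> as the pairing of \<open>\<mu>\<close> and \<open>\<xi>\<close>.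
\<close>

type_synonym 'e dual = "'e \<Rightarrow>\<^sub>L real"

definition one_parameter_subgroup ::
    "('a::topological_space, 'e::real_normed_vector) lie_group_data \<Rightarrow> 'e \<Rightarrow> (real \<Rightarrow> 'a) \<Rightarrow> bool"
where
  "one_parameter_subgroup G \<xi> \<gamma> \<longleftrightarrow>
     smooth_map vec_charts (charts G) \<gamma> \<and>
     (\<forall>s t. \<gamma> (s + t) = gmult G (\<gamma> s) (\<gamma> t)) \<and>
     has_velocity (charts G) \<gamma> \<xi> 0"

definition lie_exp ::
    "('a::topological_space, 'e::real_normed_vector) lie_group_data \<Rightarrow> 'e \<Rightarrow> 'a" where
  "lie_exp G \<xi> = (THE \<gamma>. one_parameter_subgroup G \<xi> \<gamma>) 1"

definition Ad ::
    "('a, 'e::real_normed_vector) lie_group_data \<Rightarrow> 'a \<Rightarrow> 'e \<Rightarrow> 'e" where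
  "Ad G g = tangent_map (charts G) (charts G) (\<lambda>h. gmult G (gmult G (ginv G g) h) g) (gone G)"

text \<open>
  Since \<open>Ad\<^sub>g\<close> is the derivative of \<open>h \<mapsto> g\<^sup>-\<^sup>1 h g\<close>, this is the bracket of right invariant vector
  fields, i.e. the negative of the bracket of left invariant ones.
\<close>

definition ad ::
    "('a::topological_space, 'e::real_normed_vector) lie_group_data \<Rightarrow> 'e \<Rightarrow> 'e \<Rightarrow> 'e" where
  "ad G \<xi> \<eta> = vector_derivative (\<lambda>t. Ad G (lie_exp G (t *\<^sub>R \<xi>)) \<eta>) (at 0)"

definition coad ::
    "('a::topological_space, 'e::real_normed_vector) lie_group_data \<Rightarrow> 'e \<Rightarrow> 'e dual \<Rightarrow> 'e dual" where
  "coad G \<xi> \<mu> = Blinfun (\<lambda>\<eta>. blinfun_apply \<mu> (ad G \<xi> \<eta>))"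

text \<open>\<open>T\<^sub>e R\<^sub>g : \<gg> \<rightarrow> T\<^sub>g G\<close> and its dual \<open>T\<^sub>e\<^sup>* R\<^sub>g : T\<^sub>g\<^sup>* G \<rightarrow> \<gg>\<^sup>*\<close>.\<close>

definition TR :: "('a, 'e::real_normed_vector) lie_group_data \<Rightarrow> 'a \<Rightarrow> 'e \<Rightarrow> 'e" where
  "TR G g = tangent_map (charts G) (charts G) (\<lambda>h. gmult G h g) (gone G)"

definition TR_dual ::
    "('a, 'e::real_normed_vector) lie_group_data \<Rightarrow> 'a \<Rightarrow> 'e dual \<Rightarrow> 'e dual" where
  "TR_dual G g \<alpha> = Blinfun (\<lambda>\<eta>. blinfun_apply \<alpha> (TR G g \<eta>))"


section \<open>The symplectic space \<open>TT\<^sup>*G = G \<times> \<gg>\<^sup>* \<times> \<gg> \<times> \<gg>\<^sup>*\<close>\<close>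

type_synonym ('a, 'e) TTdual = "'a \<times> 'e dual \<times> 'e \<times> 'e dual"

text \<open>
  The tangent space at \<open>(g, \<mu>, \<xi>, \<nu>)\<close> is \<open>T\<^sub>g G \<times> \<gg>\<^sup>* \<times> \<gg> \<times> \<gg>\<^sup>*\<close>, while \<open>TT_algebra\<close> holds the
  generators of right invariant vector fields.
\<close>

type_synonym 'e TT_tangent = "'e \<times> 'e dual \<times> 'e \<times> 'e dual"
type_synonym 'e TT_algebra = "'e \<times> 'e dual \<times> 'e \<times> 'e dual"

definition TT_charts ::
    "('a, 'e::real_normed_vector) lie_group_data \<Rightarrow> (('a, 'e) TTdual, 'e TT_tangent) charts" where
  "TT_charts G = prod_charts (charts G) (prod_charts vec_charts (prod_charts vec_charts vec_charts))"

fun rinv_field ::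
    "('a::topological_space, 'e::real_normed_vector) lie_group_data \<Rightarrow> 'e TT_algebra \<Rightarrow>
     ('a, 'e) TTdual \<Rightarrow> 'e TT_tangent" where
  "rinv_field G (\<xi>\<^sub>2, \<nu>\<^sub>2, \<xi>\<^sub>3, \<nu>\<^sub>3) (g, \<mu>, \<xi>, \<nu>) =
     (TR G g \<xi>\<^sub>2,
      \<nu>\<^sub>2 + coad G \<xi>\<^sub>2 \<mu>,
      \<xi>\<^sub>3 + ad G \<xi> \<xi>\<^sub>2,
      \<nu>\<^sub>3 + coad G \<xi>\<^sub>2 \<nu> - coad G \<xi> \<nu>\<^sub>2)"

fun symplectic_on_generators ::
    "('a::topological_space, 'e::real_normed_vector) lie_group_data \<Rightarrow> ('a, 'e) TTdual \<Rightarrow>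
     'e TT_algebra \<Rightarrow> 'e TT_algebra \<Rightarrow> real" where
  "symplectic_on_generators G (g, \<mu>, \<xi>, \<nu>) (\<xi>\<^sub>2, \<nu>\<^sub>2, \<xi>\<^sub>3, \<nu>\<^sub>3) (\<eta>\<^sub>2, \<kappa>\<^sub>2, \<eta>\<^sub>3, \<kappa>\<^sub>3) =
     blinfun_apply \<nu>\<^sub>3 \<eta>\<^sub>2 + blinfun_apply \<nu>\<^sub>2 \<eta>\<^sub>3 - blinfun_apply \<kappa>\<^sub>2 \<xi>\<^sub>3 - blinfun_apply \<kappa>\<^sub>3 \<xi>\<^sub>2
     + blinfun_apply \<nu> (ad G \<xi>\<^sub>2 \<eta>\<^sub>2)
     + blinfun_apply \<mu> (ad G \<xi>\<^sub>3 \<eta>\<^sub>2 + ad G \<xi>\<^sub>2 \<eta>\<^sub>3 + ad G \<xi> (ad G \<xi>\<^sub>2 \<eta>\<^sub>2))"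

text \<open>
  Every tangent vector at \<open>p\<close> is the value at \<open>p\<close> of exactly one right invariant vector field,
  so the values on those fields determine the two-form.
\<close>

definition symplectic_form ::
    "('a::topological_space, 'e::real_normed_vector) lie_group_data \<Rightarrow> ('a, 'e) TTdual \<Rightarrow>
     'e TT_tangent \<Rightarrow> 'e TT_tangent \<Rightarrow> real" where
  "symplectic_form G p v w =
     symplectic_on_generators G p (THE a. rinv_field G a p = v) (THE b. rinv_field G b p = w)"

definition differential ::
    "('a, 'e::real_normed_vector) lie_group_data \<Rightarrow> (('a, 'e) TTdual \<Rightarrow> real) \<Rightarrow>
     ('a, 'e) TTdual \<Rightarrow> 'e TT_tangent \<Rightarrow> real" where
  "differential G E p = tangent_map (TT_charts G) vec_charts E p"

text \<open>Hamilton's equation \<open>i\<^sub>X \<Omega> = - dE\<close>.\<close>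

definition hamiltonian_vector_field ::
    "('a::topological_space, 'e::real_normed_vector) lie_group_data \<Rightarrow> (('a, 'e) TTdual \<Rightarrow> real) \<Rightarrow>
     (('a, 'e) TTdual \<Rightarrow> 'e TT_tangent) \<Rightarrow> bool" where
  "hamiltonian_vector_field G E X \<longleftrightarrow>
     smooth_vector_field (TT_charts G) X \<and>
     (\<forall>p v. symplectic_form G p (X p) v = - differential G E p v)"

text \<open>
  The partial derivatives; those in the directions of \<open>\<gg>\<^sup>*\<close> are elements of \<open>\<gg>\<^sup>*\<^sup>*\<close> and are
  identified with elements of \<open>\<gg>\<close>.
\<close>

fun \<delta>_g ::
    "('a, 'e::real_normed_vector) lie_group_data \<Rightarrow> (('a, 'e) TTdual \<Rightarrow> real) \<Rightarrow>
     ('a, 'e) TTdual \<Rightarrow> 'e dual" where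
  "\<delta>_g G E (g, \<mu>, \<xi>, \<nu>) = Blinfun (tangent_map (charts G) vec_charts (\<lambda>h. E (h, \<mu>, \<xi>, \<nu>)) g)"

fun \<delta>_\<mu> :: "(('a, 'e::real_normed_vector) TTdual \<Rightarrow> real) \<Rightarrow> ('a, 'e) TTdual \<Rightarrow> 'e" where
  "\<delta>_\<mu> E (g, \<mu>, \<xi>, \<nu>) =
     (THE x. \<forall>\<alpha>. frechet_derivative (\<lambda>m. E (g, m, \<xi>, \<nu>)) (at \<mu>) \<alpha> = blinfun_apply \<alpha> x)"

fun \<delta>_\<xi> :: "(('a, 'e::real_normed_vector) TTdual \<Rightarrow> real) \<Rightarrow> ('a, 'e) TTdual \<Rightarrow> 'e dual" where
  "\<delta>_\<xi> E (g, \<mu>, \<xi>, \<nu>) = Blinfun (frechet_derivative (\<lambda>x. E (g, \<mu>, x, \<nu>)) (at \<xi>))"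

fun \<delta>_\<nu> :: "(('a, 'e::real_normed_vector) TTdual \<Rightarrow> real) \<Rightarrow> ('a, 'e) TTdual \<Rightarrow> 'e" where
  "\<delta>_\<nu> E (g, \<mu>, \<xi>, \<nu>) =
     (THE x. \<forall>\<alpha>. frechet_derivative (\<lambda>n. E (g, \<mu>, \<xi>, n)) (at \<nu>) \<alpha> = blinfun_apply \<alpha> x)"

end

theory Submission
  imports Defs
begin

text \<open>
  A tangent vector at \<open>p\<close> is the value of exactly one right invariant field, so Hamilton's equation is
  linear algebra in the generators: comparing the coefficients of the four components of the test
  generator determines the generator of \<open>X\<^sub>E\<close>. The coefficients match by antisymmetry of the bracket and the
  Jacobi identity. These follow from \<open>Ad\<^bsub>hg\<^esub> = Ad\<^sub>g Ad\<^sub>h\<close> by differentiation, and from \<open>Ad\<^bsub>exp t\<xi>\<^esub> \<xi> = \<xi>\<close>,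
  once one-parameter subgroups are known to exist and to be unique. Such subgroups are the
  solutions of \<open>\<gamma>' = T\<^sub>e R\<^sub>\<gamma> \<xi>\<close>, obtained near \<open>0\<close> from the contraction principle and extended by powers.
  Everything is computed in charts. That compositions and derivatives of smooth functions are smooth
  rests on finite dimension, used in the form that the identity has finite rank.
\<close>

section \<open>Finite-rank operators\<close>

text \<open>\<open>Ck_on\<close> differentiates only in constant directions, and tangent vectors are
  coordinates in a preferred chart that may change abruptly from point to point. Because of the
  first, the chain rule, which produces directions varying with the point, needs an expansion in
  finitely many fixed directions. Because of the second, a field has to be rewritten in one fixed
  chart before its smoothness can be discussed; \<open>chart_TR\<close> and \<open>DE\<close> are
  such fixed-chart versions of T_eR_g and dE.

  \<open>ad\<close> is defined through \<open>lie_exp\<close>, a definite description, so even its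
  linearity in the first argument has to wait for existence and uniqueness of one-parameter
  subgroups. After that it is the derivative at the identity of z \<mapsto> Ad_z \<eta>.

  Uniqueness of X_E is pointwise linear algebra, but existence includes smoothness. The partial
  derivatives of E are given point by point as representing vectors or functionals; they are shown
  to vary smoothly by pairing them with test functionals or vectors, since each pairing is a
  directional derivative of E in a fixed chart.\<close>

inductive finrank :: "('v::real_normed_vector \<Rightarrow> 'w::real_normed_vector) \<Rightarrow> bool" where
  finrank_zero: "finrank (\<lambda>x. 0)"
| finrank_step: "finrank f \<Longrightarrow> bounded_linear c \<Longrightarrow> finrank (\<lambda>x. f x + c x *\<^sub>R b)"

text \<open>Finite dimension as a decomposition of the identity into rank-one maps
  \<open>\<lambda>x. c x *\<^sub>R b\<close>. A claim about \<open>P x\<close> is proved by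
  induction on \<open>finrank P\<close> and then read at the identity; this passes to products and
  duals without a choice of basis.\<close>

abbreviation findim :: "'v::real_normed_vector itself \<Rightarrow> bool" where
  "findim _ \<equiv> finrank (\<lambda>x::'v. x)"

lemma finrank_bounded_linear: "finrank f \<Longrightarrow> bounded_linear f"
  by (induction rule: finrank.induct)
    (auto intro: bounded_linear_zero bounded_linear_add
        bounded_linear_compose[OF bounded_linear_scaleR_left])

lemma finrank_add: "finrank g \<Longrightarrow> finrank f \<Longrightarrow> finrank (\<lambda>x. f x + g x)"
proof (induction g rule: finrank.induct)
  case finrank_zero
  then show ?case by simp
next
  case (finrank_step g c b)
  then show ?case
    using finrank.finrank_step[of "\<lambda>x. f x + g x" c b] by (simp add: add.assoc)
qed

lemma finrank_compose_left:
  assumes "bounded_linear h"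
  shows "finrank f \<Longrightarrow> finrank (\<lambda>x. h (f x))"
proof (induction f rule: finrank.induct)
  case finrank_zero
  then show ?case
    using finrank.finrank_zero by (simp add: linear_0[OF bounded_linear.linear[OF assms]])
next
  case (finrank_step f c b)
  have "(\<lambda>x. h (f x + c x *\<^sub>R b)) = (\<lambda>x. h (f x) + c x *\<^sub>R h b)"
    using assms by (simp add: bounded_linear.linear linear_add linear_scale)
  then show ?case
    using finrank.finrank_step[OF finrank_step.IH finrank_step.hyps(2), of "h b"] by simp
qed

lemma finrank_compose_right:
  assumes "bounded_linear h"
  shows "finrank f \<Longrightarrow> finrank (\<lambda>x. f (h x))"
proof (induction f rule: finrank.induct)
  case finrank_zero
  then show ?case by (rule finrank.finrank_zero)
next
  case (finrank_step f c b)
  then show ?case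
    using finrank.finrank_step[OF finrank_step.IH bounded_linear_compose[OF finrank_step.hyps(2) assms]]
    by simp
qed

lemma findim_prod:
  assumes "findim TYPE('v::real_normed_vector)" and "findim TYPE('w::real_normed_vector)"
  shows "findim TYPE('v \<times> 'w)"
proof -
  have 1: "finrank (\<lambda>x::'v \<times> 'w. (fst x, 0::'w))"
    using finrank_compose_right[OF bounded_linear_fst
        finrank_compose_left[OF bounded_linear_Pair[OF bounded_linear_ident bounded_linear_zero] assms(1)]]
    by simp
  have 2: "finrank (\<lambda>x::'v \<times> 'w. (0::'v, snd x))"
    using finrank_compose_right[OF bounded_linear_snd
        finrank_compose_left[OF bounded_linear_Pair[OF bounded_linear_zero bounded_linear_ident] assms(2)]]
    by simp
  show ?thesis
    using finrank_add[OF 2 1] by simp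
qed

text \<open>Precomposition with the identity of the space is the identity of the dual, and the
  summand \<open>c x *\<^sub>R b\<close> is transposed to the rank-one map sending \<mu> to \<mu>(b)
  times \<open>c\<close>.\<close>

lemma findim_dual:
  assumes "findim TYPE('v::real_normed_vector)"
  shows "findim TYPE('v \<Rightarrow>\<^sub>L real)"
proof -
  have "finrank (\<lambda>\<mu>::'v \<Rightarrow>\<^sub>L real. \<mu> o\<^sub>L Blinfun f)" if "finrank f" for f :: "'v \<Rightarrow> 'v"
    using that
  proof (induction f rule: finrank.induct)
    case finrank_zero
    have "(\<lambda>\<mu>::'v \<Rightarrow>\<^sub>L real. \<mu> o\<^sub>L Blinfun (\<lambda>x::'v. 0)) = (\<lambda>\<mu>. 0)"
      by (auto intro!: ext blinfun_eqI simp: bounded_linear_Blinfun_apply blinfun.zero_right)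
    then show ?case using finrank.finrank_zero by simp
  next
    case (finrank_step f c b)
    have f: "bounded_linear f" using finrank_step.hyps(1) by (rule finrank_bounded_linear)
    have fc: "bounded_linear (\<lambda>x. f x + c x *\<^sub>R b)"
      using finrank.finrank_step[OF finrank_step.hyps] by (rule finrank_bounded_linear)
    have "(\<lambda>\<mu>::'v \<Rightarrow>\<^sub>L real. \<mu> o\<^sub>L Blinfun (\<lambda>x. f x + c x *\<^sub>R b))
        = (\<lambda>\<mu>. (\<mu> o\<^sub>L Blinfun f) + blinfun_apply \<mu> b *\<^sub>R Blinfun c)"
      using finrank_step.hyps(2) f fc
      by (auto intro!: ext blinfun_eqI simp: bounded_linear_Blinfun_apply blinfun.bilinear_simps)
    then show ?case
      using finrank.finrank_step[OF finrank_step.IH blinfun.bounded_linear_left, of b "Blinfun c"] by simp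
  qed
  from this[OF assms] have "finrank (\<lambda>\<mu>::'v \<Rightarrow>\<^sub>L real. \<mu> o\<^sub>L Blinfun (\<lambda>x. x))" .
  moreover have "(\<lambda>\<mu>::'v \<Rightarrow>\<^sub>L real. \<mu> o\<^sub>L Blinfun (\<lambda>x. x)) = (\<lambda>\<mu>. \<mu>)"
    by (auto intro!: ext blinfun_eqI simp: bounded_linear_Blinfun_apply)
  ultimately show ?thesis by simp
qed

text \<open>A finite-rank \<open>P\<close> that fixes every element of \<open>B\<close> is the
  identity on the span of \<open>B\<close>. It is built one vector at a time.\<close>

lemma findim_if_finite_span:
  fixes B :: "'e::real_inner set"
  assumes "finite B" and "span B = UNIV"
  shows "findim TYPE('e)"
proof -
  have "\<exists>P::'e \<Rightarrow> 'e. finrank P \<and> (\<forall>x\<in>B. P x = x)"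
    using assms(1)
  proof (induction B)
    case empty
    then show ?case using finrank_zero by blast
  next
    case (insert b B)
    then obtain P :: "'e \<Rightarrow> 'e" where P: "finrank P" "\<And>x. x \<in> B \<Longrightarrow> P x = x" by auto
    define w where "w = b - P b"
    \<comment> \<open>This functional vanishes on vectors already fixed by \<open>P\<close> and
      takes the value 1 at \<open>b\<close>, so the new term repairs \<open>P\<close> at
      \<open>b\<close> without disturbing the others. For \<open>w = 0\<close> there is nothing to
      repair and the term is 0.\<close>
    define c where "c x = (x - P x) \<bullet> w / (w \<bullet> w)" for x
    have "bounded_linear (\<lambda>x. (x - P x) \<bullet> (w /\<^sub>R (w \<bullet> w)))"
      by (intro bounded_linear_compose[OF bounded_linear_inner_left] bounded_linear_sub
          bounded_linear_ident finrank_bounded_linear P)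
    then have "bounded_linear c" by (simp add: c_def[abs_def] divide_inverse mult.commute)
    then have "finrank (\<lambda>x. P x + c x *\<^sub>R w)" using P(1) by (rule finrank_step[rotated])
    moreover have "P x + c x *\<^sub>R w = x" if "x \<in> insert b B" for x
      using that P(2) by (cases "w = 0") (auto simp: c_def w_def)
    ultimately show ?case by blast
  qed
  then obtain P :: "'e \<Rightarrow> 'e" where P: "finrank P" "\<And>x. x \<in> B \<Longrightarrow> P x = x" by auto
  have "P x = x" for x
    using linear_eq_on_span[OF bounded_linear.linear[OF finrank_bounded_linear[OF P(1)]] linear_ident P(2)]
      assms(2) by auto
  then have "P = (\<lambda>x. x)" by auto
  with P(1) show ?thesis by simp
qed

lemma finrank_linear_compose_bounded:
  assumes "linear L"
  shows "finrank f \<Longrightarrow> bounded_linear (\<lambda>x. L (f x))"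
  by (induction f rule: finrank.induct)
    (auto simp: linear_0[OF assms] linear_add[OF assms] linear_scale[OF assms]
      intro: bounded_linear_zero bounded_linear_add bounded_linear_compose[OF bounded_linear_scaleR_left])

lemma findim_linear_bounded:
  fixes L :: "'v::real_normed_vector \<Rightarrow> 'w::real_normed_vector"
  shows "findim TYPE('v) \<Longrightarrow> linear L \<Longrightarrow> bounded_linear L"
  using finrank_linear_compose_bounded by force

text \<open>Applying \<open>L\<close> to the decomposition of \<alpha> composed with the identity
  shows the representing vector to be the sum of \<open>L (Blinfun c) *\<^sub>R b\<close> over the
  rank-one summands.\<close>

lemma findim_reflexive:
  fixes L :: "('v::real_normed_vector \<Rightarrow>\<^sub>L real) \<Rightarrow> real"
  assumes "findim TYPE('v)" and L: "linear L"
  shows "\<exists>x. \<forall>\<alpha>. L \<alpha> = blinfun_apply \<alpha> x"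
proof -
  have "\<exists>x. \<forall>\<alpha>. L (\<alpha> o\<^sub>L Blinfun f) = blinfun_apply \<alpha> x" if "finrank f" for f :: "'v \<Rightarrow> 'v"
    using that
  proof (induction f rule: finrank.induct)
    case finrank_zero
    have "\<alpha> o\<^sub>L Blinfun (\<lambda>x::'v. 0) = 0" for \<alpha> :: "'v \<Rightarrow>\<^sub>L real"
      by (auto intro!: blinfun_eqI simp: bounded_linear_Blinfun_apply blinfun.zero_right)
    then show ?case by (auto simp: linear_0[OF L] intro: exI[of _ 0])
  next
    case (finrank_step f c b)
    then obtain x where x: "\<And>\<alpha>. L (\<alpha> o\<^sub>L Blinfun f) = blinfun_apply \<alpha> x" by auto
    have fc: "bounded_linear (\<lambda>x. f x + c x *\<^sub>R b)"
      using finrank.finrank_step[OF finrank_step.hyps] by (rule finrank_bounded_linear)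
    have "\<alpha> o\<^sub>L Blinfun (\<lambda>x. f x + c x *\<^sub>R b)
        = (\<alpha> o\<^sub>L Blinfun f) + blinfun_apply \<alpha> b *\<^sub>R Blinfun c" for \<alpha> :: "'v \<Rightarrow>\<^sub>L real"
      using finrank_step.hyps(2) finrank_bounded_linear[OF finrank_step.hyps(1)] fc
      by (auto intro!: blinfun_eqI simp: bounded_linear_Blinfun_apply blinfun.bilinear_simps)
    then have "L (\<alpha> o\<^sub>L Blinfun (\<lambda>x. f x + c x *\<^sub>R b)) = blinfun_apply \<alpha> (x + L (Blinfun c) *\<^sub>R b)" for \<alpha>
      by (simp add: linear_add[OF L] linear_scale[OF L] x blinfun.bilinear_simps)
    then show ?case by blast
  qed
  from this[OF assms(1)] obtain x where "\<forall>\<alpha>. L (\<alpha> o\<^sub>L Blinfun (\<lambda>x. x)) = blinfun_apply \<alpha> x" ..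
  moreover have "\<alpha> o\<^sub>L Blinfun (\<lambda>x. x) = \<alpha>" for \<alpha> :: "'v \<Rightarrow>\<^sub>L real"
    by (auto intro!: blinfun_eqI simp: bounded_linear_Blinfun_apply)
  ultimately show ?thesis by auto
qed

section \<open>Smooth functions\<close>

lemma frechet_derivative_eq: "(f has_derivative f') (at x) \<Longrightarrow> frechet_derivative f (at x) = f'"
  using frechet_derivative_at by blast

lemma frechet_derivative_cong_open:
  assumes "open S" "x \<in> S" "\<And>y. y \<in> S \<Longrightarrow> f y = g y" "f differentiable (at x)"
  shows "g differentiable (at x)" "frechet_derivative g (at x) = frechet_derivative f (at x)"
proof -
  have "(f has_derivative frechet_derivative f (at x)) (at x)"
    using assms(4) by (simp add: frechet_derivative_works)
  then have "(g has_derivative frechet_derivative f (at x)) (at x)"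
    using has_derivative_transform_within_open[OF _ assms(1,2)] assms(3) by blast
  then show "g differentiable (at x)" "frechet_derivative g (at x) = frechet_derivative f (at x)"
    by (auto simp: differentiable_def frechet_derivative_eq)
qed

lemma frechet_derivative_linear:
  "f differentiable (at x) \<Longrightarrow> bounded_linear (frechet_derivative f (at x))"
  using frechet_derivative_works has_derivative_bounded_linear by blast

lemma Ck_on_cong:
  assumes "open S" "\<And>x. x \<in> S \<Longrightarrow> f x = g x" "Ck_on k S f"
  shows "Ck_on k S g"
  using assms
proof (induction k arbitrary: f g)
  case 0
  then show ?case by (auto cong: continuous_on_cong)
next
  case (Suc k)
  have *: "g differentiable (at x)" "frechet_derivative g (at x) = frechet_derivative f (at x)"
    if "x \<in> S" for x
    using frechet_derivative_cong_open[OF Suc.prems(1) that Suc.prems(2)] Suc.prems(3) that by auto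
  show ?case
    unfolding Ck_on.simps
  proof (intro conjI ballI allI)
    fix v
    show "Ck_on k S (\<lambda>x. frechet_derivative g (at x) v)"
      using Suc.IH[of "\<lambda>x. frechet_derivative f (at x) v" "\<lambda>x. frechet_derivative g (at x) v"]
        Suc.prems * by simp
  qed (use * in auto)
qed

lemma Ck_on_subset: "Ck_on k S f \<Longrightarrow> T \<subseteq> S \<Longrightarrow> Ck_on k T f"
  by (induction k arbitrary: f) (auto intro: continuous_on_subset)

lemma Ck_on_Suc_imp: "Ck_on (Suc k) S f \<Longrightarrow> Ck_on k S f"
proof (induction k arbitrary: f)
  case 0
  then show ?case
    by (auto intro!: continuous_at_imp_continuous_on differentiable_imp_continuous_within)
next
  case (Suc k)
  show ?case
    using Suc.prems Suc.IH unfolding Ck_on.simps(2)[of "Suc k"] Ck_on.simps(2)[of k S f] by blast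
qed

lemma Ck_on_local:
  "(\<And>x. x \<in> S \<Longrightarrow> \<exists>T. open T \<and> x \<in> T \<and> Ck_on k T f) \<Longrightarrow> Ck_on k S f"
proof (induction k arbitrary: f)
  case 0
  show ?case
    unfolding Ck_on.simps
  proof (rule continuous_at_imp_continuous_on, rule ballI)
    fix x assume "x \<in> S"
    then obtain T where "open T" "x \<in> T" "continuous_on T f" using 0 by auto
    then show "isCont f x" by (simp add: continuous_on_eq_continuous_at)
  qed
next
  case (Suc k)
  show ?case
    unfolding Ck_on.simps
  proof (intro conjI ballI allI)
    fix x assume "x \<in> S"
    then show "f differentiable (at x)" using Suc.prems by auto
  next
    fix v
    show "Ck_on k S (\<lambda>x. frechet_derivative f (at x) v)"
    proof (rule Suc.IH)
      fix x assume "x \<in> S"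
      then show "\<exists>T. open T \<and> x \<in> T \<and> Ck_on k T (\<lambda>x. frechet_derivative f (at x) v)"
        using Suc.prems[of x] by auto
    qed
  qed
qed

lemma Ck_on_const: "Ck_on k S (\<lambda>x. c)"
  by (induction k arbitrary: c) (auto simp: frechet_derivative_const)

lemma Ck_on_linear:
  assumes "bounded_linear h"
  shows "Ck_on k S h"
proof (cases k)
  case 0
  then show ?thesis by (simp add: assms linear_continuous_on)
next
  case (Suc l)
  have "(h has_derivative h) (at x)" for x
    using assms by (rule bounded_linear_imp_has_derivative)
  then have "frechet_derivative h (at x) = h" "h differentiable (at x)" for x
    by (auto simp: frechet_derivative_eq differentiable_def)
  then show ?thesis
    by (simp add: Suc Ck_on_const)
qed

lemma Ck_on_bounded_linear:
  assumes "bounded_linear h" "open S"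
  shows "Ck_on k S f \<Longrightarrow> Ck_on k S (\<lambda>x. h (f x))"
proof (induction k arbitrary: f)
  case 0
  then show ?case by (simp add: assms(1) bounded_linear.continuous_on)
next
  case (Suc k)
  have "((\<lambda>x. h (f x)) has_derivative (\<lambda>v. h (frechet_derivative f (at x) v))) (at x)" if "x \<in> S" for x
    using Suc.prems that
    by (intro bounded_linear.has_derivative[OF assms(1)]) (simp add: frechet_derivative_works)
  note * = this frechet_derivative_eq[OF this]
  show ?case
    unfolding Ck_on.simps
  proof (intro conjI ballI allI)
    fix v
    show "Ck_on k S (\<lambda>x. frechet_derivative (\<lambda>x. h (f x)) (at x) v)"
      by (rule Ck_on_cong[OF assms(2) _ Suc.IH[of "\<lambda>x. frechet_derivative f (at x) v"]])
        (use Suc.prems * in auto)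
  qed (use * in \<open>auto simp: differentiable_def\<close>)
qed

lemma Ck_on_add:
  assumes "open S"
  shows "Ck_on k S f \<Longrightarrow> Ck_on k S g \<Longrightarrow> Ck_on k S (\<lambda>x. f x + g x)"
proof (induction k arbitrary: f g)
  case 0
  then show ?case by (simp add: continuous_on_add)
next
  case (Suc k)
  have "((\<lambda>x. f x + g x) has_derivative
      (\<lambda>v. frechet_derivative f (at x) v + frechet_derivative g (at x) v)) (at x)" if "x \<in> S" for x
    using Suc.prems that by (intro has_derivative_add) (simp_all add: frechet_derivative_works)
  note * = this frechet_derivative_eq[OF this]
  show ?case
    unfolding Ck_on.simps
  proof (intro conjI ballI allI)
    fix v
    show "Ck_on k S (\<lambda>x. frechet_derivative (\<lambda>x. f x + g x) (at x) v)"
      by (rule Ck_on_cong[OF assms _ Suc.IH[of "\<lambda>x. frechet_derivative f (at x) v"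
              "\<lambda>x. frechet_derivative g (at x) v"]])
        (use Suc.prems * in auto)
  qed (use * in \<open>auto simp: differentiable_def\<close>)
qed

lemma Ck_on_bilinear:
  assumes "open S" "bounded_bilinear h"
  shows "Ck_on k S f \<Longrightarrow> Ck_on k S g \<Longrightarrow> Ck_on k S (\<lambda>x. h (f x) (g x))"
proof (induction k arbitrary: f g)
  case 0
  then show ?case by (simp add: assms(2) bounded_bilinear.continuous_on)
next
  case (Suc k)
  have "((\<lambda>x. h (f x) (g x)) has_derivative
      (\<lambda>v. h (f x) (frechet_derivative g (at x) v) + h (frechet_derivative f (at x) v) (g x))) (at x)"
    if "x \<in> S" for x
    using Suc.prems that
    by (intro bounded_bilinear.FDERIV[OF assms(2)]) (simp_all add: frechet_derivative_works)
  note * = this frechet_derivative_eq[OF this]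
  show ?case
    unfolding Ck_on.simps
  proof (intro conjI ballI allI)
    fix v
    have "Ck_on k S f" "Ck_on k S g" using Suc.prems Ck_on_Suc_imp by blast+
    then have "Ck_on k S (\<lambda>x. h (f x) (frechet_derivative g (at x) v)
        + h (frechet_derivative f (at x) v) (g x))"
      using Suc.prems by (intro Ck_on_add[OF assms(1)] Suc.IH) auto
    then show "Ck_on k S (\<lambda>x. frechet_derivative (\<lambda>x. h (f x) (g x)) (at x) v)"
      by (rule Ck_on_cong[OF assms(1), rotated]) (use * in auto)
  qed (use * in \<open>auto simp: differentiable_def\<close>)
qed

text \<open>The derivative of the composite applies the derivative of \<open>g\<close> to a
  direction that moves with \<open>x\<close>, while \<open>Ck_on\<close> controls it in fixed
  directions only. Decomposing the identity of the middle space turns this into a sum of scalars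
  times derivatives of \<open>g\<close> in fixed directions \<open>b\<close>, to which the induction
  hypothesis applies; hence the generalisation over \<open>g\<close>.\<close>

lemma Ck_on_compose:
  fixes f :: "'v::real_normed_vector \<Rightarrow> 'w::real_normed_vector"
  assumes fd: "findim TYPE('w)" and S: "open S" and T: "open T" and sub: "\<And>x. x \<in> S \<Longrightarrow> f x \<in> T"
  shows "Ck_on k S f \<Longrightarrow> Ck_on k T g \<Longrightarrow> Ck_on k S (\<lambda>x. g (f x))"
proof (induction k arbitrary: g)
  case 0
  then show ?case using sub by (auto intro!: continuous_on_compose2[of T g])
next
  case (Suc k)
  have "((\<lambda>x. g (f x)) has_derivative
      (\<lambda>v. frechet_derivative g (at (f x)) (frechet_derivative f (at x) v))) (at x)" if "x \<in> S" for x
    using Suc.prems that sub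
    by (intro has_derivative_compose[of f _ x UNIV g]) (simp_all add: frechet_derivative_works)
  note * = this frechet_derivative_eq[OF this]
  have f: "Ck_on k S f" using Suc.prems Ck_on_Suc_imp by blast
  have g: "bounded_linear (frechet_derivative g (at (f x)))" if "x \<in> S" for x
    using Suc.prems sub[OF that] by (auto intro: frechet_derivative_linear)
  show ?case
    unfolding Ck_on.simps
  proof (intro conjI ballI allI)
    fix v
    have "Ck_on k S (\<lambda>x. frechet_derivative g (at (f x)) (P (frechet_derivative f (at x) v)))"
      if "finrank P" for P
      using that
    proof (induction P rule: finrank.induct)
      case finrank_zero
      show ?case
        by (rule Ck_on_cong[OF S _ Ck_on_const[of _ _ 0]])
          (simp add: g linear_0 bounded_linear.linear)
    next
      case (finrank_step P c b)
      have "Ck_on k S (\<lambda>x. frechet_derivative g (at (f x)) (P (frechet_derivative f (at x) v))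
          + c (frechet_derivative f (at x) v) *\<^sub>R frechet_derivative g (at (f x)) b)"
        using Suc.prems finrank_step f
        by (intro Ck_on_add S Ck_on_bilinear[OF S bounded_bilinear_scaleR]
            Ck_on_bounded_linear[of c] Suc.IH[of "\<lambda>y. frechet_derivative g (at y) b"]) auto
      then show ?case
        by (rule Ck_on_cong[OF S, rotated])
          (simp add: g linear_add linear_scale bounded_linear.linear)
    qed
    from this[OF fd]
    show "Ck_on k S (\<lambda>x. frechet_derivative (\<lambda>x. g (f x)) (at x) v)"
      by (rule Ck_on_cong[OF S, rotated]) (use * in auto)
  qed (use * in \<open>auto simp: differentiable_def\<close>)
qed

text \<open>Smoothness of a germ, with one neighbourhood serving all orders. The closure rules then
  carry no open sets and chain freely, and functions need to agree only near the point.\<close>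

definition smooth_at :: "('v::real_normed_vector \<Rightarrow> 'w::real_normed_vector) \<Rightarrow> 'v \<Rightarrow> bool" where
  "smooth_at f x \<longleftrightarrow> (\<exists>S. open S \<and> x \<in> S \<and> smooth_on S f)"

lemma smooth_on_eq_smooth_at: "open S \<Longrightarrow> smooth_on S f \<longleftrightarrow> (\<forall>x\<in>S. smooth_at f x)"
proof
  assume "\<forall>x\<in>S. smooth_at f x"
  then show "smooth_on S f"
    unfolding smooth_on_def smooth_at_def by (intro allI Ck_on_local) blast
qed (auto simp: smooth_at_def)

lemma smooth_onD_differentiable: "smooth_on S f \<Longrightarrow> x \<in> S \<Longrightarrow> f differentiable (at x)"
  unfolding smooth_on_def by (drule spec[of _ "Suc 0"]) simp

lemma smooth_on_subset: "smooth_on S f \<Longrightarrow> T \<subseteq> S \<Longrightarrow> smooth_on T f"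
  unfolding smooth_on_def using Ck_on_subset by blast

lemma smooth_on_derivative: "smooth_on S f \<Longrightarrow> smooth_on S (\<lambda>x. frechet_derivative f (at x) v)"
  unfolding smooth_on_def
proof
  fix k assume "\<forall>k. Ck_on k S f"
  then show "Ck_on k S (\<lambda>x. frechet_derivative f (at x) v)"
    by (auto dest: spec[of _ "Suc k"])
qed

lemma smooth_at_differentiable: "smooth_at f x \<Longrightarrow> f differentiable (at x)"
  unfolding smooth_at_def using smooth_onD_differentiable by blast

lemma smooth_at_has_derivative:
  "smooth_at f x \<Longrightarrow> (f has_derivative frechet_derivative f (at x)) (at x)"
  using frechet_derivative_works smooth_at_differentiable by blast

lemma smooth_at_isCont: "smooth_at f x \<Longrightarrow> isCont f x"
  using smooth_at_differentiable differentiable_imp_continuous_within by blast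

lemma smooth_at_eventually: "smooth_at f x \<Longrightarrow> \<forall>\<^sub>F y in nhds x. smooth_at f y"
  unfolding smooth_at_def eventually_nhds by blast

lemma smooth_at_derivative_const:
  "smooth_at f x \<Longrightarrow> smooth_at (\<lambda>x. frechet_derivative f (at x) v) x"
  unfolding smooth_at_def using smooth_on_derivative by blast

lemma smooth_at_cong:
  assumes "smooth_at f x" "\<forall>\<^sub>F y in nhds x. f y = g y"
  shows "smooth_at g x"
proof -
  obtain S where S: "open S" "x \<in> S" "smooth_on S f" using assms(1) by (auto simp: smooth_at_def)
  obtain T where T: "open T" "x \<in> T" "\<And>y. y \<in> T \<Longrightarrow> f y = g y"
    using assms(2) by (auto simp: eventually_nhds)
  have "smooth_on (S \<inter> T) g"
    unfolding smooth_on_def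
  proof
    fix k
    have "Ck_on k (S \<inter> T) f"
      using S(3) Ck_on_subset[of k S f "S \<inter> T"] by (auto simp: smooth_on_def)
    then show "Ck_on k (S \<inter> T) g"
      by (rule Ck_on_cong[rotated 2]) (use S T in auto)
  qed
  then show ?thesis unfolding smooth_at_def using S T by (intro exI[of _ "S \<inter> T"]) auto
qed

lemma frechet_derivative_cong_ev:
  assumes "f differentiable (at x)" "\<forall>\<^sub>F y in nhds x. f y = g y"
  shows "frechet_derivative g (at x) = frechet_derivative f (at x)"
proof -
  obtain T where T: "open T" "x \<in> T" "\<And>y. y \<in> T \<Longrightarrow> f y = g y"
    using assms(2) by (auto simp: eventually_nhds)
  then show ?thesis by (rule frechet_derivative_cong_open(2)[OF _ _ _ assms(1)])
qed

lemma smooth_at_const: "smooth_at (\<lambda>x. c) x"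
  unfolding smooth_at_def smooth_on_def using Ck_on_const by (intro exI[of _ UNIV]) auto

lemma smooth_at_linear: "bounded_linear h \<Longrightarrow> smooth_at h x"
  unfolding smooth_at_def smooth_on_def using Ck_on_linear by (intro exI[of _ UNIV]) auto

lemma smooth_at_ident: "smooth_at (\<lambda>x. x) x"
  by (rule smooth_at_linear[OF bounded_linear_ident])

lemma smooth_at_bounded_linear: "bounded_linear h \<Longrightarrow> smooth_at f x \<Longrightarrow> smooth_at (\<lambda>x. h (f x)) x"
  unfolding smooth_at_def smooth_on_def by (metis Ck_on_bounded_linear)

lemma smooth_at_common:
  assumes "smooth_at f x" "smooth_at g x"
  shows "\<exists>S. open S \<and> x \<in> S \<and> smooth_on S f \<and> smooth_on S g"
proof -
  obtain S T where "open S" "x \<in> S" "smooth_on S f" "open T" "x \<in> T" "smooth_on T g"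
    using assms by (auto simp: smooth_at_def)
  then show ?thesis
    by (intro exI[of _ "S \<inter> T"])
      (simp add: open_Int smooth_on_subset[of S f "S \<inter> T"] smooth_on_subset[of T g "S \<inter> T"])
qed

lemma smooth_at_add: "smooth_at f x \<Longrightarrow> smooth_at g x \<Longrightarrow> smooth_at (\<lambda>x. f x + g x) x"
  using smooth_at_common[of f x g] unfolding smooth_at_def smooth_on_def
  by (metis Ck_on_add)

lemma smooth_at_bilinear:
  assumes "bounded_bilinear h" "smooth_at f x" "smooth_at g x"
  shows "smooth_at (\<lambda>x. h (f x) (g x)) x"
  using smooth_at_common[OF assms(2,3)] assms(1)
  unfolding smooth_at_def smooth_on_def by (metis Ck_on_bilinear)

lemma smooth_at_minus: "smooth_at f x \<Longrightarrow> smooth_at (\<lambda>x. - f x) x"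
  by (rule smooth_at_bounded_linear[OF bounded_linear_minus[OF bounded_linear_ident]])

lemma smooth_at_diff: "smooth_at f x \<Longrightarrow> smooth_at g x \<Longrightarrow> smooth_at (\<lambda>x. f x - g x) x"
  using smooth_at_add[OF _ smooth_at_minus] by fastforce

lemma smooth_at_Pair:
  assumes "smooth_at f x" "smooth_at g x"
  shows "smooth_at (\<lambda>x. (f x, g x)) x"
  using smooth_at_add[OF
      smooth_at_bounded_linear[OF bounded_linear_Pair[OF bounded_linear_ident bounded_linear_zero] assms(1)]
      smooth_at_bounded_linear[OF bounded_linear_Pair[OF bounded_linear_zero bounded_linear_ident] assms(2)]]
  by simp

lemma smooth_at_fst: "smooth_at f x \<Longrightarrow> smooth_at (\<lambda>x. fst (f x)) x"
  by (rule smooth_at_bounded_linear[OF bounded_linear_fst])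

lemma smooth_at_snd: "smooth_at f x \<Longrightarrow> smooth_at (\<lambda>x. snd (f x)) x"
  by (rule smooth_at_bounded_linear[OF bounded_linear_snd])

lemma smooth_at_compose:
  fixes f :: "'v::real_normed_vector \<Rightarrow> 'w::real_normed_vector"
  assumes "findim TYPE('w)" "smooth_at f x" "smooth_at g (f x)"
  shows "smooth_at (\<lambda>x. g (f x)) x"
proof -
  obtain T where T: "open T" "f x \<in> T" "smooth_on T g" using assms(3) by (auto simp: smooth_at_def)
  obtain S where S: "open S" "x \<in> S" "smooth_on S f" using assms(2) by (auto simp: smooth_at_def)
  have "\<forall>\<^sub>F y in nhds x. f y \<in> T"
    using smooth_at_isCont[OF assms(2)] T(1,2)
    by (auto simp: continuous_at tendsto_at_iff_tendsto_nhds intro: topological_tendstoD)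
  then obtain R where R: "open R" "x \<in> R" "\<And>y. y \<in> R \<Longrightarrow> f y \<in> T" by (auto simp: eventually_nhds)
  have "smooth_on (S \<inter> R) (\<lambda>x. g (f x))"
    unfolding smooth_on_def
  proof
    fix k
    show "Ck_on k (S \<inter> R) (\<lambda>x. g (f x))"
      by (rule Ck_on_compose[OF assms(1) _ T(1)])
        (use S R T Ck_on_subset[of k S f "S \<inter> R"] in \<open>auto simp: smooth_on_def\<close>)
  qed
  then show ?thesis unfolding smooth_at_def using S R by (intro exI[of _ "S \<inter> R"]) auto
qed

text \<open>Base point and direction vary together, again by decomposing the direction. Derivatives
  depending on parameters, such as \<open>chart_TR\<close>, \<open>Ad\<close> and \<open>DE\<close>,
  are treated with this rule.\<close>

lemma smooth_at_derivative:
  fixes f :: "'v::real_normed_vector \<Rightarrow> 'w::real_normed_vector" and u :: "'z::real_normed_vector \<Rightarrow> 'v"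
  assumes "findim TYPE('v)" "smooth_at u z" "smooth_at f (u z)" "smooth_at v z"
  shows "smooth_at (\<lambda>z. frechet_derivative f (at (u z)) (v z)) z"
proof -
  have ev: "\<forall>\<^sub>F y in nhds z. smooth_at f (u y)"
    using smooth_at_isCont[OF assms(2)] smooth_at_eventually[OF assms(3)]
    by (auto simp: continuous_at tendsto_at_iff_tendsto_nhds dest: eventually_compose_filterlim)
  have "smooth_at (\<lambda>z. frechet_derivative f (at (u z)) (P (v z))) z" if "finrank P" for P
    using that
  proof (induction P rule: finrank.induct)
    case finrank_zero
    show ?case
      by (rule smooth_at_cong[OF smooth_at_const[of 0]])
        (auto intro: eventually_mono[OF ev] simp: linear_0 bounded_linear.linear
            frechet_derivative_linear smooth_at_differentiable)
  next
    case (finrank_step P c b)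
    have "smooth_at (\<lambda>z. frechet_derivative f (at (u z)) (P (v z))
        + c (v z) *\<^sub>R frechet_derivative f (at (u z)) b) z"
      by (intro smooth_at_add finrank_step.IH smooth_at_bilinear[OF bounded_bilinear_scaleR]
          smooth_at_bounded_linear[OF finrank_step.hyps(2)] assms(4)
          smooth_at_compose[OF assms(1,2) smooth_at_derivative_const[OF assms(3)]])
    then show ?case
      by (rule smooth_at_cong)
        (auto intro: eventually_mono[OF ev] simp: linear_add linear_scale bounded_linear.linear
            frechet_derivative_linear smooth_at_differentiable)
  qed
  from this[OF assms(1)] show ?thesis .
qed

lemma smooth_at_derivative_compose:
  fixes f :: "'v::real_normed_vector \<Rightarrow> 'w::real_normed_vector"
  assumes "smooth_at f x" "smooth_at g (f x)"
  shows "frechet_derivative (\<lambda>x. g (f x)) (at x) v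
    = frechet_derivative g (at (f x)) (frechet_derivative f (at x) v)"
  using has_derivative_compose[OF smooth_at_has_derivative[OF assms(1)] smooth_at_has_derivative[OF assms(2)]]
  by (simp add: frechet_derivative_eq)

section \<open>Smooth maps from normed spaces into a Lie group\<close>

lemma eventually_in_open:
  assumes "isCont f z" "open S" "f z \<in> S"
  shows "\<forall>\<^sub>F w in nhds z. f w \<in> S"
  using assms by (auto simp: continuous_at tendsto_at_iff_tendsto_nhds intro: topological_tendstoD)

lemma inv_into_map_prod:
  assumes "inj_on f A" "inj_on g B" "u \<in> f ` A" "v \<in> g ` B"
  shows "inv_into (A \<times> B) (map_prod f g) (u, v) = (inv_into A f u, inv_into B g v)"
  using assms by (intro inv_into_f_eq) (auto simp: map_prod_inj_on inv_into_into f_inv_into_f)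

lemma smooth_on_cong:
  "open S \<Longrightarrow> (\<And>x. x \<in> S \<Longrightarrow> f x = g x) \<Longrightarrow> smooth_on S f \<Longrightarrow> smooth_on S g"
  unfolding smooth_on_def using Ck_on_cong[of S f g] by blast

locale lie =
  fixes G :: "('a::{t2_space, second_countable_topology}, 'e::{real_inner, banach}) lie_group_data"
  assumes lie_group: "lie_group G"
begin

abbreviation U :: "'a \<Rightarrow> 'a set" where "U x \<equiv> chart_dom (charts G) x"
abbreviation \<phi> :: "'a \<Rightarrow> 'a \<Rightarrow> 'e" where "\<phi> x \<equiv> chart (charts G) x"
abbreviation \<psi> :: "'a \<Rightarrow> 'e \<Rightarrow> 'a" where "\<psi> x \<equiv> chart_inv (charts G) x"
abbreviation V :: "'a \<Rightarrow> 'e set" where "V x \<equiv> \<phi> x ` U x"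
abbreviation mul :: "'a \<Rightarrow> 'a \<Rightarrow> 'a" (infixl "\<odot>" 70) where "x \<odot> y \<equiv> gmult G x y"
abbreviation id_elt :: 'a ("\<^bold>e") where "\<^bold>e \<equiv> gone G"
abbreviation \<iota> :: "'a \<Rightarrow> 'a" where "\<iota> \<equiv> ginv G"

sublocale grp: group "gmult G" "gone G" "ginv G"
  using lie_group by (simp add: lie_group_def)

lemma manifold: "smooth_manifold (charts G)"
  using lie_group by (simp add: lie_group_def)

lemma findim_model: "findim TYPE('e)"
  using manifold findim_if_finite_span by (auto simp: smooth_manifold_def)

lemma findim_model2: "findim TYPE('e \<times> 'e)"
  by (intro findim_prod findim_model)

lemma findim_TT: "findim TYPE('e TT_tangent)"
  by (intro findim_prod findim_dual findim_model)

lemma in_U [simp]: "x \<in> U x" and open_U: "open (U x)" and open_V: "open (V x)"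
  using manifold by (auto simp: smooth_manifold_def)

lemma homeo: "homeomorphism (U x) (V x) (\<phi> x) (\<psi> x)"
  using manifold by (auto simp: smooth_manifold_def)

lemma psi_phi [simp]: "x \<in> U y \<Longrightarrow> \<psi> y (\<phi> y x) = x"
  using homeo[of y] by (auto simp: homeomorphism_def)

lemma phi_psi: "z \<in> V y \<Longrightarrow> \<phi> y (\<psi> y z) = z"
  using homeo[of y] by (auto simp: homeomorphism_def)

lemma psi_in: "z \<in> V y \<Longrightarrow> \<psi> y z \<in> U y"
  using homeo[of y] by (auto simp: homeomorphism_def)

lemma inj_phi: "inj_on (\<phi> y) (U y)"
  using psi_phi by (metis inj_on_inverseI)

lemma isCont_phi: "x \<in> U y \<Longrightarrow> isCont (\<phi> y) x"
  using homeo[of y] open_U by (auto simp: homeomorphism_def continuous_on_eq_continuous_at)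

lemma isCont_psi: "z \<in> V y \<Longrightarrow> isCont (\<psi> y) z"
  using homeo[of y] open_V[of y] by (auto simp: homeomorphism_def continuous_on_eq_continuous_at)

lemma open_phi_image:
  assumes "open W" "W \<subseteq> U y"
  shows "open (\<phi> y ` W)"
proof -
  have "\<phi> y ` W = \<psi> y -` W \<inter> V y"
    using assms(2) phi_psi by (auto simp: subset_iff)
  moreover have "continuous_on (V y) (\<psi> y)" using homeo[of y] by (simp add: homeomorphism_def)
  ultimately show ?thesis
    using assms(1) open_V[of y] by (simp add: continuous_on_open_vimage)
qed

lemma smooth_transition:
  assumes "z \<in> V x" "\<psi> x z \<in> U y"
  shows "smooth_at (\<lambda>w. \<phi> y (\<psi> x w)) z"
proof -
  have "smooth_on (\<phi> x ` (U x \<inter> U y)) (\<phi> y \<circ> \<psi> x)"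
    using manifold by (auto simp: smooth_manifold_def)
  moreover have "z \<in> \<phi> x ` (U x \<inter> U y)"
    using assms psi_in[of z x] phi_psi[of z x] by (metis IntI image_eqI)
  moreover have "open (\<phi> x ` (U x \<inter> U y))"
    by (intro open_phi_image) (auto intro: open_U)
  ultimately show ?thesis by (auto simp: smooth_at_def comp_def)
qed

text \<open>Continuity is demanded separately because the values of a chart outside its domain are
  arbitrary: it guarantees that the coordinates near \<open>z\<close> mean something.\<close>

definition smooth_into :: "('v::real_normed_vector \<Rightarrow> 'a) \<Rightarrow> 'v \<Rightarrow> bool" where
  "smooth_into f z \<longleftrightarrow> isCont f z \<and> smooth_at (\<lambda>w. \<phi> (f z) (f w)) z"

lemma smooth_into_isCont: "smooth_into f z \<Longrightarrow> isCont f z"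
  by (simp add: smooth_into_def)

text \<open>Composition with the transition map; by continuity the values of \<open>f\<close> near
  \<open>z\<close> stay in the domain of the first chart, where the two expressions agree.\<close>

lemma smooth_at_change_chart:
  assumes "isCont f z" "f z \<in> U x" "f z \<in> U y" "smooth_at (\<lambda>w. \<phi> x (f w)) z"
  shows "smooth_at (\<lambda>w. \<phi> y (f w)) z"
proof (rule smooth_at_cong)
  show "smooth_at (\<lambda>w. \<phi> y (\<psi> x (\<phi> x (f w)))) z"
    by (rule smooth_at_compose[OF findim_model assms(4) smooth_transition]) (use assms in auto)
  show "\<forall>\<^sub>F w in nhds z. \<phi> y (\<psi> x (\<phi> x (f w))) = \<phi> y (f w)"
    using eventually_in_open[OF assms(1) open_U assms(2)] by (rule eventually_mono) simp
qed

lemma smooth_intoI: "isCont f z \<Longrightarrow> f z \<in> U y \<Longrightarrow> smooth_at (\<lambda>w. \<phi> y (f w)) z \<Longrightarrow> smooth_into f z"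
  unfolding smooth_into_def using smooth_at_change_chart[of z f y "f z"] by simp

lemma smooth_intoD: "smooth_into f z \<Longrightarrow> f z \<in> U y \<Longrightarrow> smooth_at (\<lambda>w. \<phi> y (f w)) z"
  unfolding smooth_into_def using smooth_at_change_chart[of z f "f z" y] by simp

lemma smooth_into_const: "smooth_into (\<lambda>z. x) z"
  by (simp add: smooth_into_def smooth_at_const)

lemma smooth_into_psi:
  assumes "u \<in> V y"
  shows "smooth_into (\<psi> y) u"
proof (rule smooth_intoI)
  show "smooth_at (\<lambda>w. \<phi> y (\<psi> y w)) u"
    by (rule smooth_at_cong[OF smooth_at_ident])
      (use assms open_V in \<open>auto simp: eventually_nhds phi_psi intro!: exI[of _ "V y"]\<close>)
qed (use assms in \<open>auto intro: isCont_psi psi_in\<close>)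

lemma smooth_into_compose:
  fixes g :: "'v::real_normed_vector \<Rightarrow> 'w::real_normed_vector"
  assumes "findim TYPE('w)" "smooth_at g z" "smooth_into f (g z)"
  shows "smooth_into (\<lambda>z. f (g z)) z"
  unfolding smooth_into_def
proof
  show "isCont (\<lambda>z. f (g z)) z"
    using isCont_o2[OF smooth_at_isCont[OF assms(2)], where g = f] assms(3) by (simp add: smooth_into_def)
  show "smooth_at (\<lambda>w. \<phi> (f (g z)) (f (g w))) z"
    using assms(3) by (intro smooth_at_compose[OF assms(1,2)]) (simp add: smooth_into_def)
qed

lemma isCont_mult:
  assumes "isCont f z" "isCont g z"
  shows "isCont (\<lambda>z. f z \<odot> g z) z"
proof -
  have "continuous_on UNIV (\<lambda>(g, h). g \<odot> h)"
    using lie_group by (simp add: lie_group_def smooth_map_def)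
  then have "isCont (\<lambda>(g, h). g \<odot> h) (f z, g z)" by (simp add: continuous_on_eq_continuous_at)
  moreover have "isCont (\<lambda>z. (f z, g z)) z" using assms by (rule continuous_Pair)
  ultimately show ?thesis using isCont_o2[where f = "\<lambda>z. (f z, g z)" and g = "\<lambda>(g, h). g \<odot> h"] by simp
qed

lemma isCont_ginv: "isCont f z \<Longrightarrow> isCont (\<lambda>z. \<iota> (f z)) z"
proof -
  have "continuous_on UNIV \<iota>"
    using lie_group by (simp add: lie_group_def smooth_map_def)
  then show "isCont f z \<Longrightarrow> ?thesis" using isCont_o2[where f = f and g = \<iota>] by (simp add: continuous_on_eq_continuous_at)
qed

lemma smooth_ginv_chart:
  assumes "u \<in> V a" "\<iota> (\<psi> a u) \<in> U y"
  shows "smooth_at (\<lambda>u. \<phi> y (\<iota> (\<psi> a u))) u"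
proof -
  have "smooth_on (\<phi> a ` (U a \<inter> \<iota> -` U y)) (\<phi> y \<circ> \<iota> \<circ> \<psi> a)"
    using lie_group by (simp add: lie_group_def smooth_map_def)
  moreover have "u \<in> \<phi> a ` (U a \<inter> \<iota> -` U y)"
    using assms psi_in[of u a] phi_psi[of u a] by (metis IntI image_eqI vimage_eq)
  moreover have "continuous_on UNIV \<iota>"
    using lie_group by (simp add: lie_group_def smooth_map_def)
  then have "open (\<phi> a ` (U a \<inter> \<iota> -` U y))"
    by (intro open_phi_image open_Int open_U open_vimage) auto
  ultimately show ?thesis by (auto simp: smooth_at_def comp_def)
qed

text \<open>\<open>smooth_map\<close> expresses smoothness of the multiplication through the inverse
  of a product chart; \<open>inv_into_map_prod\<close> splits it into the two chart
  inverses.\<close>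

lemma smooth_mult_chart:
  assumes "u \<in> V a" "v \<in> V b" "\<psi> a u \<odot> \<psi> b v \<in> U y"
  shows "smooth_at (\<lambda>p. \<phi> y (\<psi> a (fst p) \<odot> \<psi> b (snd p))) (u, v)"
proof -
  let ?m = "\<lambda>(g, h). g \<odot> h"
  let ?S = "U a \<times> U b \<inter> ?m -` U y"
  let ?W = "map_prod (\<phi> a) (\<phi> b) ` ?S"
  let ?F = "\<lambda>p. \<psi> a (fst p) \<odot> \<psi> b (snd p)"
  have sm: "smooth_on ?W (\<phi> y \<circ> ?m \<circ> inv_into (U a \<times> U b) (map_prod (\<phi> a) (\<phi> b)))"
    using lie_group by (simp add: lie_group_def smooth_map_def prod_charts_def)
  \<comment> \<open>As the preimage of an open set under a map continuous on an open set,
    \<open>?W\<close> is open, which turns smoothness on \<open>?W\<close> into smoothness at a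
    point.\<close>
  have W: "?W = ?F -` U y \<inter> (V a \<times> V b)"
  proof
    show "?W \<subseteq> ?F -` U y \<inter> (V a \<times> V b)" by auto
    show "?F -` U y \<inter> (V a \<times> V b) \<subseteq> ?W"
    proof
      fix p assume "p \<in> ?F -` U y \<inter> (V a \<times> V b)"
      then have "(\<psi> a (fst p), \<psi> b (snd p)) \<in> ?S" "p = map_prod (\<phi> a) (\<phi> b) (\<psi> a (fst p), \<psi> b (snd p))"
        by (auto simp: psi_in phi_psi)
      then show "p \<in> ?W" by (rule image_eqI[rotated])
    qed
  qed
  have F: "continuous_on (V a \<times> V b) ?F"
  proof (rule continuous_at_imp_continuous_on, rule ballI)
    fix p assume "p \<in> V a \<times> V b"
    then have "isCont (\<psi> a) (fst p)" "isCont (\<psi> b) (snd p)" by (auto intro: isCont_psi)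
    then show "isCont ?F p"
      by (intro isCont_mult isCont_o2[OF isCont_fst[OF continuous_ident], where g = "\<psi> a"]
          isCont_o2[OF isCont_snd[OF continuous_ident], where g = "\<psi> b"])
  qed
  have oW: "open ?W"
    unfolding W using F open_U open_V by (simp add: continuous_on_open_vimage open_Times)
  have "smooth_on ?W (\<lambda>p. \<phi> y (?F p))"
  proof (rule smooth_on_cong[OF oW _ sm])
    fix p assume "p \<in> ?W"
    then have "fst p \<in> V a" "snd p \<in> V b" unfolding W by auto
    then have "inv_into (U a \<times> U b) (map_prod (\<phi> a) (\<phi> b)) (fst p, snd p) = (\<psi> a (fst p), \<psi> b (snd p))"
      by (intro inv_into_map_prod inj_phi)
    then show "(\<phi> y \<circ> ?m \<circ> inv_into (U a \<times> U b) (map_prod (\<phi> a) (\<phi> b))) p = \<phi> y (?F p)" by simp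
  qed
  moreover have "(u, v) \<in> ?W" unfolding W using assms by simp
  ultimately show ?thesis using oW unfolding smooth_at_def by blast
qed

lemma smooth_into_ginv:
  assumes "smooth_into f z"
  shows "smooth_into (\<lambda>z. \<iota> (f z)) z"
  unfolding smooth_into_def
proof
  show "isCont (\<lambda>z. \<iota> (f z)) z" using assms by (intro isCont_ginv) (simp add: smooth_into_def)
  let ?y = "\<iota> (f z)"
  have "smooth_at (\<lambda>w. \<phi> ?y (\<iota> (\<psi> (f z) (\<phi> (f z) (f w))))) z"
    by (rule smooth_at_compose[OF findim_model smooth_intoD[OF assms] smooth_ginv_chart]) auto
  then show "smooth_at (\<lambda>w. \<phi> ?y (\<iota> (f w))) z"
    by (rule smooth_at_cong)
      (use eventually_in_open[OF smooth_into_isCont[OF assms] open_U, of "f z"] in \<open>auto elim: eventually_mono\<close>)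
qed

lemma smooth_into_mult:
  assumes "smooth_into f z" "smooth_into g z"
  shows "smooth_into (\<lambda>z. f z \<odot> g z) z"
  unfolding smooth_into_def
proof
  show "isCont (\<lambda>z. f z \<odot> g z) z" using assms by (intro isCont_mult) (auto simp: smooth_into_def)
  let ?y = "f z \<odot> g z"
  have "smooth_at (\<lambda>w. \<phi> ?y (\<psi> (f z) (fst (\<phi> (f z) (f w), \<phi> (g z) (g w)))
      \<odot> \<psi> (g z) (snd (\<phi> (f z) (f w), \<phi> (g z) (g w))))) z"
    by (rule smooth_at_compose[OF findim_model2
          smooth_at_Pair[OF smooth_intoD[OF assms(1)] smooth_intoD[OF assms(2)]] smooth_mult_chart]) auto
  moreover have "\<forall>\<^sub>F w in nhds z. f w \<in> U (f z) \<and> g w \<in> U (g z)"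
    using eventually_in_open[OF smooth_into_isCont[OF assms(1)] open_U, of "f z"]
      eventually_in_open[OF smooth_into_isCont[OF assms(2)] open_U, of "g z"] by (simp add: eventually_conj)
  then have "\<forall>\<^sub>F w in nhds z. \<phi> ?y (\<psi> (f z) (fst (\<phi> (f z) (f w), \<phi> (g z) (g w)))
      \<odot> \<psi> (g z) (snd (\<phi> (f z) (f w), \<phi> (g z) (g w)))) = \<phi> ?y (f w \<odot> g w)"
    by (rule eventually_mono) simp
  ultimately show "smooth_at (\<lambda>w. \<phi> ?y (f w \<odot> g w)) z"
    by (rule smooth_at_cong)
qed

section \<open>Charts of the phase space and the energy\<close>

lemma TT_dom: "chart_dom (TT_charts G) p = U (fst p) \<times> UNIV"
  and TT_chart: "chart (TT_charts G) p = map_prod (\<phi> (fst p)) id"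
  by (cases p; simp add: TT_charts_def prod_charts_def vec_charts_def split_def map_prod.id)+

lemma TT_chart_inv:
  assumes "z \<in> V (fst p) \<times> UNIV"
  shows "chart_inv (TT_charts G) p z = (\<psi> (fst p) (fst z), snd z)"
  using inv_into_map_prod[OF inj_phi inj_on_id, of "fst z" "fst p" "snd z" UNIV] assms
  by (cases z) (auto simp: TT_dom TT_chart)

lemma TT_image: "chart (TT_charts G) p ` chart_dom (TT_charts G) p = V (fst p) \<times> UNIV"
  unfolding TT_dom TT_chart by (auto simp: map_prod_surj_on)

lemma smooth_energy_chart:
  assumes E: "smooth_map (TT_charts G) vec_charts (E :: ('a, 'e) TTdual \<Rightarrow> real)" and z: "fst z \<in> V a"
  shows "smooth_at (\<lambda>z. E (\<psi> a (fst z), snd z)) z"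
proof -
  \<comment> \<open>Charts of the phase space depend on the group component alone, so the zeros are
    arbitrary.\<close>
  let ?p = "(a, 0, 0, 0) :: ('a, 'e) TTdual"
  have W: "open (V a \<times> (UNIV :: ('e dual \<times> 'e \<times> 'e dual) set))"
    by (intro open_Times open_V open_UNIV)
  have "smooth_on (chart (TT_charts G) ?p ` (chart_dom (TT_charts G) ?p \<inter> E -` UNIV))
      (id \<circ> E \<circ> chart_inv (TT_charts G) ?p)"
    using E unfolding smooth_map_def vec_charts_def by auto
  then have "smooth_on (V a \<times> UNIV) (E \<circ> chart_inv (TT_charts G) ?p)"
    using TT_image[of ?p] by simp
  then have "smooth_on (V a \<times> UNIV) (\<lambda>z. E (\<psi> a (fst z), snd z))"
    by (rule smooth_on_cong[OF W, rotated]) (simp add: TT_chart_inv)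
  then show ?thesis using W z by (auto simp: smooth_at_def mem_Times_iff intro!: exI[of _ "V a \<times> UNIV"])
qed

end

section \<open>Ordinary differential equations\<close>

text \<open>Each directional derivative is continuous at \<open>c\<close>, hence bounded nearby. A
  finite-rank \<open>P\<close> involves only finitely many directions \<open>b\<close>, which makes
  the bound uniform in \<open>v\<close>.\<close>

lemma finrank_derivative_bounded:
  assumes "finrank P" and F: "smooth_at F c"
  shows "\<exists>K\<ge>0. \<forall>\<^sub>F x in nhds c. \<forall>v. norm (frechet_derivative F (at x) (P v)) \<le> K * norm v"
  using assms(1)
proof (induction P rule: finrank.induct)
  case finrank_zero
  have "\<forall>\<^sub>F x in nhds c. frechet_derivative F (at x) 0 = 0"
    using smooth_at_eventually[OF F]
    by (rule eventually_mono)
      (simp add: linear_0 bounded_linear.linear frechet_derivative_linear smooth_at_differentiable)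
  then show ?case by (intro exI[of _ 0]) (auto elim: eventually_mono)
next
  case (finrank_step P k b)
  then obtain K where K: "K \<ge> 0"
    "\<forall>\<^sub>F x in nhds c. \<forall>v. norm (frechet_derivative F (at x) (P v)) \<le> K * norm v" by auto
  define N where "N = norm (frechet_derivative F (at c) b) + 1"
  have "isCont (\<lambda>x. norm (frechet_derivative F (at x) b)) c"
    using smooth_at_isCont[OF smooth_at_derivative_const[OF F]] by (rule continuous_norm)
  then have "((\<lambda>x. norm (frechet_derivative F (at x) b)) \<longlongrightarrow> norm (frechet_derivative F (at c) b)) (nhds c)"
    unfolding continuous_at
    using tendsto_at_iff_tendsto_nhds[of "\<lambda>x. norm (frechet_derivative F (at x) b)" c] by simp
  then have N: "\<forall>\<^sub>F x in nhds c. norm (frechet_derivative F (at x) b) < N"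
    by (rule order_tendstoD) (simp add: N_def)
  have "\<forall>\<^sub>F x in nhds c. \<forall>v. norm (frechet_derivative F (at x) (P v + k v *\<^sub>R b)) \<le> (K + onorm k * N) * norm v"
    using K(2) N smooth_at_eventually[OF F]
  proof eventually_elim
    case (elim x)
    have l: "linear (frechet_derivative F (at x))"
      using elim(3) by (simp add: bounded_linear.linear frechet_derivative_linear smooth_at_differentiable)
    show ?case
    proof
      fix v
      have "norm (frechet_derivative F (at x) (P v + k v *\<^sub>R b))
          \<le> norm (frechet_derivative F (at x) (P v)) + \<bar>k v\<bar> * norm (frechet_derivative F (at x) b)"
        unfolding linear_add[OF l] linear_scale[OF l]
        by (rule order_trans[OF norm_triangle_ineq]) simp
      also have "\<dots> \<le> K * norm v + (onorm k * norm v) * N"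
        using elim(1,2) onorm[OF finrank_step.hyps(2), of v] onorm_pos_le[OF finrank_step.hyps(2)]
        by (intro add_mono mult_mono) auto
      finally show "norm (frechet_derivative F (at x) (P v + k v *\<^sub>R b)) \<le> (K + onorm k * N) * norm v"
        by (simp add: algebra_simps)
    qed
  qed
  moreover have "K + onorm k * N \<ge> 0"
    using K(1) onorm_pos_le[OF finrank_step.hyps(2)] by (simp add: N_def)
  ultimately show ?case by blast
qed

text \<open>Mean value inequality on a ball, which is convex; half the radius \<open>d\<close> puts
  the closed ball inside the region where the derivative is bounded.\<close>

lemma smooth_at_imp_locally_lipschitz:
  fixes F :: "'v::real_normed_vector \<Rightarrow> 'w::real_normed_vector"
  assumes "findim TYPE('v)" and F: "smooth_at F c"
  obtains r L where "r > 0" "L \<ge> 0"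
    "\<And>x y. x \<in> cball c r \<Longrightarrow> y \<in> cball c r \<Longrightarrow> norm (F x - F y) \<le> L * norm (x - y)"
proof -
  obtain L where L: "L \<ge> 0" "\<forall>\<^sub>F x in nhds c. \<forall>v. norm (frechet_derivative F (at x) v) \<le> L * norm v"
    using finrank_derivative_bounded[OF assms] by auto
  have "\<forall>\<^sub>F x in nhds c. smooth_at F x \<and> (\<forall>v. norm (frechet_derivative F (at x) v) \<le> L * norm v)"
    using smooth_at_eventually[OF F] L(2) by (rule eventually_conj)
  then obtain d where d: "d > 0"
    "\<And>x. dist x c < d \<Longrightarrow> smooth_at F x \<and> (\<forall>v. norm (frechet_derivative F (at x) v) \<le> L * norm v)"
    by (auto simp: eventually_nhds_metric)
  have *: "smooth_at F x" "\<And>v. norm (frechet_derivative F (at x) v) \<le> L * norm v"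
    if "x \<in> cball c (d/2)" for x
    using that d by (auto simp: dist_commute)
  have "norm (F x - F y) \<le> L * norm (x - y)" if "x \<in> cball c (d/2)" "y \<in> cball c (d/2)" for x y
    by (rule differentiable_bound[OF convex_cball _ _ that])
      (use * in \<open>auto intro!: has_derivative_at_withinI[OF smooth_at_has_derivative]
          intro!: onorm_bound[OF L(1)]\<close>)
  then show ?thesis using that[of "d/2" L] d(1) L(1) by simp
qed

text \<open>The points \<open>s\<close> and \<open>t\<close> may come in either order, so
  differences of integrals from the left end serve in place of oriented integrals.\<close>

lemma primitive_bound:
  fixes h :: "real \<Rightarrow> 'v::banach"
  assumes h: "continuous_on {a..b} h" "\<And>t. t \<in> {a..b} \<Longrightarrow> norm (h t) \<le> K"
    and "t \<in> {a..b}" "s \<in> {a..b}"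
  shows "norm (integral {a..t} h - integral {a..s} h) \<le> K * \<bar>t - s\<bar>"
proof -
  have "norm (integral {a..t} h - integral {a..s} h) \<le> K * norm (t - s)"
  proof (rule differentiable_bound[OF _ _ _ assms(3,4)])
    fix u assume u: "u \<in> {a..b}"
    show "((\<lambda>t. integral {a..t} h) has_derivative (\<lambda>x. x *\<^sub>R h u)) (at u within {a..b})"
      using integral_has_vector_derivative[OF h(1) u] by (simp add: has_vector_derivative_def)
    show "onorm (\<lambda>x. x *\<^sub>R h u) \<le> K"
      using h(2)[OF u] by (intro onorm_le) (simp add: mult.commute[of K] mult_left_mono)
  qed simp
  then show ?thesis by simp
qed

text \<open>Picard iteration, as a contraction of the complete set of bounded continuous functions
  on the line with values in the ball.\<close>

lemma ode_local_existence:
  fixes F :: "'v::banach \<Rightarrow> 'v"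
  assumes r: "r > 0" and L: "L \<ge> 0"
    and lip: "\<And>x y. x \<in> cball c r \<Longrightarrow> y \<in> cball c r \<Longrightarrow> norm (F x - F y) \<le> L * norm (x - y)"
  obtains a x where "a > 0" "x 0 = c"
    "\<And>t. t \<in> {-a<..<a} \<Longrightarrow> x t \<in> cball c r"
    "\<And>t. t \<in> {-a<..<a} \<Longrightarrow> (x has_vector_derivative F (x t)) (at t)"
proof -
  define M where "M = norm (F c) + L * r"
  \<comment> \<open>\<open>M\<close> bounds the field on the ball, so the first term keeps the
    iterates in the ball during time \<open>a\<close>; the second yields the contraction factor 1/2.
    The added 1s keep the denominators positive.\<close>
  define a where "a = min (r / (M + 1)) (1 / (2 * (L + 1)))"
  have M0: "M \<ge> 0" using r L by (simp add: M_def)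
  have a0: "a > 0" using r L M0 by (simp add: a_def)
  have aM: "M * a \<le> r"
  proof -
    have "a * (M + 1) \<le> r" using M0 by (simp add: a_def pos_le_divide_eq[symmetric])
    then show ?thesis using a0 by (simp add: algebra_simps)
  qed
  have aL: "L * a \<le> 1/2"
  proof -
    have "a \<le> 1 / (2 * (L + 1))" by (simp add: a_def)
    then have "a * (2 * (L + 1)) \<le> 1" using L by (simp add: pos_le_divide_eq)
    then show ?thesis using a0 by (simp add: algebra_simps)
  qed
  have FM: "norm (F x) \<le> M" if "x \<in> cball c r" for x
  proof -
    have "norm (F x) \<le> norm (F c) + norm (F x - F c)" by (metis add_diff_cancel_left' diff_add_cancel norm_triangle_ineq)
    also have "norm (F x - F c) \<le> L * norm (x - c)" using lip[OF that] r by simp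
    also have "\<dots> \<le> L * r" using that L by (intro mult_left_mono) (auto simp: dist_norm norm_minus_commute)
    finally show ?thesis by (simp add: M_def)
  qed
  have Fcont: "continuous_on (cball c r) F"
  proof (rule lipschitz_on_continuous_on)
    show "L-lipschitz_on (cball c r) F"
      using lip L by (intro lipschitz_onI) (auto simp: dist_norm)
  qed
  \<comment> \<open>Freezing time outside \<open>{-a..a}\<close> makes every iterate a bounded
    continuous function on the whole line.\<close>
  define clamp where "clamp t = max (-a) (min a t)" for t :: real
  have clamp: "clamp t \<in> {-a..a}" for t using a0 by (auto simp: clamp_def)
  have clamp_id: "clamp t = t" if "t \<in> {-a..a}" for t using that by (auto simp: clamp_def)
  have clamp_cont: "continuous_on UNIV clamp" unfolding clamp_def[abs_def] by (intro continuous_intros)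
  define X where "X = (PiC UNIV (\<lambda>_. cball c r) :: (real \<Rightarrow>\<^sub>C 'v) set)"
  have X: "x \<in> X \<longleftrightarrow> (\<forall>t. apply_bcontfun x t \<in> cball c r)" for x
    by (auto simp: X_def mem_PiC_iff Pi_iff)
  define h where "h x = (\<lambda>t. F (apply_bcontfun x t))" for x :: "real \<Rightarrow>\<^sub>C 'v"
  \<comment> \<open>The difference is the oriented integral from 0 to \<open>clamp t\<close>, for
    times of either sign.\<close>
  define T0 where "T0 x t = c + (integral {-a..clamp t} (h x) - integral {-a..0} (h x))" for x t
  have hc: "continuous_on {-a..a} (h x)" if "x \<in> X" for x
    unfolding h_def using that by (intro continuous_on_compose2[OF Fcont]) (auto simp: X)
  have hi: "(h x) integrable_on {-a..t}" if "x \<in> X" "t \<in> {-a..a}" for x t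
    using that by (intro integrable_continuous_real continuous_on_subset[OF hc]) auto
  have hder: "((\<lambda>u. integral {-a..u} (h x)) has_vector_derivative h x t) (at t within {-a..a})"
    if "x \<in> X" "t \<in> {-a..a}" for x t
    using integral_has_vector_derivative[OF hc[OF that(1)] that(2)] .
  have T0b: "T0 x t \<in> cball c r" if "x \<in> X" for x t
  proof -
    have "norm (integral {-a..clamp t} (h x) - integral {-a..0} (h x)) \<le> M * \<bar>clamp t - 0\<bar>"
      by (rule primitive_bound[OF hc[OF that]]) (use that clamp a0 FM in \<open>auto simp: h_def X\<close>)
    also have "\<dots> \<le> M * a" using clamp[of t] M0 by (intro mult_left_mono) auto
    finally show ?thesis using aM by (simp add: T0_def dist_norm norm_minus_commute)
  qed
  have T0c: "continuous_on UNIV (T0 x)" if "x \<in> X" for x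
  proof -
    have "continuous_on {-a..a} (\<lambda>u. integral {-a..u} (h x))"
      unfolding continuous_on_eq_continuous_within
      using hder[OF that] by (blast intro: has_vector_derivative_continuous)
    then have "continuous_on UNIV (\<lambda>t. integral {-a..clamp t} (h x))"
      using clamp by (intro continuous_on_compose2[OF _ clamp_cont]) auto
    then show ?thesis unfolding T0_def[abs_def] by (intro continuous_intros)
  qed
  have T0in: "T0 x \<in> bcontfun" if "x \<in> X" for x
  proof -
    have "bounded (range (T0 x))"
      by (rule bounded_subset[OF bounded_cball[of c r]]) (use T0b[OF that] in blast)
    then show ?thesis unfolding bcontfun_def using T0c[OF that] by simp
  qed
  define T where "T x = Bcontfun (T0 x)" for x
  have T: "apply_bcontfun (T x) = T0 x" if "x \<in> X" for x
    unfolding T_def by (rule Bcontfun_inverse[OF T0in[OF that]])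
  have "\<exists>!x\<in>X. T x = x"
  proof (rule Banach_fix[of X "1/2"])
    show "complete X" unfolding X_def complete_eq_closed by (intro closed_PiC) simp
    have "const_bcontfun c \<in> X" using r by (simp add: X)
    then show "X \<noteq> {}" by blast
    show "T ` X \<subseteq> X" using T0b by (auto simp: X T)
    fix x y assume xy: "x \<in> X" "y \<in> X"
    show "dist (T x) (T y) \<le> 1/2 * dist x y"
    proof (rule dist_bound)
        fix t
        let ?d = "\<lambda>s. h x s - h y s"
        have i: "integral {-a..s} ?d = integral {-a..s} (h x) - integral {-a..s} (h y)" if "s \<in> {-a..a}" for s
          using hi xy that by (intro integral_diff) auto
        have "T0 x t - T0 y t = integral {-a..clamp t} ?d - integral {-a..0} ?d"
          using clamp a0 by (simp add: i T0_def)
        also have "norm \<dots> \<le> (L * dist x y) * \<bar>clamp t - 0\<bar>"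
        proof (rule primitive_bound)
          show "continuous_on {-a..a} ?d" using hc xy by (intro continuous_on_diff) auto
          fix s assume "s \<in> {-a..a}"
          have "norm (?d s) \<le> L * norm (apply_bcontfun x s - apply_bcontfun y s)"
            unfolding h_def using xy by (intro lip) (auto simp: X)
          also have "\<dots> \<le> L * dist x y"
            using dist_bounded[of x s y] L by (intro mult_left_mono) (auto simp: dist_norm)
          finally show "norm (?d s) \<le> L * dist x y" .
        qed (use clamp a0 in auto)
        also have "\<dots> \<le> (L * dist x y) * a" using clamp[of t] L by (intro mult_left_mono) auto
        also have "\<dots> = (L * a) * dist x y" by simp
        also have "\<dots> \<le> 1/2 * dist x y" using aL by (intro mult_right_mono) auto
        finally show "dist (apply_bcontfun (T x) t) (apply_bcontfun (T y) t) \<le> 1/2 * dist x y"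
          using xy by (simp add: T dist_norm)
    qed
  qed auto
  then obtain x where x: "x \<in> X" "T x = x" by auto
  have xT: "apply_bcontfun x t = T0 x t" for t using T[OF x(1)] x(2) by simp
  show ?thesis
  proof (rule that[of a "apply_bcontfun x"])
    show "a > 0" by (rule a0)
    show "apply_bcontfun x 0 = c" using a0 clamp_id[of 0] by (simp add: xT T0_def)
    show "apply_bcontfun x t \<in> cball c r" for t using x(1) by (simp add: X)
    fix t assume t: "t \<in> {-a<..<a}"
    then have "((\<lambda>u. integral {-a..u} (h x)) has_vector_derivative h x t) (at t)"
      using hder[OF x(1), of t] at_within_interior[of t "{-a..a}"] by simp
    then have "((\<lambda>u. c + (integral {-a..u} (h x) - integral {-a..0} (h x))) has_vector_derivative h x t) (at t)"
      by (auto intro!: derivative_eq_intros)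
    then have "(apply_bcontfun x has_vector_derivative h x t) (at t)"
    proof (rule has_vector_derivative_transform_within_open[where S = "{-a<..<a}"])
      fix s assume "s \<in> {-a<..<a}"
      then show "c + (integral {-a..s} (h x) - integral {-a..0} (h x)) = apply_bcontfun x s"
        using clamp_id[of s] by (simp add: xT T0_def)
    qed (use t in auto)
    then show "(apply_bcontfun x has_vector_derivative F (apply_bcontfun x t)) (at t)" by (simp add: h_def)
  qed
qed

text \<open>Gronwall's argument: by Cauchy-Schwarz and the Lipschitz bound, the squared distance
  damped by exp(-2Lt) is nonincreasing, and it starts at 0.\<close>

lemma ode_unique_forward:
  fixes x y :: "real \<Rightarrow> 'v::real_inner"
  assumes lip: "\<And>u v. u \<in> D \<Longrightarrow> v \<in> D \<Longrightarrow> norm (F u - F v) \<le> L * norm (u - v)"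
    and x: "\<And>t. t \<in> {0..b} \<Longrightarrow> x t \<in> D \<and> (x has_vector_derivative F (x t)) (at t)"
    and y: "\<And>t. t \<in> {0..b} \<Longrightarrow> y t \<in> D \<and> (y has_vector_derivative F (y t)) (at t)"
    and "x 0 = y 0" "0 \<le> b"
  shows "x b = y b"
proof -
  define u where "u t = ((x t - y t) \<bullet> (x t - y t)) * exp (- (2 * L * t))" for t
  have "u b \<le> u 0"
  proof (rule DERIV_nonpos_imp_nonincreasing[OF \<open>0 \<le> b\<close>])
    fix t assume "0 \<le> t" "t \<le> b"
    then have t: "t \<in> {0..b}" by simp
    let ?w = "x t - y t" and ?w' = "F (x t) - F (y t)"
    have "(x has_derivative (\<lambda>s. s *\<^sub>R F (x t))) (at t)" "(y has_derivative (\<lambda>s. s *\<^sub>R F (y t))) (at t)"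
      using x[OF t] y[OF t] by (simp_all add: has_vector_derivative_def)
    then have "((\<lambda>t. (x t - y t) \<bullet> (x t - y t)) has_derivative (\<lambda>s. s * (2 * (?w \<bullet> ?w')))) (at t)"
      by (auto intro!: derivative_eq_intros ext
          simp: algebra_simps inner_commute inner_add_left inner_diff_left inner_add_right inner_diff_right)
    then have "((\<lambda>t. (x t - y t) \<bullet> (x t - y t)) has_real_derivative 2 * (?w \<bullet> ?w')) (at t)"
      by (rule has_derivative_imp_has_field_derivative) simp
    moreover have "((\<lambda>t. exp (- (2 * L * t))) has_real_derivative - (2 * L) * exp (- (2 * L * t))) (at t)"
      by (auto intro!: derivative_eq_intros)
    ultimately have "(u has_real_derivative (2 * (?w \<bullet> ?w') - 2 * L * (?w \<bullet> ?w)) * exp (- (2 * L * t))) (at t)"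
      unfolding u_def[abs_def] by (rule DERIV_mult[THEN DERIV_cong]) (simp add: left_diff_distrib)
    moreover have "?w \<bullet> ?w' \<le> L * (?w \<bullet> ?w)"
    proof -
      have "?w \<bullet> ?w' \<le> norm ?w * norm ?w'" by (rule norm_cauchy_schwarz)
      also have "\<dots> \<le> norm ?w * (L * norm ?w)" using lip x[OF t] y[OF t] by (intro mult_left_mono) auto
      finally show ?thesis by (simp add: power2_norm_eq_inner[symmetric] power2_eq_square algebra_simps)
    qed
    ultimately show "\<exists>d. (u has_real_derivative d) (at t) \<and> d \<le> 0"
      by (intro exI conjI) (auto intro!: mult_nonpos_nonneg)
  qed
  then have "(x b - y b) \<bullet> (x b - y b) \<le> 0"
    using \<open>x 0 = y 0\<close> by (simp add: u_def mult_le_0_iff)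
  then show ?thesis using inner_ge_zero[of "x b - y b"] by (simp add: antisym)
qed

lemma ode_unique:
  fixes x y :: "real \<Rightarrow> 'v::real_inner"
  assumes lip: "\<And>u v. u \<in> D \<Longrightarrow> v \<in> D \<Longrightarrow> norm (F u - F v) \<le> L * norm (u - v)"
    and x: "\<And>t. t \<in> {-b<..<b} \<Longrightarrow> x t \<in> D \<and> (x has_vector_derivative F (x t)) (at t)"
    and y: "\<And>t. t \<in> {-b<..<b} \<Longrightarrow> y t \<in> D \<and> (y has_vector_derivative F (y t)) (at t)"
    and 0: "x 0 = y 0" and t: "t \<in> {-b<..<b}"
  shows "x t = y t"
proof (cases "t \<ge> 0")
  case True
  show ?thesis
    by (rule ode_unique_forward[where F = F and D = D and L = L]) (use lip x y 0 t True in auto)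
next
  case False
  \<comment> \<open>Reversing time turns solutions for \<open>F\<close> into solutions for
    \<open>-F\<close>, which has the same Lipschitz constant.\<close>
  have neg: "((\<lambda>s. z (- s)) has_vector_derivative - F (z (- s))) (at s)"
    if "(z has_vector_derivative F (z (- s))) (at (- s))" for z s
    using vector_diff_chain_at[of uminus "-1" s z "F (z (- s))"] that
      has_vector_derivative_minus[OF has_vector_derivative_id, of "at s"]
    by (simp add: comp_def)
  have "(\<lambda>s. x (- s)) (- t) = (\<lambda>s. y (- s)) (- t)"
    by (rule ode_unique_forward[where F = "\<lambda>u. - F u" and D = D and L = L])
      (use lip x y 0 t False in \<open>auto intro!: neg simp: norm_minus_commute\<close>)
  then show ?thesis by simp
qed

text \<open>Bootstrapping: if \<open>x\<close> is C^k, so is its derivative t \<mapsto> F(x(t)), and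
  then \<open>x\<close> is C^(k+1).\<close>

lemma ode_solution_smooth:
  fixes x :: "real \<Rightarrow> 'v::real_normed_vector"
  assumes fd: "findim TYPE('v)" and I: "open I"
    and x: "\<And>t. t \<in> I \<Longrightarrow> smooth_at F (x t) \<and> (x has_vector_derivative F (x t)) (at t)"
  shows "t \<in> I \<Longrightarrow> smooth_at x t"
proof -
  define D where "D = {y. smooth_at F y}"
  have D: "open D" "smooth_on D F"
  proof -
    show "open D"
    proof (subst open_subopen, rule ballI)
      fix y assume "y \<in> D"
      then show "\<exists>T. open T \<and> y \<in> T \<and> T \<subseteq> D"
        using smooth_at_eventually[of F y] by (auto simp: D_def eventually_nhds)
    qed
    then show "smooth_on D F" by (simp add: smooth_on_eq_smooth_at) (simp add: D_def)
  qed
  have d: "x differentiable (at t)" "frechet_derivative x (at t) = (\<lambda>v. v *\<^sub>R F (x t))" if "t \<in> I" for t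
    using x[OF that] by (auto simp: has_vector_derivative_def differentiable_def frechet_derivative_eq)
  have "Ck_on k I x" for k
  proof (induction k)
    case 0
    then show ?case
      using d by (auto intro!: continuous_at_imp_continuous_on differentiable_imp_continuous_within)
  next
    case (Suc k)
    have "Ck_on k I (\<lambda>t. F (x t))"
      by (rule Ck_on_compose[OF fd I D(1) _ Suc]) (use x D in \<open>auto simp: D_def smooth_on_def\<close>)
    note F = Ck_on_bounded_linear[OF bounded_linear_scaleR_right I this]
    have "Ck_on k I (\<lambda>t. frechet_derivative x (at t) v)" for v
      by (rule Ck_on_cong[OF I _ F[of v]]) (simp add: d)
    then show ?case using d by simp
  qed
  then show "t \<in> I \<Longrightarrow> smooth_at x t" using I by (auto simp: smooth_at_def smooth_on_def)
qed

section \<open>One-parameter subgroups\<close>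

lemma frechet_derivative_partial_fst:
  assumes "smooth_at f (a, b)"
  shows "frechet_derivative (\<lambda>x. f (x, b)) (at a) v = frechet_derivative f (at (a, b)) (v, 0)"
proof -
  have "((\<lambda>x. (x, b)) has_derivative (\<lambda>v. (v, 0))) (at a)" by (auto intro!: derivative_eq_intros)
  then show ?thesis
    using smooth_at_derivative_compose[OF smooth_at_Pair[OF smooth_at_ident smooth_at_const] assms, of v]
    by (simp add: frechet_derivative_eq)
qed

lemma frechet_derivative_partial_snd:
  assumes "smooth_at f (a, b)"
  shows "frechet_derivative (\<lambda>x. f (a, x)) (at b) v = frechet_derivative f (at (a, b)) (0, v)"
proof -
  have "((\<lambda>x. (a, x)) has_derivative (\<lambda>v. (0, v))) (at b)" by (auto intro!: derivative_eq_intros)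
  then show ?thesis
    using smooth_at_derivative_compose[OF smooth_at_Pair[OF smooth_at_const smooth_at_ident] assms, of v]
    by (simp add: frechet_derivative_eq)
qed

lemma has_vector_derivative_smooth_compose:
  assumes "(x has_vector_derivative x') (at t)" "smooth_at f (x t)"
  shows "((\<lambda>s. f (x s)) has_vector_derivative frechet_derivative f (at (x t)) x') (at t)"
proof -
  have "bounded_linear (frechet_derivative f (at (x t)))"
    using assms(2) by (intro frechet_derivative_linear smooth_at_differentiable)
  then show ?thesis
    using has_derivative_compose[OF assms(1)[unfolded has_vector_derivative_def]
        smooth_at_has_derivative[OF assms(2)]]
    by (simp add: has_vector_derivative_def linear_scale bounded_linear.linear)
qed

lemma has_vector_derivative_cong_ev:
  assumes "(f has_vector_derivative f') (at t)" "\<forall>\<^sub>F s in nhds t. f s = g s"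
  shows "(g has_vector_derivative f') (at t)"
proof -
  obtain T where "open T" "t \<in> T" "\<And>s. s \<in> T \<Longrightarrow> f s = g s"
    using assms(2) by (auto simp: eventually_nhds)
  then show ?thesis using has_vector_derivative_transform_within_open[OF assms(1)] by blast
qed

section \<open>Right translations in charts\<close>

context lie begin

abbreviation c :: 'e where "c \<equiv> \<phi> \<^bold>e \<^bold>e"

lemma c_in [simp]: "c \<in> V \<^bold>e"
  by simp

text \<open>The right invariant field of \<eta> at \<open>x\<close>, in the coordinates of the chart
  at \<open>y\<close>. With \<open>y\<close> held fixed it can be differentiated and integrated
  while \<open>x\<close> moves, whereas \<open>TR\<close> changes its chart along with
  \<open>x\<close>.\<close>

definition chart_TR :: "'a \<Rightarrow> 'a \<Rightarrow> 'e \<Rightarrow> 'e" where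
  "chart_TR y x \<eta> = frechet_derivative (\<lambda>h. \<phi> y (\<psi> \<^bold>e h \<odot> x)) (at c) \<eta>"

lemma TR_eq_chart_TR: "TR G x = chart_TR x x"
  by (auto simp: TR_def chart_TR_def[abs_def] tangent_map_def comp_def)

lemma smooth_at_right_mult:
  assumes "x \<in> U y1" "x \<odot> k \<in> U y"
  shows "smooth_at (\<lambda>z. \<phi> y (\<psi> y1 z \<odot> k)) (\<phi> y1 x)"
  by (rule smooth_intoD[OF smooth_into_mult[OF smooth_into_psi smooth_into_const]]) (use assms in auto)

lemma chart_TR_linear: "x \<in> U y \<Longrightarrow> bounded_linear (chart_TR y x)"
  unfolding chart_TR_def[abs_def]
  by (intro frechet_derivative_linear smooth_at_differentiable smooth_at_right_mult) auto

text \<open>Derivative of the identity (hx)k = h(xk) in h: right translations carry a right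
  invariant field to itself.\<close>

lemma chart_TR_right_translate:
  assumes "x \<in> U y1" "x \<odot> k \<in> U y"
  shows "frechet_derivative (\<lambda>z. \<phi> y (\<psi> y1 z \<odot> k)) (at (\<phi> y1 x)) (chart_TR y1 x \<eta>) = chart_TR y (x \<odot> k) \<eta>"
proof -
  let ?f = "\<lambda>h. \<phi> y1 (\<psi> \<^bold>e h \<odot> x)" and ?g = "\<lambda>z. \<phi> y (\<psi> y1 z \<odot> k)"
  have m: "smooth_into (\<lambda>h. \<psi> \<^bold>e h \<odot> x) c" by (rule smooth_into_mult[OF smooth_into_psi smooth_into_const]) simp
  have f: "smooth_at ?f c" by (rule smooth_intoD[OF m]) (simp add: assms)
  have g: "smooth_at ?g (?f c)" using smooth_at_right_mult[OF assms] by simp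
  have "\<forall>\<^sub>F h in nhds c. \<psi> \<^bold>e h \<odot> x \<in> U y1"
    by (rule eventually_in_open[OF smooth_into_isCont[OF m] open_U]) (simp add: assms)
  then have ev: "\<forall>\<^sub>F h in nhds c. ?g (?f h) = \<phi> y (\<psi> \<^bold>e h \<odot> (x \<odot> k))"
    by (rule eventually_mono) (simp add: grp.assoc)
  show ?thesis
    using smooth_at_derivative_compose[OF f g, of \<eta>]
      frechet_derivative_cong_ev[OF smooth_at_differentiable[OF smooth_at_compose[OF findim_model f g]] ev]
    by (simp add: chart_TR_def)
qed

lemma chart_TR_change_chart:
  assumes "x \<in> U y1" "x \<in> U y"
  shows "frechet_derivative (\<lambda>z. \<phi> y (\<psi> y1 z)) (at (\<phi> y1 x)) (chart_TR y1 x \<eta>) = chart_TR y x \<eta>"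
  using chart_TR_right_translate[of x y1 "\<^bold>e" y] assms by simp

lemma chart_TR_one: "chart_TR \<^bold>e \<^bold>e \<eta> = \<eta>"
proof -
  have ev: "\<forall>\<^sub>F h in nhds c. h = \<phi> \<^bold>e (\<psi> \<^bold>e h \<odot> \<^bold>e)"
    using open_V[of "\<^bold>e"] by (auto simp: eventually_nhds phi_psi intro!: exI[of _ "V \<^bold>e"])
  show ?thesis
    using frechet_derivative_cong_ev[OF differentiable_ident ev] by (simp add: chart_TR_def)
qed

text \<open>Multiplication in charts is jointly smooth, and \<open>chart_TR\<close> is its partial
  derivative in the first factor at the identity.\<close>

lemma smooth_at_chart_TR:
  assumes f: "smooth_into f z" and y: "f z \<in> U y" and v: "smooth_at v z"
  shows "smooth_at (\<lambda>z. chart_TR y (f z) (v z)) z"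
proof -
  let ?N = "\<lambda>p. \<phi> y (\<psi> \<^bold>e (fst p) \<odot> \<psi> y (snd p))"
  have N: "smooth_at ?N (c, \<phi> y x)" if "x \<in> U y" for x
    by (rule smooth_mult_chart) (use that in auto)
  have "smooth_at (\<lambda>w. frechet_derivative ?N (at (c, \<phi> y (f w))) (v w, 0)) z"
    by (rule smooth_at_derivative[OF findim_model2 smooth_at_Pair[OF smooth_at_const smooth_intoD[OF f y]] N[OF y]
          smooth_at_Pair[OF v smooth_at_const]])
  moreover have "\<forall>\<^sub>F w in nhds z. frechet_derivative ?N (at (c, \<phi> y (f w))) (v w, 0) = chart_TR y (f w) (v w)"
    using eventually_in_open[OF smooth_into_isCont[OF f] open_U y]
  proof eventually_elim
    case (elim w)
    then show ?case
      using frechet_derivative_partial_fst[OF N[OF elim], of "v w"] by (simp add: chart_TR_def)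
  qed
  ultimately show ?thesis by (rule smooth_at_cong)
qed

section \<open>Homomorphisms from the real line\<close>

lemma hom_one: "(\<And>s t. \<gamma> (s + t) = \<gamma> s \<odot> \<gamma> t) \<Longrightarrow> \<gamma> (0::real) = \<^bold>e"
  by (metis add_0 grp.assoc grp.left_inverse grp.left_neutral)

text \<open>Since \<gamma>(s) = \<gamma>(s - t)\<gamma>(t), the curve near \<open>t\<close> is a
  right translate of the curve near 0. Its velocity at 0 therefore makes it an integral curve of the
  right invariant field at all times.\<close>

lemma hom_velocity:
  assumes hom: "\<And>s t. \<gamma> (s + t) = \<gamma> s \<odot> \<gamma> t" and vel: "has_velocity (charts G) \<gamma> \<xi> 0"
  shows "isCont \<gamma> t"
    and "\<gamma> t \<in> U y \<Longrightarrow> ((\<lambda>s. \<phi> y (\<gamma> s)) has_vector_derivative chart_TR y (\<gamma> t) \<xi>) (at t)"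
proof -
  have one: "\<gamma> 0 = \<^bold>e" by (rule hom_one[OF hom])
  have c0: "isCont \<gamma> 0" and d0: "((\<lambda>s. \<phi> \<^bold>e (\<gamma> s)) has_vector_derivative \<xi>) (at 0)"
    using vel by (simp_all add: has_velocity_def one comp_def)
  have shift: "\<gamma> s = \<gamma> (s - t) \<odot> \<gamma> t" for s using hom[of "s - t" t] by simp
  have sub: "isCont (\<lambda>s. s - t) t" by (intro continuous_intros)
  have "isCont (\<lambda>s. \<gamma> (s - t)) t"
    by (rule isCont_o2[OF sub]) (simp add: c0)
  then have "isCont (\<lambda>s. \<gamma> (s - t) \<odot> \<gamma> t) t" by (intro isCont_mult continuous_const)
  then show "isCont \<gamma> t" by (simp only: shift[symmetric])
  assume y: "\<gamma> t \<in> U y"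
  let ?g = "\<lambda>h. \<phi> y (\<psi> \<^bold>e h \<odot> \<gamma> t)"
  have g: "smooth_at ?g (\<phi> \<^bold>e (\<gamma> 0))" unfolding one by (rule smooth_at_right_mult) (simp_all add: y)
  have "((\<lambda>s. \<phi> \<^bold>e (\<gamma> (s - t))) has_vector_derivative \<xi>) (at t)"
    using vector_diff_chain_at[of "\<lambda>s. s - t" 1 t "\<lambda>s. \<phi> \<^bold>e (\<gamma> s)" \<xi>] d0
    by (simp add: comp_def has_vector_derivative_diff_const has_vector_derivative_id)
  then have "((\<lambda>s. ?g (\<phi> \<^bold>e (\<gamma> (s - t)))) has_vector_derivative chart_TR y (\<gamma> t) \<xi>) (at t)"
    using has_vector_derivative_smooth_compose[of "\<lambda>s. \<phi> \<^bold>e (\<gamma> (s - t))" \<xi> t ?g] g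
    by (simp add: one chart_TR_def)
  moreover have "\<forall>\<^sub>F s in nhds t. \<gamma> (s - t) \<in> U \<^bold>e"
    by (rule eventually_in_open[OF \<open>isCont (\<lambda>s. \<gamma> (s - t)) t\<close> open_U]) (simp add: one)
  then have "\<forall>\<^sub>F s in nhds t. ?g (\<phi> \<^bold>e (\<gamma> (s - t))) = \<phi> y (\<gamma> s)"
    by (rule eventually_mono) (simp add: shift[symmetric])
  ultimately show "((\<lambda>s. \<phi> y (\<gamma> s)) has_vector_derivative chart_TR y (\<gamma> t) \<xi>) (at t)"
    by (rule has_vector_derivative_cong_ev)
qed

lemma smooth_at_chart_TR_psi: "z \<in> V y \<Longrightarrow> smooth_at (\<lambda>z. chart_TR y (\<psi> y z) \<xi>) z"
  by (intro smooth_at_chart_TR smooth_into_psi smooth_at_const psi_in)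

text \<open>In every chart the curve solves an autonomous equation with smooth right-hand side, so
  \<open>ode_solution_smooth\<close> gives its smoothness.\<close>

lemma hom_one_parameter_subgroup:
  assumes hom: "\<And>s t. \<gamma> (s + t) = \<gamma> s \<odot> \<gamma> t" and vel: "has_velocity (charts G) \<gamma> \<xi> 0"
  shows "one_parameter_subgroup G \<xi> \<gamma>"
proof -
  note hv = hom_velocity[of \<gamma>, OF hom vel]
  have cont: "continuous_on UNIV \<gamma>" using hv(1) by (simp add: continuous_on_eq_continuous_at)
  have "smooth_on (\<gamma> -` U y) (\<lambda>t. \<phi> y (\<gamma> t))" for y
  proof -
    have o: "open (\<gamma> -` U y)" using cont open_U by (simp add: open_vimage)
    have "smooth_at (\<lambda>t. \<phi> y (\<gamma> t)) t" if "t \<in> \<gamma> -` U y" for t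
    proof (rule ode_solution_smooth[OF findim_model o _ that, where F = "\<lambda>z. chart_TR y (\<psi> y z) \<xi>"])
      fix t assume "t \<in> \<gamma> -` U y"
      then show "smooth_at (\<lambda>z. chart_TR y (\<psi> y z) \<xi>) (\<phi> y (\<gamma> t)) \<and>
          ((\<lambda>t. \<phi> y (\<gamma> t)) has_vector_derivative chart_TR y (\<psi> y (\<phi> y (\<gamma> t))) \<xi>) (at t)"
        using hv(2)[of t y] by (simp add: smooth_at_chart_TR_psi)
    qed
    then show ?thesis using smooth_on_eq_smooth_at[OF o] by blast
  qed
  moreover have "inv_into UNIV id = (id :: real \<Rightarrow> real)" by (metis inv_id)
  ultimately have "smooth_map vec_charts (charts G) \<gamma>"
    using cont by (simp add: smooth_map_def vec_charts_def comp_def)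
  then show ?thesis using hom vel by (simp add: one_parameter_subgroup_def)
qed

lemma one_parameter_subgroup_iff:
  "one_parameter_subgroup G \<xi> \<gamma> \<longleftrightarrow>
    (\<forall>s t. \<gamma> (s + t) = \<gamma> s \<odot> \<gamma> t) \<and> has_velocity (charts G) \<gamma> \<xi> 0"
  using hom_one_parameter_subgroup[of \<gamma> \<xi>] by (auto simp: one_parameter_subgroup_def)

section \<open>Powers and the extension of local homomorphisms\<close>

primrec gpow :: "'a \<Rightarrow> nat \<Rightarrow> 'a" where
  "gpow g 0 = \<^bold>e"
| "gpow g (Suc n) = g \<odot> gpow g n"

lemma gpow_add: "gpow g (m + n) = gpow g m \<odot> gpow g n"
  by (induction m) (simp_all add: grp.assoc)

lemma gpow_mult: "gpow g (m * n) = gpow (gpow g n) m"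
  by (induction m) (simp_all add: gpow_add)

lemma gpow_commute: "g \<odot> h = h \<odot> g \<Longrightarrow> gpow g n \<odot> h = h \<odot> gpow g n"
  by (induction n) (simp_all, metis grp.assoc)

lemma gpow_distrib: "g \<odot> h = h \<odot> g \<Longrightarrow> gpow (g \<odot> h) n = gpow g n \<odot> gpow h n"
proof (induction n)
  case (Suc n)
  then show ?case using gpow_commute[of g h n] by simp (metis grp.assoc)
qed simp

lemma hom_gpow: "(\<And>s t. \<gamma> (s + t) = \<gamma> s \<odot> \<gamma> t) \<Longrightarrow> \<gamma> (real n * s) = gpow (\<gamma> s) n"
  by (induction n) (simp_all add: hom_one distrib_right)

text \<open>The extension is \<open>t \<mapsto> f (t / n)\<^sup>n\<close> for any \<open>n\<close> large enough.\<close>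

lemma local_hom_extends:
  fixes f :: "real \<Rightarrow> 'a"
  assumes b: "b > 0" and hom: "\<And>s t. \<bar>s\<bar> < b \<Longrightarrow> \<bar>t\<bar> < b \<Longrightarrow> f (s + t) = f s \<odot> f t"
  obtains \<gamma> where "\<And>s t. \<gamma> (s + t) = \<gamma> s \<odot> \<gamma> t" "\<And>t. \<bar>t\<bar> < b \<Longrightarrow> \<gamma> t = f t"
proof -
  have "f 0 \<odot> f 0 = f 0 \<odot> \<^bold>e" using hom[of 0 0] b by simp
  then have f0: "f 0 = \<^bold>e" by (metis grp.assoc grp.left_inverse grp.left_neutral)
  have mult: "f (real m * s) = gpow (f s) m" if "\<bar>real m * s\<bar> < b" for m s
    using that
  proof (induction m)
    case (Suc m)
    have "\<bar>real m * s\<bar> \<le> \<bar>real (Suc m) * s\<bar>" "\<bar>s\<bar> \<le> \<bar>real (Suc m) * s\<bar>"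
      by (simp_all add: abs_mult mult_right_mono mult_le_cancel_right1)
    then have "\<bar>real m * s\<bar> < b" "\<bar>s\<bar> < b" using Suc.prems by linarith+
    then show ?case using hom[of s "real m * s"] Suc.IH by (simp add: distrib_right)
  qed (simp add: f0)
  define N where "N t = Suc (nat \<lceil>\<bar>t\<bar> / b\<rceil>)" for t
  have N: "N t > 0" and Nb: "\<bar>t / real (N t)\<bar> < b" for t
  proof -
    show "N t > 0" by (simp add: N_def)
    have "\<bar>t\<bar> / b < real (N t)" unfolding N_def by linarith
    then show "\<bar>t / real (N t)\<bar> < b" using b \<open>N t > 0\<close> by (simp add: abs_divide field_simps)
  qed
  define \<gamma> where "\<gamma> t = gpow (f (t / real (N t))) (N t)" for t
  \<comment> \<open>Two admissible subdivisions \<open>n\<close> and \<open>m\<close> both give the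
    value computed with the common refinement \<open>n * m\<close>, so the choice made in
    \<open>N\<close> is immaterial.\<close>
  have refine: "gpow (f (t / real n)) n = gpow (f (t / real (n * m))) (n * m)"
    if "n > 0" "m > 0" "\<bar>t / real n\<bar> < b" for t n m
    using mult[of m "t / real (n * m)"] that by (simp add: gpow_mult)
  have \<gamma>: "\<gamma> t = gpow (f (t / real n)) n" if "n > 0" "\<bar>t / real n\<bar> < b" for t n
    using refine[of n "N t" t] refine[of "N t" n t] that N Nb[of t] by (simp add: \<gamma>_def mult.commute)
  have "\<gamma> (s + t) = \<gamma> s \<odot> \<gamma> t" for s t
  proof -
    define n where "n = N s + N t + N (s + t)"
    have le: "\<bar>u / real n\<bar> < b" if "N u \<le> n" for u
    proof -
      have "\<bar>u / real n\<bar> \<le> \<bar>u / real (N u)\<bar>"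
        using that N[of u] by (simp add: abs_divide frac_le)
      then show ?thesis using Nb[of u] by linarith
    qed
    have n: "n > 0" "\<bar>s / real n\<bar> < b" "\<bar>t / real n\<bar> < b" "\<bar>(s + t) / real n\<bar> < b"
      using N[of s] le[of s] le[of t] le[of "s + t"] by (simp_all add: n_def)
    have "\<gamma> (s + t) = gpow (f (s / real n) \<odot> f (t / real n)) n"
      using \<gamma>[OF n(1,4)] hom[OF n(2,3)] by (simp add: add_divide_distrib)
    \<comment> \<open>Either order of the product is \<open>f\<close> at the sum of the arguments,
      so the two factors commute.\<close>
    also have "\<dots> = gpow (f (s / real n)) n \<odot> gpow (f (t / real n)) n"
      using hom[OF n(2,3)] hom[OF n(3,2)] by (intro gpow_distrib) (simp add: add.commute)
    finally show ?thesis using \<gamma> n by simp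
  qed
  moreover have "\<gamma> t = f t" if "\<bar>t\<bar> < b" for t
    using \<gamma>[of 1 t] that by (simp)
  ultimately show ?thesis by (rule that)
qed

section \<open>Existence and uniqueness of one-parameter subgroups\<close>

lemma lipschitz_ball:
  obtains r L where "r > 0" "L \<ge> 0" "cball c r \<subseteq> V \<^bold>e"
    "\<And>x y. x \<in> cball c r \<Longrightarrow> y \<in> cball c r \<Longrightarrow>
      norm (chart_TR \<^bold>e (\<psi> \<^bold>e x) \<xi> - chart_TR \<^bold>e (\<psi> \<^bold>e y) \<xi>) \<le> L * norm (x - y)"
proof -
  obtain r L where r: "r > 0" "L \<ge> 0" "\<And>x y. x \<in> cball c r \<Longrightarrow> y \<in> cball c r \<Longrightarrow>
      norm (chart_TR \<^bold>e (\<psi> \<^bold>e x) \<xi> - chart_TR \<^bold>e (\<psi> \<^bold>e y) \<xi>) \<le> L * norm (x - y)"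
    using smooth_at_imp_locally_lipschitz[OF findim_model smooth_at_chart_TR_psi[OF c_in]] by metis
  obtain d where d: "d > 0" "cball c d \<subseteq> V \<^bold>e"
    using open_contains_cball open_V c_in by blast
  show ?thesis by (rule that[of "min r d" L]) (use r d in auto)
qed

text \<open>For fixed t the curves u \<mapsto> f(u + t) and u \<mapsto> f(u)f(t) agree at u = 0 and
  solve the same equation, the second by \<open>chart_TR_right_translate\<close>. The care lies in
  keeping the products inside the ball where solutions are unique.\<close>

lemma local_one_parameter_group:
  obtains b f where "b > 0" "\<And>s t. \<bar>s\<bar> < b \<Longrightarrow> \<bar>t\<bar> < b \<Longrightarrow> f (s + t) = f s \<odot> f t"
    "has_velocity (charts G) f \<xi> 0" "f 0 = \<^bold>e"
proof -
  let ?F = "\<lambda>z. chart_TR \<^bold>e (\<psi> \<^bold>e z) \<xi>"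
  obtain r L where r: "r > 0" "L \<ge> 0" "cball c r \<subseteq> V \<^bold>e"
    and lip: "\<And>x y. x \<in> cball c r \<Longrightarrow> y \<in> cball c r \<Longrightarrow> norm (?F x - ?F y) \<le> L * norm (x - y)"
    using lipschitz_ball by blast
  obtain a x where a: "a > 0" and x0: "x 0 = c" and xr: "\<And>t. t \<in> {-a<..<a} \<Longrightarrow> x t \<in> cball c r"
    and xd: "\<And>t. t \<in> {-a<..<a} \<Longrightarrow> (x has_vector_derivative ?F (x t)) (at t)"
    using ode_local_existence[OF r(1,2) lip] by blast
  define f where "f t = \<psi> \<^bold>e (x t)" for t
  have f0: "f 0 = \<^bold>e" by (simp add: f_def x0)
  have xV: "x t \<in> V \<^bold>e" if "t \<in> {-a<..<a}" for t using xr[OF that] r(3) by blast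
  have fU: "f t \<in> U \<^bold>e" and \<phi>f: "\<phi> \<^bold>e (f t) = x t" if "t \<in> {-a<..<a}" for t
    using xV[OF that] by (simp_all add: f_def psi_in phi_psi)
  have fc: "isCont f t" if "t \<in> {-a<..<a}" for t
    unfolding f_def
    using isCont_o2[OF has_vector_derivative_continuous[OF xd[OF that]], where g = "\<psi> \<^bold>e"]
      isCont_psi[OF xV[OF that]] by blast
  have z: "0 \<in> {-a<..<a}" using a by simp
  \<comment> \<open>Continuity of the multiplication at the identity: for small times, products of
    values stay in the image of the ball.\<close>
  have "isCont (\<lambda>p. f (fst p) \<odot> f (snd p)) (0, 0)"
    by (intro isCont_mult isCont_o2[OF isCont_fst[OF continuous_ident], where g = f]
          isCont_o2[OF isCont_snd[OF continuous_ident], where g = f]) (use fc[OF z] in auto)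
  moreover have "open (\<psi> \<^bold>e ` ball c r)" "\<psi> \<^bold>e ` ball c r \<subseteq> U \<^bold>e"
  proof -
    have sub: "ball c r \<subseteq> V \<^bold>e" using r(3) by auto
    then show "\<psi> \<^bold>e ` ball c r \<subseteq> U \<^bold>e" using psi_in by blast
    have "\<psi> \<^bold>e ` ball c r = \<phi> \<^bold>e -` ball c r \<inter> U \<^bold>e"
      using sub psi_in phi_psi by (auto simp: subset_iff image_iff) (metis mem_ball psi_phi)+
    moreover have "continuous_on (U \<^bold>e) (\<phi> \<^bold>e)" using homeo by (simp add: homeomorphism_def)
    ultimately show "open (\<psi> \<^bold>e ` ball c r)"
      by (simp add: continuous_on_open_vimage open_U)
  qed
  moreover have "f (fst (0,0)) \<odot> f (snd (0,0)) \<in> \<psi> \<^bold>e ` ball c r"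
    using r(1) by (auto simp: f0 intro!: image_eqI[of _ _ c])
  ultimately have "\<forall>\<^sub>F p in nhds (0, 0). f (fst p) \<odot> f (snd p) \<in> \<psi> \<^bold>e ` ball c r"
    by (intro eventually_in_open) auto
  then have "\<forall>\<^sub>F p in nhds 0 \<times>\<^sub>F nhds 0. f (fst p) \<odot> f (snd p) \<in> \<psi> \<^bold>e ` ball c r"
    by (simp add: nhds_prod)
  then obtain P where P: "eventually P (nhds (0::real))"
    "\<And>s t. P s \<Longrightarrow> P t \<Longrightarrow> f s \<odot> f t \<in> \<psi> \<^bold>e ` ball c r"
    by (auto simp: eventually_prod_same)
  then obtain d where d: "d > 0" "\<And>t. \<bar>t\<bar> < d \<Longrightarrow> P t"
    by (auto simp: eventually_nhds_metric dist_real_def)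
  \<comment> \<open>Half of \<open>a\<close>, so that the sum of two times remains where the
    solution exists; \<open>d\<close> confines the products.\<close>
  define b where "b = min d (a / 2)"
  have b: "b > 0" "b \<le> d" "b \<le> a / 2" using d(1) a by (auto simp: b_def)
  have hom: "f (s + t) = f s \<odot> f t" if "\<bar>s\<bar> < b" "\<bar>t\<bar> < b" for s t
  proof -
    have in_ball: "f u \<odot> f t \<in> U \<^bold>e" "\<phi> \<^bold>e (f u \<odot> f t) \<in> cball c r" if "u \<in> {-b<..<b}" for u
    proof -
      have "f u \<odot> f t \<in> \<psi> \<^bold>e ` ball c r" using P(2) d(2) b that \<open>\<bar>t\<bar> < b\<close> by auto
      then show "f u \<odot> f t \<in> U \<^bold>e" "\<phi> \<^bold>e (f u \<odot> f t) \<in> cball c r"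
        using psi_in phi_psi r(3) by (auto simp: subset_iff)
    qed
    have "x (s + t) = \<phi> \<^bold>e (f s \<odot> f t)"
    proof (rule ode_unique[where D = "cball c r" and F = ?F and L = L and b = b and t = s
          and x = "\<lambda>u. x (u + t)" and y = "\<lambda>u. \<phi> \<^bold>e (f u \<odot> f t)"])
      fix u assume u: "u \<in> {-b<..<b}"
      then have ut: "u + t \<in> {-a<..<a}" and ua: "u \<in> {-a<..<a}" using b \<open>\<bar>t\<bar> < b\<close> by auto
      have "((\<lambda>u. x (u + t)) has_vector_derivative ?F (x (u + t))) (at u)"
        using vector_diff_chain_at[of "\<lambda>u. u + t" 1 u x "?F (x (u + t))"] xd[OF ut]
        by (simp add: comp_def has_vector_derivative_add_const has_vector_derivative_id)
      then show "x (u + t) \<in> cball c r \<and> ((\<lambda>u. x (u + t)) has_vector_derivative ?F (x (u + t))) (at u)"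
        using xr[OF ut] by blast
      let ?g = "\<lambda>z. \<phi> \<^bold>e (\<psi> \<^bold>e z \<odot> f t)"
      have "smooth_at ?g (x u)"
        using smooth_at_right_mult[OF fU[OF ua] in_ball(1)[OF u]] \<phi>f[OF ua] by simp
      then have "((\<lambda>u. ?g (x u)) has_vector_derivative frechet_derivative ?g (at (x u)) (?F (x u))) (at u)"
        by (rule has_vector_derivative_smooth_compose[OF xd[OF ua]])
      moreover have "frechet_derivative ?g (at (x u)) (?F (x u)) = chart_TR \<^bold>e (f u \<odot> f t) \<xi>"
        using chart_TR_right_translate[OF fU[OF ua] in_ball(1)[OF u], of \<xi>] \<phi>f[OF ua] by (simp add: f_def)
      ultimately have "((\<lambda>u. \<phi> \<^bold>e (f u \<odot> f t)) has_vector_derivative ?F (\<phi> \<^bold>e (f u \<odot> f t))) (at u)"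
        using in_ball(1)[OF u] by (simp add: f_def)
      then show "\<phi> \<^bold>e (f u \<odot> f t) \<in> cball c r \<and>
          ((\<lambda>u. \<phi> \<^bold>e (f u \<odot> f t)) has_vector_derivative ?F (\<phi> \<^bold>e (f u \<odot> f t))) (at u)"
        using in_ball(2)[OF u] by blast
    next
      have "t \<in> {-a<..<a}" using \<open>\<bar>t\<bar> < b\<close> b a by auto
      then show "x (0 + t) = \<phi> \<^bold>e (f 0 \<odot> f t)" using \<phi>f[of t] by (simp add: f0)
    qed (use lip \<open>\<bar>s\<bar> < b\<close> in auto)
    then have "f (s + t) = \<psi> \<^bold>e (\<phi> \<^bold>e (f s \<odot> f t))" by (simp add: f_def)
    also have "\<dots> = f s \<odot> f t" using in_ball(1)[of s] \<open>\<bar>s\<bar> < b\<close> by (simp add: abs_less_iff)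
    finally show ?thesis .
  qed
  have "((\<lambda>s. \<phi> \<^bold>e (f s)) has_vector_derivative \<xi>) (at 0)"
  proof (rule has_vector_derivative_cong_ev)
    show "(x has_vector_derivative \<xi>) (at 0)" using xd[OF z] by (simp add: x0 chart_TR_one)
    show "\<forall>\<^sub>F s in nhds 0. x s = \<phi> \<^bold>e (f s)"
      using a \<phi>f by (auto simp: eventually_nhds intro!: exI[of _ "{-a<..<a}"])
  qed
  then have "has_velocity (charts G) f \<xi> 0"
    using fc[OF z] by (simp add: has_velocity_def f0 comp_def)
  then show ?thesis using that b(1) hom f0 by blast
qed

lemma one_parameter_subgroup_exists: "\<exists>\<gamma>. one_parameter_subgroup G \<xi> \<gamma>"
proof -
  obtain b f where b: "b > 0" and hom: "\<And>s t. \<bar>s\<bar> < b \<Longrightarrow> \<bar>t\<bar> < b \<Longrightarrow> f (s + t) = f s \<odot> f t"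
    and vel: "has_velocity (charts G) f \<xi> 0" and f0: "f 0 = \<^bold>e"
    using local_one_parameter_group[of \<xi>] by metis
  obtain \<gamma> where \<gamma>: "\<And>s t. \<gamma> (s + t) = \<gamma> s \<odot> \<gamma> t" "\<And>t. \<bar>t\<bar> < b \<Longrightarrow> \<gamma> t = f t"
    using local_hom_extends[of b f, OF b hom] by metis
  have ev: "\<forall>\<^sub>F t in nhds 0. f t = \<gamma> t"
    using b \<gamma>(2) by (auto simp: eventually_nhds_metric dist_real_def)
  have "isCont \<gamma> 0" using vel isCont_cong[OF ev] by (simp add: has_velocity_def)
  moreover have "((\<lambda>t. \<phi> \<^bold>e (\<gamma> t)) has_vector_derivative \<xi>) (at 0)"
    by (rule has_vector_derivative_cong_ev[of "\<lambda>t. \<phi> \<^bold>e (f t)"])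
      (use vel f0 ev in \<open>auto simp: has_velocity_def comp_def elim: eventually_mono\<close>)
  ultimately have "has_velocity (charts G) \<gamma> \<xi> 0"
    using f0 \<gamma>(2)[of 0] b by (simp add: has_velocity_def comp_def)
  then show ?thesis using hom_one_parameter_subgroup[OF \<gamma>(1)] by blast
qed

text \<open>Near 0 both curves solve the same equation in the chart at the identity. Agreement there
  is enough, because the value at \<open>t\<close> is the n-th power of the value at t/n.\<close>

lemma one_parameter_subgroup_unique:
  assumes "one_parameter_subgroup G \<xi> \<gamma>1" "one_parameter_subgroup G \<xi> \<gamma>2"
  shows "\<gamma>1 = \<gamma>2"
proof
  fix t :: real
  have hom: "\<And>s t. \<gamma>1 (s + t) = \<gamma>1 s \<odot> \<gamma>1 t" "\<And>s t. \<gamma>2 (s + t) = \<gamma>2 s \<odot> \<gamma>2 t"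
    and vel: "has_velocity (charts G) \<gamma>1 \<xi> 0" "has_velocity (charts G) \<gamma>2 \<xi> 0"
    using assms by (auto simp: one_parameter_subgroup_iff)
  note v1 = hom_velocity[of \<gamma>1, OF hom(1) vel(1)] and v2 = hom_velocity[of \<gamma>2, OF hom(2) vel(2)]
  have one: "\<gamma>1 0 = \<^bold>e" "\<gamma>2 0 = \<^bold>e" by (rule hom_one, rule hom)+
  let ?F = "\<lambda>z. chart_TR \<^bold>e (\<psi> \<^bold>e z) \<xi>"
  obtain r L where r: "r > 0" "L \<ge> 0" "cball c r \<subseteq> V \<^bold>e"
    and lip: "\<And>x y. x \<in> cball c r \<Longrightarrow> y \<in> cball c r \<Longrightarrow> norm (?F x - ?F y) \<le> L * norm (x - y)"
    using lipschitz_ball by blast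
  have near: "\<forall>\<^sub>F t in nhds 0. \<gamma> t \<in> U \<^bold>e \<and> \<phi> \<^bold>e (\<gamma> t) \<in> ball c r"
    if "isCont \<gamma> 0" "\<gamma> 0 = \<^bold>e" for \<gamma> :: "real \<Rightarrow> 'a"
  proof (rule eventually_conj)
    show "\<forall>\<^sub>F t in nhds 0. \<gamma> t \<in> U \<^bold>e" by (rule eventually_in_open[OF that(1) open_U]) (simp add: that(2))
    have "isCont (\<lambda>t. \<phi> \<^bold>e (\<gamma> t)) 0" by (rule isCont_o2[OF that(1)]) (simp add: that(2) isCont_phi)
    then show "\<forall>\<^sub>F t in nhds 0. \<phi> \<^bold>e (\<gamma> t) \<in> ball c r"
      by (rule eventually_in_open[OF _ open_ball]) (simp add: that(2) r(1))
  qed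
  obtain b where b: "b > 0" "\<And>t. \<bar>t\<bar> < b \<Longrightarrow> (\<gamma>1 t \<in> U \<^bold>e \<and> \<phi> \<^bold>e (\<gamma>1 t) \<in> ball c r) \<and>
      (\<gamma>2 t \<in> U \<^bold>e \<and> \<phi> \<^bold>e (\<gamma>2 t) \<in> ball c r)"
    using eventually_conj[OF near[OF v1(1) one(1)] near[OF v2(1) one(2)]]
    by (auto simp: eventually_nhds_metric dist_real_def)
  have eq: "\<gamma>1 t = \<gamma>2 t" if "\<bar>t\<bar> < b" for t
  proof -
    have "\<phi> \<^bold>e (\<gamma>1 t) = \<phi> \<^bold>e (\<gamma>2 t)"
    proof (rule ode_unique[where D = "cball c r" and F = ?F and L = L and b = b and t = t
          and x = "\<lambda>t. \<phi> \<^bold>e (\<gamma>1 t)" and y = "\<lambda>t. \<phi> \<^bold>e (\<gamma>2 t)"])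
      fix u assume "u \<in> {-b<..<b}"
      then have u: "\<bar>u\<bar> < b" by auto
      show "\<phi> \<^bold>e (\<gamma>1 u) \<in> cball c r \<and>
          ((\<lambda>t. \<phi> \<^bold>e (\<gamma>1 t)) has_vector_derivative ?F (\<phi> \<^bold>e (\<gamma>1 u))) (at u)"
        using b(2)[OF u] v1(2)[of u "\<^bold>e"] by auto
      show "\<phi> \<^bold>e (\<gamma>2 u) \<in> cball c r \<and>
          ((\<lambda>t. \<phi> \<^bold>e (\<gamma>2 t)) has_vector_derivative ?F (\<phi> \<^bold>e (\<gamma>2 u))) (at u)"
        using b(2)[OF u] v2(2)[of u "\<^bold>e"] by auto
    qed (use lip one that in auto)
    then show ?thesis using b(2)[OF that] by (metis psi_phi)
  qed
  obtain n where n: "real n > \<bar>t\<bar> / b" using reals_Archimedean2 by blast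
  have n0: "real n > 0" using n b(1) by (meson abs_ge_zero divide_nonneg_pos le_less_trans)
  then have "\<bar>t / real n\<bar> < b" using n b(1) by (simp add: abs_divide field_simps)
  then have "gpow (\<gamma>1 (t / real n)) n = gpow (\<gamma>2 (t / real n)) n" using eq by simp
  then show "\<gamma>1 t = \<gamma>2 t"
    using hom_gpow[of \<gamma>1 n "t / real n", OF hom(1)] hom_gpow[of \<gamma>2 n "t / real n", OF hom(2)] n0 by simp
qed

text \<open>Speeding up the parameter by \<open>t\<close> multiplies the velocity by
  \<open>t\<close>; uniqueness then evaluates the definite description in
  \<open>lie_exp\<close>.\<close>

lemma lie_exp_scale:
  assumes "one_parameter_subgroup G \<xi> \<gamma>"
  shows "lie_exp G (t *\<^sub>R \<xi>) = \<gamma> t"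
proof -
  have hom: "\<And>s t. \<gamma> (s + t) = \<gamma> s \<odot> \<gamma> t" and vel: "has_velocity (charts G) \<gamma> \<xi> 0"
    using assms by (auto simp: one_parameter_subgroup_def)
  have cm: "isCont (\<lambda>s. t * s) 0" by (intro continuous_intros)
  have "isCont (\<lambda>s. \<gamma> (t * s)) 0"
    by (rule isCont_o2[OF cm]) (use vel in \<open>simp add: has_velocity_def\<close>)
  moreover have "((\<lambda>s. t * s) has_vector_derivative t) (at 0)"
    by (auto intro!: derivative_eq_intros)
  then have "((\<lambda>s. \<phi> \<^bold>e (\<gamma> (t * s))) has_vector_derivative t *\<^sub>R \<xi>) (at 0)"
    using vector_diff_chain_at[of "\<lambda>s. t * s" t 0 "\<lambda>s. \<phi> \<^bold>e (\<gamma> s)" \<xi>] vel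
    by (simp add: comp_def has_velocity_def hom_one[OF hom])
  ultimately have "has_velocity (charts G) (\<lambda>s. \<gamma> (t * s)) (t *\<^sub>R \<xi>) 0"
    by (simp add: has_velocity_def comp_def hom_one[OF hom])
  then have "one_parameter_subgroup G (t *\<^sub>R \<xi>) (\<lambda>s. \<gamma> (t * s))"
    by (intro hom_one_parameter_subgroup) (simp_all add: hom distrib_left)
  then have "(THE \<gamma>. one_parameter_subgroup G (t *\<^sub>R \<xi>) \<gamma>) = (\<lambda>s. \<gamma> (t * s))"
    using one_parameter_subgroup_unique by (intro the_equality) auto
  then show ?thesis by (simp add: lie_exp_def)
qed

end

section \<open>The adjoint representation and the Lie bracket\<close>

text \<open>Decomposing the first argument into rank-one summands leaves the linear maps
  \<open>B b\<close> of the second argument, which are bounded by finite dimension.\<close>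

lemma findim_bounded_bilinear:
  fixes B :: "'v::real_normed_vector \<Rightarrow> 'w::real_normed_vector \<Rightarrow> 'z::real_normed_vector"
  assumes fv: "findim TYPE('v)" and fw: "findim TYPE('w)"
    and l: "\<And>y. linear (\<lambda>x. B x y)" and r: "\<And>x. linear (B x)"
  shows "bounded_bilinear B"
proof -
  have "\<exists>K. \<forall>x y. norm (B (P x) y) \<le> norm x * norm y * K" if "finrank P" for P :: "'v \<Rightarrow> 'v"
    using that
  proof (induction P rule: finrank.induct)
    case finrank_zero
    then show ?case by (auto simp: linear_0[OF l] intro!: exI[of _ 0])
  next
    case (finrank_step P k b)
    then obtain K where K: "\<And>x y. norm (B (P x) y) \<le> norm x * norm y * K" by auto
    have b: "bounded_linear (B b)" by (rule findim_linear_bounded[OF fw r])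
    have "norm (B (P x + k x *\<^sub>R b) y) \<le> norm x * norm y * (K + onorm k * onorm (B b))" for x y
    proof -
      have "norm (B (P x + k x *\<^sub>R b) y) \<le> norm (B (P x) y) + \<bar>k x\<bar> * norm (B b y)"
        unfolding linear_add[OF l] linear_scale[OF l] by (rule order_trans[OF norm_triangle_ineq]) simp
      also have "\<dots> \<le> norm x * norm y * K + (onorm k * norm x) * (onorm (B b) * norm y)"
        using K onorm[OF finrank_step.hyps(2), of x] onorm[OF b, of y] onorm_pos_le[OF finrank_step.hyps(2)]
        by (intro add_mono mult_mono) auto
      finally show ?thesis by (simp add: algebra_simps)
    qed
    then show ?case by blast
  qed
  from this[OF fv] show ?thesis
    by unfold_locales
      (auto simp: linear_add[OF r] linear_scale[OF r] linear_add[OF l] linear_scale[OF l])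
qed

section \<open>The adjoint representation\<close>

context lie begin

abbreviation conjug :: "'a \<Rightarrow> 'a \<Rightarrow> 'a" where "conjug g h \<equiv> \<iota> g \<odot> h \<odot> g"

lemma conjug_one [simp]: "conjug g \<^bold>e = \<^bold>e"
  by simp

lemma smooth_into_conjug: "smooth_into f z \<Longrightarrow> smooth_into g z \<Longrightarrow> smooth_into (\<lambda>z. conjug (f z) (g z)) z"
  by (intro smooth_into_mult smooth_into_ginv)

lemma Ad_eq: "Ad G g = frechet_derivative (\<lambda>u. \<phi> \<^bold>e (conjug g (\<psi> \<^bold>e u))) (at c)"
  unfolding Ad_def tangent_map_def by (simp add: comp_def)

lemma smooth_at_conjug: "smooth_at (\<lambda>u. \<phi> \<^bold>e (conjug g (\<psi> \<^bold>e u))) c"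
  by (rule smooth_intoD[OF smooth_into_conjug[OF smooth_into_const smooth_into_psi]]) auto

lemma Ad_linear: "bounded_linear (Ad G g)"
  unfolding Ad_eq by (intro frechet_derivative_linear smooth_at_differentiable smooth_at_conjug)

text \<open>Conjugation in charts is jointly smooth, and \<open>Ad\<close> is its partial derivative
  in the conjugated element at the identity.\<close>

lemma smooth_at_Ad:
  assumes f: "smooth_into f z" and v: "smooth_at v z"
  shows "smooth_at (\<lambda>z. Ad G (f z) (v z)) z"
proof -
  let ?N = "\<lambda>p. \<phi> \<^bold>e (conjug (\<psi> (f z) (fst p)) (\<psi> \<^bold>e (snd p)))"
  have N: "smooth_at ?N (\<phi> (f z) g, c)" if "g \<in> U (f z)" for g
  proof -
    have "smooth_into (\<lambda>p. \<psi> (f z) (fst p)) (\<phi> (f z) g, c)"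
      by (rule smooth_into_compose[OF findim_model smooth_at_fst[OF smooth_at_ident] smooth_into_psi]) (simp add: that)
    moreover have "smooth_into (\<lambda>p. \<psi> \<^bold>e (snd p)) (\<phi> (f z) g, c)"
      by (rule smooth_into_compose[OF findim_model smooth_at_snd[OF smooth_at_ident] smooth_into_psi]) simp
    ultimately show ?thesis by (rule smooth_intoD[OF smooth_into_conjug]) simp
  qed
  have "smooth_at (\<lambda>w. frechet_derivative ?N (at (\<phi> (f z) (f w), c)) (0, v w)) z"
    by (rule smooth_at_derivative[OF findim_model2 smooth_at_Pair[OF smooth_intoD[OF f in_U] smooth_at_const]
          N[OF in_U] smooth_at_Pair[OF smooth_at_const v]])
  moreover have "\<forall>\<^sub>F w in nhds z. frechet_derivative ?N (at (\<phi> (f z) (f w), c)) (0, v w) = Ad G (f w) (v w)"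
    using eventually_in_open[OF smooth_into_isCont[OF f] open_U in_U]
  proof eventually_elim
    case (elim w)
    then show ?case
      using frechet_derivative_partial_snd[OF N[OF elim], of "v w"] by (simp add: Ad_eq)
  qed
  ultimately show ?thesis by (rule smooth_at_cong)
qed

text \<open>The order is reversed because \<open>Ad\<close> comes from u \<mapsto> g^{-1}ug:
  conjugating by a product conjugates by its left factor first.\<close>

lemma Ad_mult: "Ad G (h \<odot> g) \<eta> = Ad G g (Ad G h \<eta>)"
proof -
  let ?f = "\<lambda>u. \<phi> \<^bold>e (conjug h (\<psi> \<^bold>e u))" and ?g = "\<lambda>u. \<phi> \<^bold>e (conjug g (\<psi> \<^bold>e u))"
  have g: "smooth_at ?g (?f c)" using smooth_at_conjug by simp
  have "\<forall>\<^sub>F u in nhds c. conjug h (\<psi> \<^bold>e u) \<in> U \<^bold>e"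
    by (rule eventually_in_open[OF smooth_into_isCont[OF smooth_into_conjug[OF smooth_into_const smooth_into_psi]] open_U]) auto
  then have ev: "\<forall>\<^sub>F u in nhds c. ?g (?f u) = \<phi> \<^bold>e (conjug (h \<odot> g) (\<psi> \<^bold>e u))"
    by (rule eventually_mono) (simp add: grp.assoc grp.inverse_distrib_swap)
  show ?thesis
    using smooth_at_derivative_compose[OF smooth_at_conjug g, of \<eta>]
      frechet_derivative_cong_ev[OF smooth_at_differentiable[OF
          smooth_at_compose[OF findim_model smooth_at_conjug g]] ev]
    by (simp add: Ad_eq)
qed

lemma Ad_one: "Ad G \<^bold>e \<eta> = \<eta>"
proof -
  have "\<iota> \<^bold>e = \<^bold>e" by (metis grp.left_inverse grp.right_neutral)
  then have ev: "\<forall>\<^sub>F u in nhds c. u = \<phi> \<^bold>e (conjug \<^bold>e (\<psi> \<^bold>e u))"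
    using open_V[of "\<^bold>e"] by (auto simp: eventually_nhds phi_psi intro!: exI[of _ "V \<^bold>e"])
  show ?thesis
    using frechet_derivative_cong_ev[OF differentiable_ident ev] by (simp add: Ad_eq)
qed

section \<open>The Lie bracket as a derivative of Ad\<close>

lemma smooth_at_Ad_psi: "smooth_at (\<lambda>z. Ad G (\<psi> \<^bold>e z) \<eta>) c"
  by (intro smooth_at_Ad smooth_into_psi smooth_at_const c_in)

lemma ad_along_one_parameter_subgroup:
  assumes "one_parameter_subgroup G \<xi> \<gamma>"
  shows "((\<lambda>t. Ad G (\<gamma> t) \<eta>) has_vector_derivative
      frechet_derivative (\<lambda>z. Ad G (\<psi> \<^bold>e z) \<eta>) (at c) \<xi>) (at 0)"
proof -
  have one: "\<gamma> 0 = \<^bold>e" using assms by (intro hom_one) (auto simp: one_parameter_subgroup_def)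
  have v: "isCont \<gamma> 0" "((\<lambda>t. \<phi> \<^bold>e (\<gamma> t)) has_vector_derivative \<xi>) (at 0)"
    using assms by (auto simp: one_parameter_subgroup_def has_velocity_def one comp_def)
  have "((\<lambda>t. Ad G (\<psi> \<^bold>e (\<phi> \<^bold>e (\<gamma> t))) \<eta>) has_vector_derivative
      frechet_derivative (\<lambda>z. Ad G (\<psi> \<^bold>e z) \<eta>) (at c) \<xi>) (at 0)"
    using has_vector_derivative_smooth_compose[OF v(2), of "\<lambda>z. Ad G (\<psi> \<^bold>e z) \<eta>"] smooth_at_Ad_psi
    by (simp add: one)
  moreover have "\<forall>\<^sub>F t in nhds 0. \<gamma> t \<in> U \<^bold>e"
    by (rule eventually_in_open[OF v(1) open_U]) (simp add: one)
  then have "\<forall>\<^sub>F t in nhds 0. Ad G (\<psi> \<^bold>e (\<phi> \<^bold>e (\<gamma> t))) \<eta> = Ad G (\<gamma> t) \<eta>"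
    by (rule eventually_mono) simp
  ultimately show ?thesis by (rule has_vector_derivative_cong_ev)
qed

text \<open>An actual one-parameter subgroup evaluates \<open>lie_exp\<close>, and the chain rule
  removes it. Linearity in \<xi> becomes that of a derivative.\<close>

lemma ad_eq: "ad G \<xi> \<eta> = frechet_derivative (\<lambda>z. Ad G (\<psi> \<^bold>e z) \<eta>) (at c) \<xi>"
proof -
  obtain \<gamma> where \<gamma>: "one_parameter_subgroup G \<xi> \<gamma>" using one_parameter_subgroup_exists by blast
  show ?thesis
    using vector_derivative_at[OF ad_along_one_parameter_subgroup[OF \<gamma>, of \<eta>]]
    by (simp add: ad_def lie_exp_scale[OF \<gamma>])
qed

lemma has_derivative_Ad_psi: "((\<lambda>z. Ad G (\<psi> \<^bold>e z) \<eta>) has_derivative (\<lambda>\<xi>. ad G \<xi> \<eta>)) (at c)"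
  using smooth_at_has_derivative[OF smooth_at_Ad_psi] by (simp add: ad_eq)

text \<open>Linear in the first argument as a derivative; in the second because every
  \<open>Ad G g\<close> is linear and derivatives are unique.\<close>

lemma ad_bilinear: "bounded_bilinear (ad G)"
proof (rule findim_bounded_bilinear[OF findim_model findim_model])
  show "linear (\<lambda>\<xi>. ad G \<xi> \<eta>)" for \<eta>
    using has_derivative_linear[OF has_derivative_Ad_psi] .
  note l = bounded_linear.linear[OF Ad_linear]
  show "linear (ad G \<xi>)" for \<xi>
  proof
    fix \<eta> \<zeta> and r :: real
    have "((\<lambda>z. Ad G (\<psi> \<^bold>e z) (\<eta> + \<zeta>)) has_derivative (\<lambda>\<xi>. ad G \<xi> \<eta> + ad G \<xi> \<zeta>)) (at c)"
      unfolding linear_add[OF l] by (intro has_derivative_add has_derivative_Ad_psi)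
    from has_derivative_unique[OF has_derivative_Ad_psi this]
    show "ad G \<xi> (\<eta> + \<zeta>) = ad G \<xi> \<eta> + ad G \<xi> \<zeta>" by (rule fun_cong)
    have "((\<lambda>z. Ad G (\<psi> \<^bold>e z) (r *\<^sub>R \<eta>)) has_derivative (\<lambda>\<xi>. r *\<^sub>R ad G \<xi> \<eta>)) (at c)"
      unfolding linear_scale[OF l] by (intro has_derivative_scaleR_right has_derivative_Ad_psi)
    from has_derivative_unique[OF has_derivative_Ad_psi this]
    show "ad G \<xi> (r *\<^sub>R \<eta>) = r *\<^sub>R ad G \<xi> \<eta>" by (rule fun_cong)
  qed
qed

sublocale ad: bounded_bilinear "ad G"
  by (rule ad_bilinear)

text \<open>Conjugation by \<open>\<gamma> t\<close> fixes the one-parameter subgroup \<open>\<gamma>\<close> pointwise, hence fixes its velocity.\<close>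

lemma ad_self: "ad G \<xi> \<xi> = 0"
proof -
  obtain \<gamma> where \<gamma>: "one_parameter_subgroup G \<xi> \<gamma>" using one_parameter_subgroup_exists by blast
  have hom: "\<And>s t. \<gamma> (s + t) = \<gamma> s \<odot> \<gamma> t" and cont: "isCont \<gamma> 0"
    using \<gamma> by (auto simp: one_parameter_subgroup_def has_velocity_def)
  have one: "\<gamma> 0 = \<^bold>e" by (rule hom_one[OF hom])
  have vel: "((\<lambda>t. \<phi> \<^bold>e (\<gamma> t)) has_vector_derivative \<xi>) (at 0)"
    using \<gamma> by (auto simp: one_parameter_subgroup_def has_velocity_def one comp_def)
  have fix_self: "conjug (\<gamma> t) (\<gamma> s) = \<gamma> s" for s t
  proof -
    have "\<gamma> s \<odot> \<gamma> t = \<gamma> t \<odot> \<gamma> s" using hom[of s t] hom[of t s] by (simp add: add.commute)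
    then show ?thesis by (metis grp.assoc grp.left_inverse grp.left_neutral)
  qed
  have "Ad G (\<gamma> t) \<xi> = \<xi>" for t
  proof -
    have "((\<lambda>s. \<phi> \<^bold>e (conjug (\<gamma> t) (\<psi> \<^bold>e (\<phi> \<^bold>e (\<gamma> s))))) has_vector_derivative Ad G (\<gamma> t) \<xi>) (at 0)"
      using has_vector_derivative_smooth_compose[OF vel, of "\<lambda>u. \<phi> \<^bold>e (conjug (\<gamma> t) (\<psi> \<^bold>e u))"]
        smooth_at_conjug by (simp add: one Ad_eq)
    moreover have "\<forall>\<^sub>F s in nhds 0. \<gamma> s \<in> U \<^bold>e"
      by (rule eventually_in_open[OF cont open_U]) (simp add: one)
    then have "\<forall>\<^sub>F s in nhds 0. \<phi> \<^bold>e (conjug (\<gamma> t) (\<psi> \<^bold>e (\<phi> \<^bold>e (\<gamma> s)))) = \<phi> \<^bold>e (\<gamma> s)"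
      by (rule eventually_mono) (simp add: fix_self)
    ultimately have "((\<lambda>s. \<phi> \<^bold>e (\<gamma> s)) has_vector_derivative Ad G (\<gamma> t) \<xi>) (at 0)"
      by (rule has_vector_derivative_cong_ev)
    then show ?thesis by (rule vector_derivative_unique_at) (rule vel)
  qed
  then have "((\<lambda>t. \<xi>) has_vector_derivative ad G \<xi> \<xi>) (at 0)"
    using ad_along_one_parameter_subgroup[OF \<gamma>, of \<xi>] by (simp add: ad_eq)
  then show ?thesis by (rule vector_derivative_unique_at) (rule has_vector_derivative_const)
qed

lemma ad_antisym: "ad G \<xi> \<eta> = - ad G \<eta> \<xi>"
proof -
  have "ad G (\<xi> + \<eta>) (\<xi> + \<eta>) = ad G \<xi> \<eta> + ad G \<eta> \<xi>"
    by (simp add: ad.add_left ad.add_right ad_self[of \<xi>] ad_self[of \<eta>])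
  then have "ad G \<xi> \<eta> + ad G \<eta> \<xi> = 0" using ad_self[of "\<xi> + \<eta>"] by (rule trans[OF sym])
  then show ?thesis by (rule eq_neg_iff_add_eq_0[THEN iffD2])
qed

text \<open>From g(g^{-1}zg) = zg and \<open>Ad_mult\<close>, the adjoint of g^{-1}zg applied to
  Ad_g \<eta> equals Ad_g Ad_z \<eta>. The claim is the derivative of this equation in z at the
  identity.\<close>

lemma Ad_ad: "Ad G g (ad G \<xi> \<eta>) = ad G (Ad G g \<xi>) (Ad G g \<eta>)"
proof -
  let ?f = "\<lambda>z. \<phi> \<^bold>e (conjug g (\<psi> \<^bold>e z))"
  have f: "(?f has_derivative Ad G g) (at c)"
    using smooth_at_has_derivative[OF smooth_at_conjug] by (simp add: Ad_eq)
  have "((\<lambda>z. Ad G (\<psi> \<^bold>e z) (Ad G g \<eta>)) has_derivative (\<lambda>\<xi>. ad G \<xi> (Ad G g \<eta>))) (at (?f c))"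
    using has_derivative_Ad_psi by simp
  from has_derivative_compose[OF f this]
  have d1: "((\<lambda>z. Ad G (\<psi> \<^bold>e (?f z)) (Ad G g \<eta>)) has_derivative (\<lambda>\<xi>. ad G (Ad G g \<xi>) (Ad G g \<eta>))) (at c)" .
  have "\<forall>\<^sub>F z in nhds c. conjug g (\<psi> \<^bold>e z) \<in> U \<^bold>e"
    by (rule eventually_in_open[OF smooth_into_isCont[OF smooth_into_conjug[OF smooth_into_const smooth_into_psi]] open_U]) auto
  then have ev: "\<forall>\<^sub>F z in nhds c. Ad G (\<psi> \<^bold>e (?f z)) (Ad G g \<eta>) = Ad G g (Ad G (\<psi> \<^bold>e z) \<eta>)"
  proof eventually_elim
    case (elim z)
    have "g \<odot> conjug g (\<psi> \<^bold>e z) = \<psi> \<^bold>e z \<odot> g" by (metis grp.assoc grp.right_inverse grp.left_neutral)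
    then show ?case using elim by (simp add: Ad_mult[symmetric])
  qed
  have d2: "((\<lambda>z. Ad G g (Ad G (\<psi> \<^bold>e z) \<eta>)) has_derivative (\<lambda>\<xi>. Ad G g (ad G \<xi> \<eta>))) (at c)"
    by (intro bounded_linear.has_derivative[OF Ad_linear] has_derivative_Ad_psi)
  have "(\<lambda>\<xi>. Ad G g (ad G \<xi> \<eta>)) = (\<lambda>\<xi>. ad G (Ad G g \<xi>) (Ad G g \<eta>))"
    using frechet_derivative_cong_ev[OF differentiableI[OF d1] ev]
    unfolding frechet_derivative_eq[OF d1] frechet_derivative_eq[OF d2] .
  then show ?thesis by (rule fun_cong)
qed

text \<open>\<open>Ad_ad\<close> differentiated in the group element at the identity in direction
  \<zeta>; the two terms on the right are those of the product rule.\<close>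

lemma jacobi: "ad G \<zeta> (ad G \<xi> \<eta>) = ad G (ad G \<zeta> \<xi>) \<eta> + ad G \<xi> (ad G \<zeta> \<eta>)"
proof -
  have "((\<lambda>z. ad G (Ad G (\<psi> \<^bold>e z) \<xi>) (Ad G (\<psi> \<^bold>e z) \<eta>)) has_derivative
      (\<lambda>\<zeta>. ad G (Ad G (\<psi> \<^bold>e c) \<xi>) (ad G \<zeta> \<eta>) + ad G (ad G \<zeta> \<xi>) (Ad G (\<psi> \<^bold>e c) \<eta>))) (at c)"
    by (rule ad.FDERIV[OF has_derivative_Ad_psi has_derivative_Ad_psi])
  then have "((\<lambda>z. Ad G (\<psi> \<^bold>e z) (ad G \<xi> \<eta>)) has_derivative
      (\<lambda>\<zeta>. ad G \<xi> (ad G \<zeta> \<eta>) + ad G (ad G \<zeta> \<xi>) \<eta>)) (at c)"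
    by (simp add: Ad_ad Ad_one)
  from has_derivative_unique[OF has_derivative_Ad_psi this]
  show ?thesis by (simp add: fun_eq_iff add.commute)
qed

end

section \<open>The symplectic form and Hamilton's equations\<close>

text \<open>A decomposition of the identity writes \<open>f\<close> as a sum of scalar functions
  \<open>k (f z)\<close> times fixed vectors. This fits \<open>\<delta>_\<mu>\<close> and
  \<open>\<delta>_\<nu>\<close>, which are given through their pairings.\<close>

lemma smooth_at_functionals:
  fixes f :: "'z::real_normed_vector \<Rightarrow> 'v::real_normed_vector"
  assumes "findim TYPE('v)" and f: "\<And>\<alpha> :: 'v \<Rightarrow>\<^sub>L real. smooth_at (\<lambda>z. blinfun_apply \<alpha> (f z)) z"
  shows "smooth_at f z"
proof -
  have "smooth_at (\<lambda>z. P (f z)) z" if "finrank P" for P :: "'v \<Rightarrow> 'v"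
    using that
  proof (induction P rule: finrank.induct)
    case (finrank_step P k b)
    have "smooth_at (\<lambda>z. k (f z)) z"
      using f[of "Blinfun k"] finrank_step.hyps(2) by (simp add: bounded_linear_Blinfun_apply)
    then show ?case
      by (intro smooth_at_add finrank_step.IH smooth_at_bilinear[OF bounded_bilinear_scaleR] smooth_at_const)
  qed (rule smooth_at_const)
  from this[OF assms(1)] show ?thesis .
qed

text \<open>By reflexivity every functional on the dual is evaluation at a vector, so evaluations
  are sufficient tests.\<close>

lemma smooth_at_dual:
  fixes f :: "'z::real_normed_vector \<Rightarrow> 'v::real_normed_vector \<Rightarrow>\<^sub>L real"
  assumes "findim TYPE('v)" and f: "\<And>v. smooth_at (\<lambda>z. blinfun_apply (f z) v) z"
  shows "smooth_at f z"
proof (rule smooth_at_functionals[OF findim_dual[OF assms(1)]])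
  fix \<alpha> :: "('v \<Rightarrow>\<^sub>L real) \<Rightarrow>\<^sub>L real"
  have "linear (blinfun_apply \<alpha>)" by (rule bounded_linear.linear[OF blinfun.bounded_linear_right])
  then obtain v where "\<And>\<beta>. blinfun_apply \<alpha> \<beta> = blinfun_apply \<beta> v"
    using findim_reflexive[OF assms(1)] by metis
  then show "smooth_at (\<lambda>z. blinfun_apply \<alpha> (f z)) z" using f by simp
qed

lemma dual_separates:
  fixes x y :: "'v::real_inner"
  assumes "\<And>\<alpha> :: 'v \<Rightarrow>\<^sub>L real. blinfun_apply \<alpha> x = blinfun_apply \<alpha> y"
  shows "x = y"
proof -
  have "blinfun_apply (Blinfun (\<lambda>w. w \<bullet> (x - y))) (x - y) = 0"
    using assms by (simp only: blinfun.diff_right)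
  then show ?thesis by (simp add: bounded_linear_Blinfun_apply bounded_linear_inner_left)
qed

lemma has_vector_derivative_Pair_iff:
  "((\<lambda>s. (f s, h s)) has_vector_derivative (a, b)) (at t) \<longleftrightarrow>
    (f has_vector_derivative a) (at t) \<and> (h has_vector_derivative b) (at t)"
  using bounded_linear.has_vector_derivative[OF bounded_linear_fst, of "\<lambda>s. (f s, h s)"]
    bounded_linear.has_vector_derivative[OF bounded_linear_snd, of "\<lambda>s. (f s, h s)"]
  by (auto intro: has_vector_derivative_Pair)

lemma isCont_Pair_iff: "isCont (\<lambda>s. (f s, h s)) t \<longleftrightarrow> isCont f t \<and> isCont h t"
  using isCont_fst[of t "\<lambda>s. (f s, h s)"] isCont_snd[of t "\<lambda>s. (f s, h s)"]
  by (auto intro: continuous_Pair)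

section \<open>The right invariant frame and nondegeneracy\<close>

context lie begin

text \<open>The inverse is the derivative of right translation by \<open>\<iota> g\<close>. One
  composite is an instance of \<open>chart_TR_right_translate\<close>; the other is the chain rule
  for a composite that is the identity near \<open>g\<close>.\<close>

lemma TR_bij: "bij (TR G g)"
proof (rule o_bij)
  let ?f = "\<lambda>z. \<phi> \<^bold>e (\<psi> g z \<odot> \<iota> g)" and ?h = "\<lambda>u. \<phi> g (\<psi> \<^bold>e u \<odot> g)"
  let ?A = "frechet_derivative ?f (at (\<phi> g g))"
  show "?A \<circ> TR G g = id"
    using chart_TR_right_translate[of g g "\<iota> g" "\<^bold>e"] by (auto simp: TR_eq_chart_TR chart_TR_one)
  have f: "smooth_at ?f (\<phi> g g)" by (rule smooth_at_right_mult) simp_all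
  have fc: "?f (\<phi> g g) = c" by simp
  have h: "smooth_at ?h (?f (\<phi> g g))" unfolding fc by (rule smooth_at_right_mult) simp_all
  have "\<forall>\<^sub>F z in nhds (\<phi> g g). \<psi> g z \<odot> \<iota> g \<in> U \<^bold>e"
    by (rule eventually_in_open[OF smooth_into_isCont[OF smooth_into_mult[OF smooth_into_psi smooth_into_const]] open_U]) auto
  moreover have "\<forall>\<^sub>F z in nhds (\<phi> g g). z \<in> V g"
    using open_V[of g] by (intro eventually_nhds_in_open) auto
  ultimately have ev: "\<forall>\<^sub>F z in nhds (\<phi> g g). z = ?h (?f z)"
    by eventually_elim (simp add: grp.assoc phi_psi)
  have "TR G g (?A v) = v" for v
    using smooth_at_derivative_compose[OF f h, of v] frechet_derivative_cong_ev[OF differentiable_ident ev]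
    unfolding TR_eq_chart_TR chart_TR_def fc by simp
  then show "TR G g \<circ> ?A = id" by auto
qed

lemma TR_linear: "bounded_linear (TR G g)"
  unfolding TR_eq_chart_TR by (rule chart_TR_linear) simp

lemma coad_apply [simp]: "blinfun_apply (coad G \<xi> \<mu>) \<eta> = blinfun_apply \<mu> (ad G \<xi> \<eta>)"
  unfolding coad_def
  by (subst bounded_linear_Blinfun_apply)
    (auto intro: bounded_linear_compose[OF blinfun.bounded_linear_right ad.bounded_linear_right])

lemma TR_dual_apply [simp]: "blinfun_apply (TR_dual G g \<alpha>) \<eta> = blinfun_apply \<alpha> (TR G g \<eta>)"
  unfolding TR_dual_def
  by (subst bounded_linear_Blinfun_apply)
    (auto intro: bounded_linear_compose[OF blinfun.bounded_linear_right TR_linear])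

lemma rinv_field_inject: "rinv_field G a p = rinv_field G b p \<longleftrightarrow> a = b"
proof
  assume "rinv_field G a p = rinv_field G b p"
  then show "a = b"
    by (cases a; cases b; cases p) (auto simp: inj_eq[OF bij_is_inj[OF TR_bij]])
qed simp

text \<open>A triangular system: the first component determines \<open>a1\<close>, which enters all
  the others, and \<open>a2\<close> enters the fourth.\<close>

lemma rinv_field_surj: obtains a where "v = rinv_field G a p"
proof -
  obtain v1 v2 v3 v4 where v: "v = (v1, v2, v3, v4)" by (cases v)
  obtain g \<mu> \<xi> \<nu> where p: "p = (g, \<mu>, \<xi>, \<nu>)" by (cases p)
  obtain a1 where a1: "v1 = TR G g a1" using bij_is_surj[OF TR_bij] by (metis surjD)
  define a2 where "a2 = v2 - coad G a1 \<mu>"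
  show ?thesis
    by (rule that[of "(a1, a2, v3 - ad G \<xi> a1, v4 - coad G a1 \<nu> + coad G \<xi> a2)"])
      (simp add: v p a1 a2_def)
qed

lemma symplectic_form_rinv_field:
  "symplectic_form G p (rinv_field G a p) (rinv_field G b p) = symplectic_on_generators G p a b"
  by (simp add: symplectic_form_def rinv_field_inject)

text \<open>Triangular as well. Test generators with one nonzero component read off the first and
  third components directly, then the second and the fourth up to terms already known to
  agree.\<close>

lemma symplectic_nondegenerate:
  assumes "\<And>b. symplectic_on_generators G p a b = symplectic_on_generators G p a' b"
  shows "a = a'"
proof -
  obtain g \<mu> \<xi> \<nu> where p: "p = (g, \<mu>, \<xi>, \<nu>)" by (cases p)
  obtain a1 a2 a3 a4 where a: "a = (a1, a2, a3, a4)" by (cases a)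
  obtain b1 b2 b3 b4 where a': "a' = (b1, b2, b3, b4)" by (cases a')
  note simps = p a a' ad.zero_right blinfun.zero_left blinfun.zero_right
  have 1: "a1 = b1"
    by (rule dual_separates) (use assms[of "(0, 0, 0, _)"] in \<open>simp add: simps\<close>)
  have 3: "a3 = b3"
    by (rule dual_separates) (use assms[of "(0, _, 0, 0)"] in \<open>simp add: simps\<close>)
  have 2: "a2 = b2"
    by (rule blinfun_eqI) (use assms[of "(0, 0, _, 0)"] 1 in \<open>simp add: simps\<close>)
  have 4: "a4 = b4"
    by (rule blinfun_eqI) (use assms[of "(_, 0, 0, 0)"] 1 2 3 in \<open>simp add: simps\<close>)
  show ?thesis using 1 2 3 4 by (simp add: a a')
qed

end

declare \<delta>_g.simps [simp del] \<delta>_\<mu>.simps [simp del] \<delta>_\<xi>.simps [simp del] \<delta>_\<nu>.simps [simp del]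

section \<open>Derivatives of the energy in a fixed chart\<close>

locale lie_energy = lie G
  for G :: "('a::{t2_space, second_countable_topology}, 'e::{real_inner, banach}) lie_group_data" +
  fixes E :: "('a, 'e) TTdual \<Rightarrow> real"
  assumes energy: "smooth_map (TT_charts G) vec_charts E"
begin

text \<open>The differential of \<open>E\<close> in the chart over \<open>a\<close>, where
  \<open>z\<close> collects all four coordinates. Since \<open>a\<close> stays put while
  \<open>z\<close> moves, it can be shown smooth in \<open>z\<close>, and the partial derivatives
  are restrictions of it.\<close>

definition DE :: "'a \<Rightarrow> 'e TT_tangent \<Rightarrow> 'e TT_tangent \<Rightarrow> real" where
  "DE a z = frechet_derivative (\<lambda>z. E (\<psi> a (fst z), snd z)) (at z)"

lemma DE_linear: "fst z \<in> V a \<Longrightarrow> bounded_linear (DE a z)"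
  unfolding DE_def by (intro frechet_derivative_linear smooth_at_differentiable smooth_energy_chart energy)

lemma DE_compose:
  assumes "fst z \<in> V a" "z = f x" "smooth_at f x"
  shows "((\<lambda>x. E (\<psi> a (fst (f x)), snd (f x))) has_derivative
      (\<lambda>v. DE a z (frechet_derivative f (at x) v))) (at x)"
proof -
  have "smooth_at (\<lambda>z. E (\<psi> a (fst z), snd z)) z" by (intro smooth_energy_chart energy assms(1))
  then show ?thesis
    using has_derivative_compose[OF smooth_at_has_derivative[OF assms(3)],
        of "\<lambda>z. E (\<psi> a (fst z), snd z)" "DE a z"] smooth_at_has_derivative
    unfolding DE_def assms(2) by blast
qed

lemma DE_compose_eq:
  assumes "fst z \<in> V a" "z = f x" "(f has_derivative f') (at x)" "smooth_at f x"
  shows "frechet_derivative (\<lambda>x. E (\<psi> a (fst (f x)), snd (f x))) (at x) v = DE a z (f' v)"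
  using DE_compose[OF assms(1,2,4)] by (simp add: frechet_derivative_eq[OF assms(3)] frechet_derivative_eq)

text \<open>The base point ranges over the whole chart domain, as smoothness in it will require.
  \<open>findim_reflexive\<close> provides the vector described by the definite description,
  \<open>dual_separates\<close> its uniqueness.\<close>

lemma delta_mu:
  assumes u: "u \<in> V a"
  shows "blinfun_apply \<alpha> (\<delta>_\<mu> E (\<psi> a u, \<mu>, \<xi>, \<nu>)) = DE a (u, \<mu>, \<xi>, \<nu>) (0, \<alpha>, 0, 0)"
proof -
  let ?f = "\<lambda>m. (u, m, \<xi>, \<nu>)"
  have f': "(?f has_derivative (\<lambda>\<alpha>. (0, \<alpha>, 0, 0))) (at \<mu>)"
    by (intro has_derivative_Pair has_derivative_const has_derivative_ident)
  have d: "frechet_derivative (\<lambda>m. E (\<psi> a u, m, \<xi>, \<nu>)) (at \<mu>) \<alpha> = DE a (u, \<mu>, \<xi>, \<nu>) (0, \<alpha>, 0, 0)" for \<alpha>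
    using DE_compose_eq[OF _ _ f', of "(u, \<mu>, \<xi>, \<nu>)" a \<alpha>] u
    by (simp add: smooth_at_Pair smooth_at_const smooth_at_ident)
  have "linear (\<lambda>\<alpha>. DE a (u, \<mu>, \<xi>, \<nu>) (0, \<alpha>, 0, 0))"
    by (intro bounded_linear.linear bounded_linear_compose[OF DE_linear] bounded_linear_Pair
        bounded_linear_zero bounded_linear_ident) (simp add: u)
  then obtain x where x: "\<And>\<alpha>. DE a (u, \<mu>, \<xi>, \<nu>) (0, \<alpha>, 0, 0) = blinfun_apply \<alpha> x"
    using findim_reflexive[OF findim_model] by metis
  have "\<delta>_\<mu> E (\<psi> a u, \<mu>, \<xi>, \<nu>) = x"
    unfolding \<delta>_\<mu>.simps d x by (rule the_equality) (auto intro: dual_separates)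
  then show ?thesis by (simp add: x)
qed

lemma delta_nu:
  assumes u: "u \<in> V a"
  shows "blinfun_apply \<alpha> (\<delta>_\<nu> E (\<psi> a u, \<mu>, \<xi>, \<nu>)) = DE a (u, \<mu>, \<xi>, \<nu>) (0, 0, 0, \<alpha>)"
proof -
  let ?f = "\<lambda>n. (u, \<mu>, \<xi>, n)"
  have f': "(?f has_derivative (\<lambda>\<alpha>. (0, 0, 0, \<alpha>))) (at \<nu>)"
    by (intro has_derivative_Pair has_derivative_const has_derivative_ident)
  have d: "frechet_derivative (\<lambda>n. E (\<psi> a u, \<mu>, \<xi>, n)) (at \<nu>) \<alpha> = DE a (u, \<mu>, \<xi>, \<nu>) (0, 0, 0, \<alpha>)" for \<alpha>
    using DE_compose_eq[OF _ _ f', of "(u, \<mu>, \<xi>, \<nu>)" a \<alpha>] u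
    by (simp add: smooth_at_Pair smooth_at_const smooth_at_ident)
  have "linear (\<lambda>\<alpha>. DE a (u, \<mu>, \<xi>, \<nu>) (0, 0, 0, \<alpha>))"
    by (intro bounded_linear.linear bounded_linear_compose[OF DE_linear] bounded_linear_Pair
        bounded_linear_zero bounded_linear_ident) (simp add: u)
  then obtain x where x: "\<And>\<alpha>. DE a (u, \<mu>, \<xi>, \<nu>) (0, 0, 0, \<alpha>) = blinfun_apply \<alpha> x"
    using findim_reflexive[OF findim_model] by metis
  have "\<delta>_\<nu> E (\<psi> a u, \<mu>, \<xi>, \<nu>) = x"
    unfolding \<delta>_\<nu>.simps d x by (rule the_equality) (auto intro: dual_separates)
  then show ?thesis by (simp add: x)
qed

lemma delta_xi:
  assumes u: "u \<in> V a"
  shows "blinfun_apply (\<delta>_\<xi> E (\<psi> a u, \<mu>, \<xi>, \<nu>)) \<eta> = DE a (u, \<mu>, \<xi>, \<nu>) (0, 0, \<eta>, 0)"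
proof -
  let ?f = "\<lambda>x. (u, \<mu>, x, \<nu>)"
  have f': "(?f has_derivative (\<lambda>\<eta>. (0, 0, \<eta>, 0))) (at \<xi>)"
    by (intro has_derivative_Pair has_derivative_const has_derivative_ident)
  have "frechet_derivative (\<lambda>x. E (\<psi> a u, \<mu>, x, \<nu>)) (at \<xi>) \<eta> = DE a (u, \<mu>, \<xi>, \<nu>) (0, 0, \<eta>, 0)" for \<eta>
    using DE_compose_eq[OF _ _ f', of "(u, \<mu>, \<xi>, \<nu>)" a \<eta>] u
    by (simp add: smooth_at_Pair smooth_at_const smooth_at_ident)
  then have d: "frechet_derivative (\<lambda>x. E (\<psi> a u, \<mu>, x, \<nu>)) (at \<xi>)
      = (\<lambda>\<eta>. DE a (u, \<mu>, \<xi>, \<nu>) (0, 0, \<eta>, 0))" by blast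
  have "bounded_linear (\<lambda>\<eta>. DE a (u, \<mu>, \<xi>, \<nu>) (0, 0, \<eta>, 0))"
    by (intro bounded_linear_compose[OF DE_linear] bounded_linear_Pair
        bounded_linear_zero bounded_linear_ident) (simp add: u)
  then show ?thesis unfolding \<delta>_\<xi>.simps d by (simp add: bounded_linear_Blinfun_apply)
qed

text \<open>Restricted to the centre of the chart at \<open>g\<close>, because
  \<open>\<delta>_g\<close> is a covector in the coordinates of that very chart.\<close>

lemma delta_g:
  "blinfun_apply (\<delta>_g G E (g, \<mu>, \<xi>, \<nu>)) v = DE g (\<phi> g g, \<mu>, \<xi>, \<nu>) (v, 0, 0, 0)"
proof -
  let ?f = "\<lambda>x. (x, \<mu>, \<xi>, \<nu>)"
  have f': "(?f has_derivative (\<lambda>v. (v, 0, 0, 0))) (at (\<phi> g g))"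
    by (intro has_derivative_Pair has_derivative_const has_derivative_ident)
  have "frechet_derivative (\<lambda>x. E (\<psi> g x, \<mu>, \<xi>, \<nu>)) (at (\<phi> g g)) v
      = DE g (\<phi> g g, \<mu>, \<xi>, \<nu>) (v, 0, 0, 0)" for v
    using DE_compose_eq[OF _ _ f', of "(\<phi> g g, \<mu>, \<xi>, \<nu>)" g v]
    by (simp add: smooth_at_Pair smooth_at_const smooth_at_ident)
  then have d: "tangent_map (charts G) vec_charts (\<lambda>h. E (h, \<mu>, \<xi>, \<nu>)) g
      = (\<lambda>v. DE g (\<phi> g g, \<mu>, \<xi>, \<nu>) (v, 0, 0, 0))"
    by (simp add: tangent_map_def vec_charts_def comp_def fun_eq_iff)
  have "bounded_linear (\<lambda>v. DE g (\<phi> g g, \<mu>, \<xi>, \<nu>) (v, 0, 0, 0))"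
    by (intro bounded_linear_compose[OF DE_linear] bounded_linear_Pair
        bounded_linear_zero bounded_linear_ident) simp
  then show ?thesis unfolding \<delta>_g.simps d by (simp add: bounded_linear_Blinfun_apply)
qed

text \<open>The left side does not mention \<open>a\<close>, so two instances compare the derivative
  of \<open>E\<close> along a right invariant field in two charts.\<close>

lemma DE_chart_TR_eq:
  assumes "g \<in> U a"
  shows "frechet_derivative (\<lambda>h. E (\<psi> \<^bold>e h \<odot> g, \<mu>, \<xi>, \<nu>)) (at c) \<eta>
    = DE a (\<phi> a g, \<mu>, \<xi>, \<nu>) (chart_TR a g \<eta>, 0, 0, 0)"
proof -
  let ?r = "\<lambda>h. \<phi> a (\<psi> \<^bold>e h \<odot> g)"
  let ?f = "\<lambda>h. (?r h, \<mu>, \<xi>, \<nu>)"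
  have m: "smooth_into (\<lambda>h. \<psi> \<^bold>e h \<odot> g) c" by (rule smooth_into_mult[OF smooth_into_psi smooth_into_const]) simp
  have r: "smooth_at ?r c" by (rule smooth_intoD[OF m]) (simp add: assms)
  have f: "smooth_at ?f c" by (intro smooth_at_Pair smooth_at_const r)
  have f': "(?f has_derivative (\<lambda>\<eta>. (chart_TR a g \<eta>, 0, 0, 0))) (at c)"
    unfolding chart_TR_def by (intro has_derivative_Pair has_derivative_const smooth_at_has_derivative r)
  have "\<forall>\<^sub>F h in nhds c. \<psi> \<^bold>e h \<odot> g \<in> U a"
    by (rule eventually_in_open[OF smooth_into_isCont[OF m] open_U]) (simp add: assms)
  then have ev: "\<forall>\<^sub>F h in nhds c. E (\<psi> a (fst (?f h)), snd (?f h)) = E (\<psi> \<^bold>e h \<odot> g, \<mu>, \<xi>, \<nu>)"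
    by (rule eventually_mono) simp
  have z: "fst (\<phi> a g, \<mu>, \<xi>, \<nu>) \<in> V a" "(\<phi> a g, \<mu>, \<xi>, \<nu>) = ?f c" using assms by simp_all
  have "frechet_derivative (\<lambda>h. E (\<psi> \<^bold>e h \<odot> g, \<mu>, \<xi>, \<nu>)) (at c)
      = frechet_derivative (\<lambda>h. E (\<psi> a (fst (?f h)), snd (?f h))) (at c)"
    by (rule frechet_derivative_cong_ev[OF differentiableI[OF DE_compose[OF z f]] ev])
  then show ?thesis using DE_compose_eq[OF z f' f, of \<eta>] by simp
qed

text \<open>Pulled back to the identity, the covector no longer depends on the chart at the base
  point: \<open>DE_chart_TR_eq\<close> is applied with the charts at \<open>a\<close> and at
  \<open>\<psi> a u\<close>.\<close>

lemma TR_dual_delta_g: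
  assumes u: "u \<in> V a"
  shows "blinfun_apply (TR_dual G (\<psi> a u) (\<delta>_g G E (\<psi> a u, \<mu>, \<xi>, \<nu>))) \<eta>
    = DE a (u, \<mu>, \<xi>, \<nu>) (chart_TR a (\<psi> a u) \<eta>, 0, 0, 0)"
  using DE_chart_TR_eq[of "\<psi> a u" a \<mu> \<xi> \<nu> \<eta>] DE_chart_TR_eq[of "\<psi> a u" "\<psi> a u" \<mu> \<xi> \<nu> \<eta>] u
  by (simp add: delta_g TR_eq_chart_TR psi_in phi_psi)

lemma differential_eq:
  "differential G E (g, \<mu>, \<xi>, \<nu>) (v1, v2, v3, v4) =
    blinfun_apply (\<delta>_g G E (g, \<mu>, \<xi>, \<nu>)) v1 + blinfun_apply v2 (\<delta>_\<mu> E (g, \<mu>, \<xi>, \<nu>))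
    + blinfun_apply (\<delta>_\<xi> E (g, \<mu>, \<xi>, \<nu>)) v3 + blinfun_apply v4 (\<delta>_\<nu> E (g, \<mu>, \<xi>, \<nu>))"
proof -
  let ?z = "(\<phi> g g, \<mu>, \<xi>, \<nu>)" and ?p = "(g, \<mu>, \<xi>, \<nu>)"
  have "smooth_at (\<lambda>z. E (\<psi> g (fst z), snd z)) ?z" by (intro smooth_energy_chart energy) simp
  moreover have "\<forall>\<^sub>F z in nhds ?z. z \<in> V g \<times> UNIV"
    by (intro eventually_nhds_in_open open_Times open_V open_UNIV) simp
  then have "\<forall>\<^sub>F z in nhds ?z. E (\<psi> g (fst z), snd z) = E (chart_inv (TT_charts G) ?p z)"
    by (rule eventually_mono) (simp add: TT_chart_inv)
  ultimately have "differential G E ?p = DE g ?z"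
    unfolding differential_def tangent_map_def DE_def
    using frechet_derivative_cong_ev[OF smooth_at_differentiable]
    by (simp add: vec_charts_def comp_def TT_chart)
  moreover have "(v1, v2, v3, v4) = (v1, 0, 0, 0) + (0, v2, 0, 0) + (0, 0, v3, 0) + (0, 0, 0, v4)" by simp
  moreover have "linear (DE g ?z)" by (intro bounded_linear.linear DE_linear) simp
  moreover have u: "\<phi> g g \<in> V g" by simp
  ultimately show ?thesis
    using delta_mu[OF u, of v2 \<mu> \<xi> \<nu>] delta_nu[OF u, of v4 \<mu> \<xi> \<nu>] delta_xi[OF u, of \<mu> \<xi> \<nu> v3]
    by (simp only: linear_add delta_g psi_phi in_U)
qed

section \<open>The Hamiltonian vector field\<close>

fun ham_generator :: "('a, 'e) TTdual \<Rightarrow> 'e TT_algebra" where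
  "ham_generator (g, \<mu>, \<xi>, \<nu>) = (let p = (g, \<mu>, \<xi>, \<nu>) in
    (\<delta>_\<nu> E p,
     - (\<delta>_\<xi> E p + coad G (\<delta>_\<nu> E p) \<mu>),
     \<delta>_\<mu> E p - ad G \<xi> (\<delta>_\<nu> E p),
     - (TR_dual G g (\<delta>_g G E p) + coad G \<xi> (\<delta>_\<xi> E p) + coad G \<xi> (coad G (\<delta>_\<nu> E p) \<mu>))))"

fun ham_field :: "('a, 'e) TTdual \<Rightarrow> 'e TT_tangent" where
  "ham_field (g, \<mu>, \<xi>, \<nu>) = (let p = (g, \<mu>, \<xi>, \<nu>) in
    (TR G g (\<delta>_\<nu> E p), - \<delta>_\<xi> E p, \<delta>_\<mu> E p, coad G (\<delta>_\<nu> E p) \<nu> - TR_dual G g (\<delta>_g G E p)))"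

text \<open>The \<open>ad\<close> and \<open>coad\<close> terms of the generator cancel against the
  corrections in \<open>rinv_field\<close>, and only
  \<open>coad G (\<delta>_\<nu> E p) \<nu>\<close> survives.\<close>

lemma rinv_field_ham_generator: "rinv_field G (ham_generator p) p = ham_field p"
proof -
  obtain g \<mu> \<xi> \<nu> where p: "p = (g, \<mu>, \<xi>, \<nu>)" by (cases p)
  have "coad G \<xi> (- (\<alpha> + \<beta>)) = - (coad G \<xi> \<alpha> + coad G \<xi> \<beta>)" for \<alpha> \<beta>
    by (rule blinfun_eqI) (simp add: blinfun.bilinear_simps)
  then show ?thesis by (simp add: p Let_def)
qed

text \<open>The triple brackets paired with \<mu> cancel by the Jacobi instance \<open>J\<close>;
  the brackets of \<open>b1\<close> with \<open>?n\<close> and \<open>?m\<close>, which occur in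
  opposite orders on the two sides, match by \<open>A\<close>.\<close>

lemma ham_generator_symplectic:
  "symplectic_on_generators G p (ham_generator p) b = - differential G E p (rinv_field G b p)"
proof -
  obtain g \<mu> \<xi> \<nu> where p: "p = (g, \<mu>, \<xi>, \<nu>)" by (cases p)
  obtain b1 b2 b3 b4 where b: "b = (b1, b2, b3, b4)" by (cases b)
  let ?n = "\<delta>_\<nu> E p" and ?m = "\<delta>_\<mu> E p"
  have J: "ad G \<xi> (ad G ?n b1) = ad G (ad G \<xi> ?n) b1 + ad G ?n (ad G \<xi> b1)" by (rule jacobi)
  have A: "ad G b1 ?n = - ad G ?n b1" "ad G b1 ?m = - ad G ?m b1" by (rule ad_antisym)+
  show ?thesis
    using J A
    by (simp add: p b Let_def differential_eq blinfun.bilinear_simps ad.diff_left ad.add_left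
        ad.add_right algebra_simps)
qed

lemma ham_field_unique:
  assumes "hamiltonian_vector_field G E X"
  shows "X p = ham_field p"
proof -
  obtain a where a: "X p = rinv_field G a p" by (rule rinv_field_surj)
  have "symplectic_on_generators G p a b = symplectic_on_generators G p (ham_generator p) b" for b
    using assms unfolding hamiltonian_vector_field_def
    by (metis a symplectic_form_rinv_field ham_generator_symplectic)
  then have "a = ham_generator p" by (rule symplectic_nondegenerate)
  then show ?thesis by (simp add: a rinv_field_ham_generator)
qed

lemma smooth_at_DE:
  assumes "fst z \<in> V a" "smooth_at v z"
  shows "smooth_at (\<lambda>z. DE a z (v z)) z"
  unfolding DE_def
  by (rule smooth_at_derivative[OF findim_TT smooth_at_ident smooth_energy_chart[OF energy assms(1)] assms(2)])

text \<open>In the fixed chart at \<open>y\<close> the components are assembled from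
  \<open>DE\<close>, \<open>chart_TR\<close> and the bracket, so each becomes smooth after pairing
  with a constant functional or vector.\<close>

lemma ham_field_smooth: "smooth_vector_field (TT_charts G) ham_field"
  unfolding smooth_vector_field_def
proof
  fix y :: "('a, 'e) TTdual"
  define a where "a = fst y"
  let ?W = "V a \<times> (UNIV :: ('e dual \<times> 'e \<times> 'e dual) set)"
  let ?p = "\<lambda>z :: 'e TT_tangent. (\<psi> a (fst z), snd z)"
  have W: "open ?W" by (intro open_Times open_V open_UNIV)
  \<comment> \<open>The field in the chart at \<open>y\<close>. The three linear factors have a
    global chart, so the change of chart only replaces \<open>TR\<close> by
    \<open>chart_TR a\<close> in the first component.\<close>
  let ?Y = "\<lambda>z. (chart_TR a (\<psi> a (fst z)) (\<delta>_\<nu> E (?p z)), - \<delta>_\<xi> E (?p z), \<delta>_\<mu> E (?p z),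
      coad G (\<delta>_\<nu> E (?p z)) (snd (snd (snd z))) - TR_dual G (\<psi> a (fst z)) (\<delta>_g G E (?p z)))"
  have eq: "?Y z = (let x = chart_inv (TT_charts G) y z in
      frechet_derivative (chart (TT_charts G) y \<circ> chart_inv (TT_charts G) x)
        (at (chart (TT_charts G) x x)) (ham_field x))" if z: "z \<in> ?W" for z
  proof -
    obtain u \<mu> \<xi> \<nu> where zz: "z = (u, \<mu>, \<xi>, \<nu>)" by (cases z)
    have u: "u \<in> V a" using z by (simp add: zz)
    define g where "g = \<psi> a u"
    have g: "g \<in> U a" using u by (simp add: g_def psi_in)
    let ?x = "(g, \<mu>, \<xi>, \<nu>)"
    have x: "chart_inv (TT_charts G) y z = ?x"
      using TT_chart_inv[of z y] z by (simp add: a_def zz g_def)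
    let ?t = "\<lambda>w. \<phi> a (\<psi> g w)"
    let ?q = "(\<phi> g g, \<mu>, \<xi>, \<nu>)"
    have q: "chart (TT_charts G) ?x ?x = ?q" by (simp add: TT_chart)
    have t: "(?t has_derivative frechet_derivative ?t (at (\<phi> g g))) (at (fst ?q))"
      using smooth_at_has_derivative[OF smooth_transition] g by simp
    have "((\<lambda>w. ?t (fst w)) has_derivative (\<lambda>v. frechet_derivative ?t (at (\<phi> g g)) (fst v))) (at ?q)"
      by (rule has_derivative_compose[where f = fst and g = ?t, OF _ t])
        (rule has_derivative_fst[OF has_derivative_ident])
    then have d: "((\<lambda>w. (?t (fst w), snd w)) has_derivative
        (\<lambda>v. (frechet_derivative ?t (at (\<phi> g g)) (fst v), snd v))) (at ?q)"
      by (intro has_derivative_Pair has_derivative_snd has_derivative_ident)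
    have "\<forall>\<^sub>F w in nhds ?q. w \<in> V g \<times> UNIV"
      by (intro eventually_nhds_in_open open_Times open_V open_UNIV) simp
    then have ev: "\<forall>\<^sub>F w in nhds ?q.
        (?t (fst w), snd w) = (chart (TT_charts G) y \<circ> chart_inv (TT_charts G) ?x) w"
    proof (rule eventually_mono)
      fix w :: "'e TT_tangent"
      assume "w \<in> V g \<times> UNIV"
      then have "chart_inv (TT_charts G) ?x w = (\<psi> g (fst w), snd w)"
        using TT_chart_inv[of w ?x] by simp
      then show "(?t (fst w), snd w) = (chart (TT_charts G) y \<circ> chart_inv (TT_charts G) ?x) w"
        unfolding comp_apply by (simp only: TT_chart[of y]) (simp add: a_def)
    qed
    have "frechet_derivative (chart (TT_charts G) y \<circ> chart_inv (TT_charts G) ?x) (at ?q)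
        = (\<lambda>v. (frechet_derivative ?t (at (\<phi> g g)) (fst v), snd v))"
      using frechet_derivative_cong_ev[OF differentiableI[OF d] ev] frechet_derivative_eq[OF d]
      by (simp add: comp_def)
    then show ?thesis
      unfolding x Let_def q using chart_TR_change_chart[of g g a] g
      by (simp add: zz g_def[symmetric] TR_eq_chart_TR Let_def)
  qed
  have "smooth_at ?Y z" if z: "z \<in> ?W" for z
  proof -
    have z1: "fst z \<in> V a" using z by auto
    have ev: "\<forall>\<^sub>F w in nhds z. w \<in> ?W" using W z by (rule eventually_nhds_in_open)
    have cong: "smooth_at f z" if "smooth_at f' z" "\<And>w. w \<in> ?W \<Longrightarrow> f' w = f w"
      for f f' :: "'e TT_tangent \<Rightarrow> real"
      using that(1) by (rule smooth_at_cong) (use that(2) in \<open>auto intro: eventually_mono[OF ev]\<close>)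
    have delta_z: "blinfun_apply \<alpha> (\<delta>_\<nu> E (?p w)) = DE a w (0, 0, 0, \<alpha>)"
      "blinfun_apply \<alpha> (\<delta>_\<mu> E (?p w)) = DE a w (0, \<alpha>, 0, 0)"
      "blinfun_apply (\<delta>_\<xi> E (?p w)) \<eta> = DE a w (0, 0, \<eta>, 0)"
      "blinfun_apply (TR_dual G (\<psi> a (fst w)) (\<delta>_g G E (?p w))) \<eta>
        = DE a w (chart_TR a (\<psi> a (fst w)) \<eta>, 0, 0, 0)" if "w \<in> ?W" for w \<alpha> \<eta>
      using that
      by (cases w; simp only: mem_Times_iff fst_conv snd_conv delta_nu delta_mu delta_xi TR_dual_delta_g)+
    note sm = smooth_at_DE[OF z1] smooth_at_Pair smooth_at_const
    have psi: "smooth_into (\<lambda>z. \<psi> a (fst z)) z"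
      by (rule smooth_into_compose[OF findim_model smooth_at_fst[OF smooth_at_ident] smooth_into_psi[OF z1]])
    have nu: "smooth_at (\<lambda>z. \<delta>_\<nu> E (?p z)) z"
    proof (rule smooth_at_functionals[OF findim_model])
      fix \<alpha> :: "'e dual"
      show "smooth_at (\<lambda>z. blinfun_apply \<alpha> (\<delta>_\<nu> E (?p z))) z"
        by (rule cong[of "\<lambda>z. DE a z (0, 0, 0, \<alpha>)"]) (intro sm, simp add: delta_z)
    qed
    have mu: "smooth_at (\<lambda>z. \<delta>_\<mu> E (?p z)) z"
    proof (rule smooth_at_functionals[OF findim_model])
      fix \<alpha> :: "'e dual"
      show "smooth_at (\<lambda>z. blinfun_apply \<alpha> (\<delta>_\<mu> E (?p z))) z"
        by (rule cong[of "\<lambda>z. DE a z (0, \<alpha>, 0, 0)"]) (intro sm, simp add: delta_z)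
    qed
    have xi: "smooth_at (\<lambda>z. \<delta>_\<xi> E (?p z)) z"
    proof (rule smooth_at_dual[OF findim_model])
      fix \<eta> :: 'e
      show "smooth_at (\<lambda>z. blinfun_apply (\<delta>_\<xi> E (?p z)) \<eta>) z"
        by (rule cong[of "\<lambda>z. DE a z (0, 0, \<eta>, 0)"]) (intro sm, simp add: delta_z)
    qed
    \<comment> \<open>Here the direction moves with the point through \<open>chart_TR\<close>, so
      smoothness of \<open>DE\<close> jointly in point and direction is used.\<close>
    have g: "smooth_at (\<lambda>z. TR_dual G (\<psi> a (fst z)) (\<delta>_g G E (?p z))) z"
    proof (rule smooth_at_dual[OF findim_model])
      fix \<eta> :: 'e
      have t: "smooth_at (\<lambda>z. chart_TR a (\<psi> a (fst z)) \<eta>) z"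
        by (rule smooth_at_chart_TR[OF psi psi_in[OF z1] smooth_at_const])
      show "smooth_at (\<lambda>z. blinfun_apply (TR_dual G (\<psi> a (fst z)) (\<delta>_g G E (?p z))) \<eta>) z"
      proof (rule cong[of "\<lambda>z. DE a z (chart_TR a (\<psi> a (fst z)) \<eta>, 0, 0, 0)"])
        show "smooth_at (\<lambda>z. DE a z (chart_TR a (\<psi> a (fst z)) \<eta>, 0, 0, 0)) z"
          by (intro sm t)
        fix w assume "w \<in> ?W"
        then show "DE a w (chart_TR a (\<psi> a (fst w)) \<eta>, 0, 0, 0)
            = blinfun_apply (TR_dual G (\<psi> a (fst w)) (\<delta>_g G E (?p w))) \<eta>"
          by (simp only: delta_z(4))
      qed
    qed
    have coad: "smooth_at (\<lambda>z. coad G (\<delta>_\<nu> E (?p z)) (snd (snd (snd z)))) z"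
    proof (rule smooth_at_dual[OF findim_model])
      fix \<eta> :: 'e
      show "smooth_at (\<lambda>z. blinfun_apply (coad G (\<delta>_\<nu> E (?p z)) (snd (snd (snd z)))) \<eta>) z"
        unfolding coad_apply
        by (intro smooth_at_bilinear[OF bounded_bilinear_blinfun_apply] smooth_at_bilinear[OF ad_bilinear]
            smooth_at_snd smooth_at_ident smooth_at_const nu)
    qed
    show ?thesis
      by (intro smooth_at_Pair smooth_at_minus smooth_at_diff nu mu xi g coad
          smooth_at_chart_TR[OF psi psi_in[OF z1]])
  qed
  then have "smooth_on ?W ?Y" using W by (simp add: smooth_on_eq_smooth_at)
  then have "smooth_on ?W (\<lambda>z. let x = chart_inv (TT_charts G) y z in
      frechet_derivative (chart (TT_charts G) y \<circ> chart_inv (TT_charts G) x)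
        (at (chart (TT_charts G) x x)) (ham_field x))"
    by (rule smooth_on_cong[OF W eq, rotated])
  then show "smooth_on (chart (TT_charts G) y ` chart_dom (TT_charts G) y)
     (\<lambda>z. let x = chart_inv (TT_charts G) y z in
      frechet_derivative (chart (TT_charts G) y \<circ> chart_inv (TT_charts G) x)
        (at (chart (TT_charts G) x x)) (ham_field x))"
    by (simp only: TT_image a_def)
qed

lemma ham_field_hamiltonian: "hamiltonian_vector_field G E ham_field"
  unfolding hamiltonian_vector_field_def
proof (intro conjI ham_field_smooth allI)
  fix p v
  obtain b where "v = rinv_field G b p" by (rule rinv_field_surj)
  then show "symplectic_form G p (ham_field p) v = - differential G E p v"
    by (metis rinv_field_ham_generator symplectic_form_rinv_field ham_generator_symplectic)
qed

end

text \<open>Three factors carry the identity chart, where velocity is the ordinary derivative and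
  already implies the continuity demanded by \<open>has_velocity\<close>.\<close>

lemma (in lie) has_velocity_TT:
  "has_velocity (TT_charts G) (\<lambda>t. (g t, \<mu> t, \<xi> t, \<nu> t)) (v1, v2, v3, v4) t \<longleftrightarrow>
    has_velocity (charts G) g v1 t \<and> (\<mu> has_vector_derivative v2) (at t) \<and>
    (\<xi> has_vector_derivative v3) (at t) \<and> (\<nu> has_vector_derivative v4) (at t)"
  unfolding has_velocity_def isCont_Pair_iff
  by (auto simp: TT_chart comp_def has_vector_derivative_Pair_iff intro: has_vector_derivative_continuous)

theorem mainTheorem15:
  fixes G :: "('a::{t2_space, second_countable_topology}, 'e::{real_inner, banach}) lie_group_data"
    and E :: "('a, 'e) TTdual \<Rightarrow> real"
  assumes G: "lie_group G"
    and E: "smooth_map (TT_charts G) vec_charts E"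
  shows "(\<exists>!X. hamiltonian_vector_field G E X) \<and>
    (\<forall>X. hamiltonian_vector_field G E X \<longrightarrow>
      (\<forall>g \<mu> \<xi> \<nu>. let p = (g, \<mu>, \<xi>, \<nu>) in
        X p = rinv_field G
          (\<delta>_\<nu> E p,
           - (\<delta>_\<xi> E p + coad G (\<delta>_\<nu> E p) \<mu>),
           \<delta>_\<mu> E p - ad G \<xi> (\<delta>_\<nu> E p),
           - (TR_dual G g (\<delta>_g G E p) + coad G \<xi> (\<delta>_\<xi> E p)
              + coad G \<xi> (coad G (\<delta>_\<nu> E p) \<mu>))) p \<and>
        X p =
          (TR G g (\<delta>_\<nu> E p),
           - \<delta>_\<xi> E p,
           \<delta>_\<mu> E p,
           coad G (\<delta>_\<nu> E p) \<nu> - TR_dual G g (\<delta>_g G E p))) \<and>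
      (\<forall>J g \<mu> \<xi> \<nu>. open J \<longrightarrow>
        (integral_curve_on (TT_charts G) X J (\<lambda>t. (g t, \<mu> t, \<xi> t, \<nu> t)) \<longleftrightarrow>
         (\<forall>t\<in>J. let p = (g t, \<mu> t, \<xi> t, \<nu> t) in
           has_velocity (charts G) g (TR G (g t) (\<delta>_\<nu> E p)) t \<and>
           (\<mu> has_vector_derivative - \<delta>_\<xi> E p) (at t) \<and>
           (\<xi> has_vector_derivative \<delta>_\<mu> E p) (at t) \<and>
           (\<nu> has_vector_derivative
              coad G (\<delta>_\<nu> E p) (\<nu> t) - TR_dual G (g t) (\<delta>_g G E p)) (at t)))))"
proof -
  interpret lie_energy G E
    by (intro lie_energy.intro lie.intro lie_energy_axioms.intro G E)
  have ex1: "\<exists>!X. hamiltonian_vector_field G E X"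
  proof
    show "hamiltonian_vector_field G E ham_field" by (rule ham_field_hamiltonian)
    show "X = ham_field" if "hamiltonian_vector_field G E X" for X
      using ham_field_unique[OF that] by (rule ext)
  qed
  show ?thesis
  proof (intro conjI allI impI ex1)
    fix X assume "hamiltonian_vector_field G E X"
    then have X: "X p = ham_field p" for p by (rule ham_field_unique)
    show "let p = (g, \<mu>, \<xi>, \<nu>) in
        X p = rinv_field G
          (\<delta>_\<nu> E p,
           - (\<delta>_\<xi> E p + coad G (\<delta>_\<nu> E p) \<mu>),
           \<delta>_\<mu> E p - ad G \<xi> (\<delta>_\<nu> E p),
           - (TR_dual G g (\<delta>_g G E p) + coad G \<xi> (\<delta>_\<xi> E p)
              + coad G \<xi> (coad G (\<delta>_\<nu> E p) \<mu>))) p \<and>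
        X p =
          (TR G g (\<delta>_\<nu> E p),
           - \<delta>_\<xi> E p,
           \<delta>_\<mu> E p,
           coad G (\<delta>_\<nu> E p) \<nu> - TR_dual G g (\<delta>_g G E p))" for g \<mu> \<xi> \<nu>
      using rinv_field_ham_generator[of "(g, \<mu>, \<xi>, \<nu>)"]
      by (simp add: X Let_def del: rinv_field.simps)
    show "integral_curve_on (TT_charts G) X J (\<lambda>t. (g t, \<mu> t, \<xi> t, \<nu> t)) \<longleftrightarrow>
         (\<forall>t\<in>J. let p = (g t, \<mu> t, \<xi> t, \<nu> t) in
           has_velocity (charts G) g (TR G (g t) (\<delta>_\<nu> E p)) t \<and>
           (\<mu> has_vector_derivative - \<delta>_\<xi> E p) (at t) \<and>
           (\<xi> has_vector_derivative \<delta>_\<mu> E p) (at t) \<and>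
           (\<nu> has_vector_derivative
              coad G (\<delta>_\<nu> E p) (\<nu> t) - TR_dual G (g t) (\<delta>_g G E p)) (at t))" for J g \<mu> \<xi> \<nu>
      by (simp add: integral_curve_on_def X Let_def has_velocity_TT)
  qed
qed

end
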